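(* (i) There is an $S^1$ action on $S^2\times S^3$ that is not smoothly homotopic to the trivial action. (ii) The fundamental group $\pi_1(\mathrm{Diff}(S^2\times S^3),\mathrm{id})$ is infinite.
   Context: A (smooth) $S^1$ action on a closed manifold $M$ is a smooth map $a:S^1\times M\to M$ with $a(0,m)=m$ and $a(\theta,a(\psi,m))=a(\theta+\psi,m)$ (with $S^1=\mathbb R/2\pi\mathbb Z$); the trivial action is $a(\theta,m)=m$. Two actions $a_0,a_1:S^1\times M\to M$ are called smoothly homotopic if there is a smooth map $F:[0,1]\times S^1\times M\to M$ with $F(0,\theta,m)=a_0(\theta,m)$ and $F(1,\theta,m)=a_1(\theta,m)$ (the maps $F(t,\cdot,\cdot)$ are not required to be actions). $\mathrm{Diff}(M)$ is the group of diffeomorphisms of $M$, regarded as a Banach manifold as an open subset of the Banach manifold $\mathrm{Maps}(M,M)$ of maps of some fixed (large) Sobolev class. *)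

theory Defs
  imports "HOL-Analysis.Analysis" "HOL-Algebra.Group"
begin

section \<open>Smooth maps on subsets of Euclidean spaces\<close>

text \<open>Manifolds are subsets of Euclidean spaces; a map on such a subset is smooth if it
  extends locally to a smooth map on an open set. This covers the non-open domain
  \<open>{0..1} \<times> UNIV \<times> M\<close> of a homotopy as well.\<close>

primrec iter_deriv ::
  "'a::euclidean_space list \<Rightarrow> ('a \<Rightarrow> 'b::real_normed_vector) \<Rightarrow> 'a \<Rightarrow> 'b" where
  "iter_deriv [] f = f"
| "iter_deriv (v # vs) f = (\<lambda>x. frechet_derivative (iter_deriv vs f) (at x) v)"

definition smooth_on_open ::
  "'a::euclidean_space set \<Rightarrow> ('a \<Rightarrow> 'b::real_normed_vector) \<Rightarrow> bool" where
  "smooth_on_open U f \<longleftrightarrow>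
     open U \<and> (\<forall>vs. set vs \<subseteq> Basis \<longrightarrow> iter_deriv vs f differentiable_on U)"

definition smooth_on ::
  "'a::euclidean_space set \<Rightarrow> ('a \<Rightarrow> 'b::real_normed_vector) \<Rightarrow> bool" where
  "smooth_on S f \<longleftrightarrow>
     (\<forall>x\<in>S. \<exists>U g. x \<in> U \<and> smooth_on_open U g \<and> (\<forall>y\<in>S \<inter> U. g y = f y))"

definition S2xS3 :: "((real^3) \<times> (real^4)) set" where
  "S2xS3 = sphere 0 1 \<times> sphere 0 1"


section \<open>Circle actions\<close>

text \<open>A map on \<open>S\<^sup>1 = \<real>/2\<pi>\<int>\<close> is given by its \<open>2\<pi>\<close>-periodic lift to \<open>\<real>\<close>; since the projection
  \<open>\<real> \<rightarrow> S\<^sup>1\<close> is a local diffeomorphism, smoothness is that of the lift.\<close>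

definition S1_action ::
  "'a::euclidean_space set \<Rightarrow> (real \<Rightarrow> 'a \<Rightarrow> 'a) \<Rightarrow> bool" where
  "S1_action M a \<longleftrightarrow>
     smooth_on (UNIV \<times> M) (\<lambda>(\<theta>, m). a \<theta> m) \<and>
     (\<forall>\<theta>. \<forall>m\<in>M. a \<theta> m \<in> M \<and> a (\<theta> + 2 * pi) m = a \<theta> m) \<and>
     (\<forall>m\<in>M. a 0 m = m) \<and>
     (\<forall>\<theta> \<psi>. \<forall>m\<in>M. a \<theta> (a \<psi> m) = a (\<theta> + \<psi>) m)"

definition trivial_action :: "real \<Rightarrow> 'a \<Rightarrow> 'a" where
  "trivial_action \<theta> m = m"

definition smoothly_homotopic ::
  "'a::euclidean_space set \<Rightarrow> (real \<Rightarrow> 'a \<Rightarrow> 'a) \<Rightarrow> (real \<Rightarrow> 'a \<Rightarrow> 'a) \<Rightarrow> bool" where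
  "smoothly_homotopic M a\<^sub>0 a\<^sub>1 \<longleftrightarrow>
     (\<exists>F :: real \<Rightarrow> real \<Rightarrow> 'a \<Rightarrow> 'a.
        smooth_on ({0..1} \<times> UNIV \<times> M) (\<lambda>(t, \<theta>, m). F t \<theta> m) \<and>
        (\<forall>t\<in>{0..1}. \<forall>\<theta>. \<forall>m\<in>M. F t \<theta> m \<in> M \<and> F t (\<theta> + 2 * pi) m = F t \<theta> m) \<and>
        (\<forall>\<theta>. \<forall>m\<in>M. F 0 \<theta> m = a\<^sub>0 \<theta> m \<and> F 1 \<theta> m = a\<^sub>1 \<theta> m))"


section \<open>Sobolev spaces on open subsets of Euclidean spaces\<close>

definition test_function :: "'e::euclidean_space set \<Rightarrow> ('e \<Rightarrow> real) \<Rightarrow> bool" where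
  "test_function \<Omega> \<phi> \<longleftrightarrow> smooth_on_open UNIV \<phi> \<and>
     compact (closure {x. \<phi> x \<noteq> 0}) \<and> closure {x. \<phi> x \<noteq> 0} \<subseteq> \<Omega>"

definition L2_on :: "'e::euclidean_space set \<Rightarrow> ('e \<Rightarrow> 'f::euclidean_space) \<Rightarrow> bool" where
  "L2_on \<Omega> u \<longleftrightarrow> set_borel_measurable lborel \<Omega> u \<and>
     set_integrable lborel \<Omega> (\<lambda>x. (norm (u x))\<^sup>2)"

definition has_weak_deriv :: "'e::euclidean_space set \<Rightarrow> 'e list \<Rightarrow>
    ('e \<Rightarrow> 'f::euclidean_space) \<Rightarrow> ('e \<Rightarrow> 'f) \<Rightarrow> bool" where
  "has_weak_deriv \<Omega> vs u w \<longleftrightarrow>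
     (\<forall>\<phi>. test_function \<Omega> \<phi> \<longrightarrow>
        (LINT x:\<Omega>|lborel. iter_deriv vs \<phi> x *\<^sub>R u x) =
        (- 1) ^ length vs *\<^sub>R (LINT x:\<Omega>|lborel. \<phi> x *\<^sub>R w x))"

text \<open>Partial derivatives are indexed by lists of basis vectors instead of multi-indices. The
  norm below therefore counts a mixed derivative once for every ordering, which gives a norm
  equivalent to the usual one.\<close>

definition deriv_indices :: "nat \<Rightarrow> 'e::euclidean_space list set" where
  "deriv_indices k = {vs. set vs \<subseteq> Basis \<and> length vs \<le> k}"

definition sobolev :: "nat \<Rightarrow> 'e::euclidean_space set \<Rightarrow> ('e \<Rightarrow> 'f::euclidean_space) set" where
  "sobolev k \<Omega> = {u. L2_on \<Omega> u \<and>
     (\<forall>vs\<in>deriv_indices k. \<exists>w. L2_on \<Omega> w \<and> has_weak_deriv \<Omega> vs u w)}"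

text \<open>On an open set the weak derivative is unique up to a null set, so the norm does not depend
  on the choice.\<close>

definition weak_deriv :: "'e::euclidean_space set \<Rightarrow> 'e list \<Rightarrow>
    ('e \<Rightarrow> 'f::euclidean_space) \<Rightarrow> 'e \<Rightarrow> 'f" where
  "weak_deriv \<Omega> vs u = (SOME w. L2_on \<Omega> w \<and> has_weak_deriv \<Omega> vs u w)"

definition sobolev_norm ::
  "nat \<Rightarrow> 'e::euclidean_space set \<Rightarrow> ('e \<Rightarrow> 'f::euclidean_space) \<Rightarrow> real" where
  "sobolev_norm k \<Omega> u =
     sqrt (\<Sum>vs\<in>deriv_indices k. LINT x:\<Omega>|lborel. (norm (weak_deriv \<Omega> vs u x))\<^sup>2)"


section \<open>Maps and diffeomorphisms of Sobolev class\<close>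

definition charts ::
  "'a::euclidean_space set \<Rightarrow> ('a set \<times> ('a \<Rightarrow> 'e::euclidean_space)) set" where
  "charts M = {(U, \<phi>). openin (top_of_set M) U \<and> open (\<phi> ` U) \<and> inj_on \<phi> U \<and>
     smooth_on U \<phi> \<and> smooth_on (\<phi> ` U) (inv_into U \<phi>)}"

definition local_rep ::
  "'a set \<times> ('a \<Rightarrow> 'e) \<Rightarrow> 'a set \<times> ('a \<Rightarrow> 'e) \<Rightarrow> ('a \<Rightarrow> 'a) \<Rightarrow> 'e \<Rightarrow> 'e" where
  "local_rep c d f y = snd d (f (inv_into (fst c) (snd c) y))"

text \<open>The type argument is the Euclidean space on which \<open>M\<close> is modelled. The maps are those of
  class \<open>H\<^sup>k = W\<^bsup>k,2\<^esup>\<close>, where \<open>k > dim M / 2\<close> is understood, so that they are continuous.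
  They are made undefined outside \<open>M\<close>, so that a map on \<open>M\<close> is represented exactly once.\<close>

definition sobolev_maps ::
  "'e::euclidean_space itself \<Rightarrow> nat \<Rightarrow> 'a::euclidean_space set \<Rightarrow> ('a \<Rightarrow> 'a) set" where
  "sobolev_maps E k M = {f \<in> M \<rightarrow>\<^sub>E M. continuous_on M f \<and>
     (\<forall>x\<in>M. \<exists>c\<in>charts M. \<exists>d\<in>charts M. x \<in> fst c \<and> f ` fst c \<subseteq> fst d \<and>
        (local_rep c d f :: 'e \<Rightarrow> 'e) \<in> sobolev k (snd c ` fst c))}"

text \<open>The topology of the Banach manifold of maps: the \<open>H\<^sup>k\<close> analogue of the \<open>C\<^sup>k\<close> topology. A
  subbasic neighbourhood of \<open>f\<close> is given by charts \<open>c\<close>, \<open>d\<close>, a compact subset \<open>K\<close> of the domain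
  of \<open>c\<close> which \<open>f\<close> maps into the domain of \<open>d\<close>, and \<open>\<epsilon> > 0\<close>.\<close>

definition sobolev_nbhd :: "nat \<Rightarrow> 'a::euclidean_space set \<Rightarrow>
    'a set \<times> ('a \<Rightarrow> 'e::euclidean_space) \<Rightarrow> 'a set \<times> ('a \<Rightarrow> 'e) \<Rightarrow> 'a set \<Rightarrow> real \<Rightarrow>
    ('a \<Rightarrow> 'a) \<Rightarrow> ('a \<Rightarrow> 'a) set" where
  "sobolev_nbhd k M c d K \<epsilon> f = {g \<in> sobolev_maps TYPE('e) k M. g ` K \<subseteq> fst d \<and>
     (\<lambda>y. local_rep c d g y - local_rep c d f y) \<in> sobolev k (interior (snd c ` K)) \<and>
     sobolev_norm k (interior (snd c ` K)) (\<lambda>y. local_rep c d g y - local_rep c d f y) < \<epsilon>}"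

definition sobolev_maps_topology ::
  "'e::euclidean_space itself \<Rightarrow> nat \<Rightarrow> 'a::euclidean_space set \<Rightarrow> ('a \<Rightarrow> 'a) topology" where
  "sobolev_maps_topology E k M = topology_generated_by
     {sobolev_nbhd k M c d K \<epsilon> f | (c :: 'a set \<times> ('a \<Rightarrow> 'e)) d K \<epsilon> f.
        f \<in> sobolev_maps E k M \<and> c \<in> charts M \<and> d \<in> charts M \<and>
        compact K \<and> K \<subseteq> fst c \<and> f ` K \<subseteq> fst d \<and> \<epsilon> > 0}"

definition Diff ::
  "'e::euclidean_space itself \<Rightarrow> nat \<Rightarrow> 'a::euclidean_space set \<Rightarrow> ('a \<Rightarrow> 'a) set" where
  "Diff E k M = {f \<in> sobolev_maps E k M. bij_betw f M M \<and>
     restrict (inv_into M f) M \<in> sobolev_maps E k M}"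

definition Diff_topology ::
  "'e::euclidean_space itself \<Rightarrow> nat \<Rightarrow> 'a::euclidean_space set \<Rightarrow> ('a \<Rightarrow> 'a) topology" where
  "Diff_topology E k M = subtopology (sobolev_maps_topology E k M) (Diff E k M)"


section \<open>The fundamental group\<close>

definition loops :: "'x topology \<Rightarrow> 'x \<Rightarrow> (real \<Rightarrow> 'x) set" where
  "loops X x = {p. pathin X p \<and> p 0 = x \<and> p 1 = x}"

definition loop_rel :: "'x topology \<Rightarrow> 'x \<Rightarrow> ((real \<Rightarrow> 'x) \<times> (real \<Rightarrow> 'x)) set" where
  "loop_rel X x = {(p, q). p \<in> loops X x \<and> q \<in> loops X x \<and>
     homotopic_with (\<lambda>r. r 0 = x \<and> r 1 = x) (top_of_set {0..1}) X p q}"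

definition loop_join :: "(real \<Rightarrow> 'x) \<Rightarrow> (real \<Rightarrow> 'x) \<Rightarrow> real \<Rightarrow> 'x" where
  "loop_join p q s = (if s \<le> 1/2 then p (2 * s) else q (2 * s - 1))"

definition fundamental_group :: "'x topology \<Rightarrow> 'x \<Rightarrow> (real \<Rightarrow> 'x) set monoid" where
  "fundamental_group X x =
     \<lparr>carrier = loops X x // loop_rel X x,
      mult = (\<lambda>A B. \<Union>p\<in>A. \<Union>q\<in>B. loop_rel X x `` {loop_join p q}),
      one = loop_rel X x `` {\<lambda>s. x}\<rparr>"

end

theory Submission imports Defs "HOL-Homology.Homology" begin

text \<open>Regard \<open>S\<^sup>2\<close> as the unit imaginary quaternions and \<open>S\<^sup>3\<close> as the unit quaternions. For fixed
  \<open>u \<in> S\<^sup>2\<close> the quaternions \<open>exp (\<theta>u) = cos \<theta> + (sin \<theta>) u\<close> form a circle group, so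
  \<open>(\<theta>, (u, q)) \<mapsto> (u, exp (\<theta>u) q)\<close> is a circle action. It is not homotopic to the trivial action
  because its second component at \<open>q = 1\<close>, the map \<open>S\<^sup>1 \<times> S\<^sup>2 \<rightarrow> S\<^sup>3\<close> sending \<open>(\<theta>, u)\<close> to
  \<open>exp (\<theta>u)\<close>, has degree 2; and running through the action \<open>n\<close> times gives degree \<open>2n\<close>, whence
  infinitely many classes of loops of diffeomorphisms.

  To work with self-maps of \<open>S\<^sup>3\<close> instead of maps on \<open>S\<^sup>1 \<times> S\<^sup>2\<close>, write a unit quaternion as
  \<open>exp (\<pi>tu)\<close> with \<open>0 \<le> t \<le> 1\<close>. A family \<open>H s t u\<close> in \<open>S\<^sup>3\<close> that equals 1 for \<open>t = 0\<close> and \<open>t = 1\<close>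
  descends along \<open>(t, u) \<mapsto> exp (\<pi>tu)\<close> to a homotopy of self-maps of \<open>S\<^sup>3\<close>
  (\<open>homotopic_clutching\<close>). The \<open>n\<close>-fold loop becomes the power map \<open>q \<mapsto> q\<^bsup>2n\<^esup>\<close>. Only the values
  \<open>n = 2\<^sup>j\<close> are used: the maps are then iterates of the squaring map, and since degrees multiply,
  everything follows from the fact that squaring has degree 2. Squaring maps the equator of
  imaginary quaternions to \<open>-1\<close>, so its degree is the sum of the contributions of the two
  hemispheres (\<open>Brouwer_degree2_pinch\<close>), and each of them is 1.

  A homotopy of loops in the diffeomorphism group yields such a family because the condition
  \<open>g ` K \<subseteq> fst d\<close> in the definition of a neighbourhood makes the Sobolev topology finer than the
  compact-open one, so that evaluation is jointly continuous
  (\<open>evaluation_jointly_continuous\<close>). A smooth homotopy from the action to the trivial one, which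
  may move the value at \<open>\<theta> = 0\<close>, is first normalised by multiplying with the conjugate of that value.

  It remains to see that the loops are continuous in the Sobolev topology
  (\<open>continuous_map_smooth_family\<close>). In charts the difference of two members of a smooth family is
  smooth, with all derivatives uniformly small on compact sets. The Sobolev norm is defined by a
  choice of weak derivatives, so this needs the two standard facts on which the norm rests: a
  classical derivative is a weak derivative (integration by parts), and weak derivatives are unique
  almost everywhere (the fundamental lemma of the calculus of variations).\<close>

section \<open>Additivity of the degree under pinching the equator\<close>

text \<open>Write \<open>E\<close> for the equator and \<open>U\<close>, \<open>L\<close> for the closed hemispheres. A class in \<open>H\<^sub>n(S)\<close>
  becomes in \<open>H\<^sub>n(S, E)\<close> a sum of a class carried by \<open>U\<close> and one carried by \<open>L\<close>. As \<open>h\<close> is a map of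
  pairs \<open>(S, E) \<rightarrow> (S, {P})\<close> and a constant map induces zero, the two summands are computed by the two
  maps that replace \<open>h\<close> by \<open>P\<close> on one hemisphere. Here \<open>h\<close> is \<open>P\<close> on the whole hyperplane
  \<open>x n = 0\<close>, also off the sphere, since the induced maps of pairs ask for that.\<close>

lemma Brouwer_degree2_pinch_aux:
  assumes n: "n > 0" and P: "P \<in> topspace (nsphere n)"
    and h: "continuous_map (nsphere n) (nsphere n) h"
    and hE: "\<And>x. x n = 0 \<Longrightarrow> h x = P"
  shows "Brouwer_degree2 n h =
     Brouwer_degree2 n (\<lambda>x. if x n \<ge> 0 then h x else P) +
     Brouwer_degree2 n (\<lambda>x. if x n \<le> 0 then h x else P)"
proof -
  define X where "X = nsphere n"
  define U where "U = {x::nat\<Rightarrow>real. x n \<ge> 0}"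
  define L where "L = {x::nat\<Rightarrow>real. x n \<le> 0}"
  define E where "E = {x::nat\<Rightarrow>real. x n = 0}"
  define hU where "hU = (\<lambda>x. if x n \<ge> 0 then h x else P)"
  define hL where "hL = (\<lambda>x. if x n \<le> 0 then h x else P)"
  let ?p = "int n"
  let ?hom = "hom_induced ?p :: _ \<Rightarrow> _ \<Rightarrow> _ \<Rightarrow> _ \<Rightarrow> ((nat \<Rightarrow> real) \<Rightarrow> nat \<Rightarrow> real) \<Rightarrow> _"
  let ?G = "homology_group ?p X"
  let ?HE = "relative_homology_group ?p X E"
  let ?HU = "relative_homology_group ?p X U"
  let ?HL = "relative_homology_group ?p X L"
  let ?XU = "subtopology X U" and ?XL = "subtopology X L"
  let ?HUE = "relative_homology_group ?p ?XU E"
  let ?HLE = "relative_homology_group ?p ?XL E"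
  let ?HP = "relative_homology_group ?p X {P}"
  have red: "reduced_homology_group ?p X = ?G"
    using n by (simp add: un_reduced_homology_group)
  have EL: "E \<subseteq> L" and EU: "E \<subseteq> U"
    by (auto simp: E_def L_def U_def)
  have idE: "id \<in> {} \<rightarrow> E" "id \<in> E \<rightarrow> L" "id \<in> E \<rightarrow> U" "id \<in> E \<rightarrow> E" "id \<in> {} \<rightarrow> {P}"
    using EL EU by auto
  have cidU: "continuous_map ?XU X id" and cidL: "continuous_map ?XL X id"
    by (simp_all add: continuous_map_id_subt)
  have isoUL: "?hom ?XU E X L id \<in> iso ?HUE ?HL"
    unfolding X_def U_def L_def E_def by (rule iso_relative_homology_group_upper_hemisphere)
  have isoLU: "?hom ?XL E X U id \<in> iso ?HLE ?HU"
    unfolding X_def U_def L_def E_def by (rule iso_relative_homology_group_lower_hemisphere)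
  have isoP: "?hom X {} X {P} id \<in> iso ?G ?HP"
    using iso_reduced_homology_by_contractible[of X "{P}" ?p] P red
    by (simp add: X_def contractible_space_subtopology_singleton)
  have exL: "?hom ?XL E X E id ` carrier ?HLE = kernel ?HE ?HL (?hom X E X L id)"
    using homology_exactness_triple_3[OF EL, of ?p X] by simp
  have exU: "?hom ?XU E X E id ` carrier ?HUE = kernel ?HE ?HU (?hom X E X U id)"
    using homology_exactness_triple_3[OF EU, of ?p X] by simp
  interpret HE: comm_group ?HE by simp
  interpret HP: comm_group ?HP by simp
  have gh: "group_hom (relative_homology_group ?p A B) (relative_homology_group ?p C D) (?hom A B C D f)"
    for A B C D f
    by (simp add: group_hom_def group_hom_axioms_def hom_induced_hom)
  interpret kL: group_hom ?HE ?HL "?hom X E X L id" by (rule gh)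
  interpret kU: group_hom ?HE ?HU "?hom X E X U id" by (rule gh)
  interpret LU: group_hom ?HLE ?HU "?hom ?XL E X U id" by (rule gh)
  interpret iL: group_hom ?HLE ?HE "?hom ?XL E X E id" by (rule gh)
  have car: "?hom A B C D f z \<in> carrier (relative_homology_group ?p C D)"
    for A B C D f z
    by (rule hom_induced_carrier)
  \<comment> \<open>By excision \<open>a\<close> and \<open>b\<close> are determined by the images of \<open>x\<close> relative to \<open>L\<close> and to \<open>U\<close>. The error
     of the decomposition vanishes relative to \<open>L\<close>, hence comes from \<open>L\<close>, and it vanishes relative to
     \<open>U\<close>, where such classes inject.\<close>
  have split: "\<exists>a\<in>carrier ?HUE. \<exists>b\<in>carrier ?HLE. ?hom X {} X E id x =
       ?hom ?XU E X E id a \<otimes>\<^bsub>?HE\<^esub> ?hom ?XL E X E id b"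
    if x: "x \<in> carrier ?G" for x
  proof -
    obtain a where a: "a \<in> carrier ?HUE" and aeq: "?hom ?XU E X L id a = ?hom X {} X L id x"
      using isoUL car[of X "{}" X L id x] unfolding iso_def bij_betw_def by (smt (verit) image_iff mem_Collect_eq)
    obtain b where b: "b \<in> carrier ?HLE" and beq: "?hom ?XL E X U id b = ?hom X {} X U id x"
      using isoLU car[of X "{}" X U id x] unfolding iso_def bij_betw_def by (smt (verit) image_iff mem_Collect_eq)
    let ?jx = "?hom X {} X E id x" and ?ia = "?hom ?XU E X E id a"
      and ?ib = "?hom ?XL E X E id b"
    have jx: "?jx \<in> carrier ?HE" and ia: "?ia \<in> carrier ?HE" and ib: "?ib \<in> carrier ?HE"
      by (rule car)+
    have kLj: "?hom X E X L id ?jx = ?hom X {} X L id x"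
      by (simp add: hom_induced_compose' idE)
    have kUj: "?hom X E X U id ?jx = ?hom X {} X U id x"
      by (simp add: hom_induced_compose' idE)
    have kLa: "?hom X E X L id ?ia = ?hom X {} X L id x"
      using aeq by (simp add: hom_induced_compose'[OF cidU _ continuous_map_id] idE)
    have kUb: "?hom X E X U id ?ib = ?hom X {} X U id x"
      using beq by (simp add: hom_induced_compose'[OF cidL _ continuous_map_id] idE)
    have kLb: "?hom X E X L id ?ib = \<one>\<^bsub>?HL\<^esub>"
      using exL b by (auto simp: kernel_def)
    have kUa: "?hom X E X U id ?ia = \<one>\<^bsub>?HU\<^esub>"
      using exU a by (auto simp: kernel_def)
    define y where "y = ?jx \<otimes>\<^bsub>?HE\<^esub> inv\<^bsub>?HE\<^esub> (?ia \<otimes>\<^bsub>?HE\<^esub> ?ib)"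
    have y: "y \<in> carrier ?HE" using jx ia ib by (simp add: y_def)
    have cL: "?hom X {} X L id x \<in> carrier ?HL" and cU: "?hom X {} X U id x \<in> carrier ?HU"
      by (rule car)+
    have kLy: "?hom X E X L id y = \<one>\<^bsub>?HL\<^esub>"
    proof -
      have "?hom X E X L id y = ?hom X {} X L id x \<otimes>\<^bsub>?HL\<^esub>
          inv\<^bsub>?HL\<^esub> (?hom X {} X L id x \<otimes>\<^bsub>?HL\<^esub> \<one>\<^bsub>?HL\<^esub>)"
        unfolding y_def using jx ia ib
        by (simp only: kL.hom_mult kL.hom_inv HE.m_closed HE.inv_closed kLj kLa kLb)
      then show ?thesis using cL kL.H.r_one kL.H.r_inv by metis
    qed
    have kUy: "?hom X E X U id y = \<one>\<^bsub>?HU\<^esub>"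
    proof -
      have "?hom X E X U id y = ?hom X {} X U id x \<otimes>\<^bsub>?HU\<^esub>
          inv\<^bsub>?HU\<^esub> (\<one>\<^bsub>?HU\<^esub> \<otimes>\<^bsub>?HU\<^esub> ?hom X {} X U id x)"
        unfolding y_def using jx ia ib
        by (simp only: kU.hom_mult kU.hom_inv HE.m_closed HE.inv_closed kUj kUa kUb)
      then show ?thesis using cU kU.H.l_one kU.H.r_inv by metis
    qed
    obtain c where c: "c \<in> carrier ?HLE" and yc: "y = ?hom ?XL E X E id c"
    proof -
      have "y \<in> kernel ?HE ?HL (?hom X E X L id)"
        using y kLy unfolding kernel_def by blast
      then show ?thesis using that unfolding exL[symmetric] by blast
    qed
    have "?hom ?XL E X U id c = ?hom X E X U id y"
      unfolding yc by (simp add: hom_induced_compose'[OF cidL _ continuous_map_id] idE)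
    then have "?hom ?XL E X U id c = \<one>\<^bsub>?HU\<^esub>" using kUy by simp
    then have "c = \<one>\<^bsub>?HLE\<^esub>"
      using isoLU c LU.iso_iff by blast
    then have "y = \<one>\<^bsub>?HE\<^esub>" unfolding yc using iL.hom_one by simp
    then have "?jx = ?ia \<otimes>\<^bsub>?HE\<^esub> ?ib"
      unfolding y_def using jx ia ib
      by (metis HE.inv_equality HE.inv_inv HE.inv_closed HE.m_closed)
    then show ?thesis using a b by blast
  qed
  have contU: "continuous_map X X hU"
    unfolding hU_def X_def
    by (rule continuous_map_cases_le) (use h P hE in \<open>auto intro: continuous_map_from_subtopology simp: continuous_map_nsphere_projection\<close>)
  have contL: "continuous_map X X hL"
    unfolding hL_def X_def
    by (rule continuous_map_cases_le) (use h P hE in \<open>auto intro: continuous_map_from_subtopology simp: continuous_map_nsphere_projection\<close>)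
  note h' = h[folded X_def]
  have fE: "h \<in> E \<rightarrow> {P}" "hU \<in> E \<rightarrow> {P}" "hL \<in> E \<rightarrow> {P}"
    using hE by (auto simp: E_def hU_def hL_def)
  have const1: "?hom Y E X {P} (\<lambda>x. P) z = \<one>\<^bsub>?HP\<^esub>" for Y :: "(nat\<Rightarrow>real) topology" and z
  proof -
    have c: "continuous_map Y (subtopology X {P}) (\<lambda>x. P)"
      using P by (simp add: X_def)
    have tr: "trivial_group (relative_homology_group ?p (subtopology X {P}) {P})"
      using trivial_relative_homology_group_topspace[of ?p "subtopology X {P}"] P by (simp add: X_def)
    have "?hom Y E X {P} (id \<circ> (\<lambda>x. P)) = ?hom (subtopology X {P}) {P} X {P} id \<circ>
        ?hom Y E (subtopology X {P}) {P} (\<lambda>x. P)"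
      by (rule hom_induced_compose[OF c]) (auto simp: continuous_map_id_subt)
    moreover have "?hom Y E (subtopology X {P}) {P} (\<lambda>x. P) z = \<one>\<^bsub>relative_homology_group ?p (subtopology X {P}) {P}\<^esub>"
      using tr car[of Y E "subtopology X {P}" "{P}" "\<lambda>x. P" z] by (simp add: trivial_group_def)
    ultimately show ?thesis
      using group_hom.hom_one[OF gh[of "subtopology X {P}" "{P}" X "{P}" id]] by (simp add: o_def)
  qed
  have key: "?hom X {} X {P} id (?hom X {} X {} f x) =
      ?hom ?XU E X {P} f a \<otimes>\<^bsub>?HP\<^esub> ?hom ?XL E X {P} f b"
    if f: "continuous_map X X f" "f \<in> E \<rightarrow> {P}" and x: "x \<in> carrier ?G"
      and ab: "a \<in> carrier ?HUE" "b \<in> carrier ?HLE" and eq: "?hom X {} X E id x =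
       ?hom ?XU E X E id a \<otimes>\<^bsub>?HE\<^esub> ?hom ?XL E X E id b" for f x a b
  proof -
    interpret f: group_hom ?HE ?HP "?hom X E X {P} f" by (rule gh)
    have "?hom X {} X {P} id (?hom X {} X {} f x) = ?hom X {} X {P} f x"
      using f by (simp add: hom_induced_compose')
    also have "\<dots> = ?hom X E X {P} f (?hom X {} X E id x)"
      using f by (simp add: hom_induced_compose')
    also have "\<dots> = ?hom X E X {P} f (?hom ?XU E X E id a) \<otimes>\<^bsub>?HP\<^esub>
         ?hom X E X {P} f (?hom ?XL E X E id b)"
      unfolding eq by (rule f.hom_mult) (rule car)+
    also have "\<dots> = ?hom ?XU E X {P} f a \<otimes>\<^bsub>?HP\<^esub> ?hom ?XL E X {P} f b"
      using f by (simp add: hom_induced_compose'[OF cidU] hom_induced_compose'[OF cidL] idE)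
    finally show ?thesis .
  qed
  have add: "?hom X {} X {} h x = ?hom X {} X {} hU x \<otimes>\<^bsub>?G\<^esub> ?hom X {} X {} hL x"
    if x: "x \<in> carrier ?G" for x
  proof -
    interpret P: group_hom ?G ?HP "?hom X {} X {P} id" by (rule gh)
    obtain a b where ab: "a \<in> carrier ?HUE" "b \<in> carrier ?HLE" and eq: "?hom X {} X E id x =
       ?hom ?XU E X E id a \<otimes>\<^bsub>?HE\<^esub> ?hom ?XL E X E id b"
      using split[OF x] by blast
    have UU: "?hom ?XU E X {P} hU = ?hom ?XU E X {P} h"
      by (rule hom_induced_eq) (auto simp: hU_def U_def)
    have LL: "?hom ?XL E X {P} hL = ?hom ?XL E X {P} h"
      by (rule hom_induced_eq) (auto simp: hL_def L_def)
    have UL: "?hom ?XL E X {P} hU = ?hom ?XL E X {P} (\<lambda>x. P)"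
      by (rule hom_induced_eq) (auto simp: hU_def L_def hE)
    have LU: "?hom ?XU E X {P} hL = ?hom ?XU E X {P} (\<lambda>x. P)"
      by (rule hom_induced_eq) (auto simp: hL_def U_def hE)
    have "?hom X {} X {P} id (?hom X {} X {} h x) =
       ?hom X {} X {P} id (?hom X {} X {} hU x) \<otimes>\<^bsub>?HP\<^esub>
       ?hom X {} X {P} id (?hom X {} X {} hL x)"
      unfolding key[OF h' fE(1) x ab eq] key[OF contU fE(2) x ab eq] key[OF contL fE(3) x ab eq] UU LL UL LU const1
      by (simp only: HP.r_one HP.l_one car)
    also have "\<dots> = ?hom X {} X {P} id (?hom X {} X {} hU x \<otimes>\<^bsub>?G\<^esub> ?hom X {} X {} hL x)"
      by (rule P.hom_mult[symmetric]) (rule car)+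
    finally have eq: "?hom X {} X {P} id (?hom X {} X {} h x) = \<dots>" .
    have inj: "inj_on (?hom X {} X {P} id) (carrier ?G)"
      using isoP by (simp add: iso_def bij_betw_def)
    have "?hom X {} X {} hU x \<otimes>\<^bsub>?G\<^esub> ?hom X {} X {} hL x \<in> carrier ?G"
      by (rule monoid.m_closed[OF group.is_monoid[OF group_relative_homology_group] car car])
    then show ?thesis
      by (rule inj_onD[OF inj eq car])
  qed
  have "Brouwer_degree2 n h = Brouwer_degree2 n hU + Brouwer_degree2 n hL"
  proof (rule Brouwer_degree2_unique[OF h])
    fix x assume "x \<in> carrier (reduced_homology_group (int n) (nsphere n))"
    then have x: "x \<in> carrier ?G" and x': "x \<in> carrier (reduced_homology_group (int n) X)"
      using red by (simp_all add: X_def)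
    interpret G: group ?G by simp
    show "hom_induced (int n) (nsphere n) {} (nsphere n) {} h x =
         x [^]\<^bsub>reduced_homology_group (int n) (nsphere n)\<^esub> (Brouwer_degree2 n hU + Brouwer_degree2 n hL)"
      using add[OF x] Brouwer_degree2[OF x'[unfolded X_def], of hU] Brouwer_degree2[OF x'[unfolded X_def], of hL] x
      by (simp add: X_def[symmetric] red G.int_pow_mult)
  qed
  then show ?thesis by (simp add: hU_def hL_def)
qed

lemma Brouwer_degree2_pinch:
  assumes n: "n > 0" and P: "P \<in> topspace (nsphere n)"
    and h: "continuous_map (nsphere n) (nsphere n) h"
    and hE: "\<And>x. x \<in> topspace (nsphere n) \<Longrightarrow> x n = 0 \<Longrightarrow> h x = P"
  shows "Brouwer_degree2 n h =
     Brouwer_degree2 n (\<lambda>x. if x n \<ge> 0 then h x else P) +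
     Brouwer_degree2 n (\<lambda>x. if x n \<le> 0 then h x else P)"
proof -
  define h' where "h' = (\<lambda>x. if x n = 0 then P else h x)"
  have eq: "h' x = h x" if "x \<in> topspace (nsphere n)" for x
    using hE that by (simp add: h'_def)
  have c: "continuous_map (nsphere n) (nsphere n) h'"
    using h eq by (metis continuous_map_eq)
  have "Brouwer_degree2 n h' =
     Brouwer_degree2 n (\<lambda>x. if x n \<ge> 0 then h' x else P) +
     Brouwer_degree2 n (\<lambda>x. if x n \<le> 0 then h' x else P)"
    by (rule Brouwer_degree2_pinch_aux[OF n P c]) (simp add: h'_def)
  moreover have "Brouwer_degree2 n h' = Brouwer_degree2 n h"
    by (rule Brouwer_degree2_eq[OF eq])
  moreover have "Brouwer_degree2 n (\<lambda>x. if x n \<ge> 0 then h' x else P) = Brouwer_degree2 n (\<lambda>x. if x n \<ge> 0 then h x else P)"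
    by (rule Brouwer_degree2_eq) (simp add: eq)
  moreover have "Brouwer_degree2 n (\<lambda>x. if x n \<le> 0 then h' x else P) = Brouwer_degree2 n (\<lambda>x. if x n \<le> 0 then h x else P)"
    by (rule Brouwer_degree2_eq) (simp add: eq)
  ultimately show ?thesis by simp
qed

section \<open>Quaternions and the degree of the squaring map\<close>

text \<open>Quaternions are vectors in \<open>\<real>\<^sup>4\<close>, the real part being the first coordinate.\<close>

definition qmul :: "real^4 \<Rightarrow> real^4 \<Rightarrow> real^4" where
  "qmul p q = (\<chi> i.
     if i = 1 then p$1*q$1 - p$2*q$2 - p$3*q$3 - p$4*q$4
     else if i = 2 then p$1*q$2 + p$2*q$1 + p$3*q$4 - p$4*q$3
     else if i = 3 then p$1*q$3 + p$3*q$1 + p$4*q$2 - p$2*q$4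
     else p$1*q$4 + p$4*q$1 + p$2*q$3 - p$3*q$2)"

definition qone :: "real^4" where "qone = (\<chi> i. if i = 1 then 1 else 0)"

definition qim :: "real^3 \<Rightarrow> real^4" where
  "qim u = (\<chi> i. if i = 1 then 0 else if i = 2 then u$1 else if i = 3 then u$2 else u$3)"

definition qconj :: "real^4 \<Rightarrow> real^4" where
  "qconj q = (\<chi> i. if i = 1 then q$1 else - (q$i))"

lemma vec4_eq_iff: "(x::real^4) = y \<longleftrightarrow> x$1 = y$1 \<and> x$2 = y$2 \<and> x$3 = y$3 \<and> x$4 = y$4"
  by (simp add: vec_eq_iff forall_4)

lemma qmul_nth [simp]:
  "qmul p q $ 1 = p$1*q$1 - p$2*q$2 - p$3*q$3 - p$4*q$4"
  "qmul p q $ 2 = p$1*q$2 + p$2*q$1 + p$3*q$4 - p$4*q$3"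
  "qmul p q $ 3 = p$1*q$3 + p$3*q$1 + p$4*q$2 - p$2*q$4"
  "qmul p q $ 4 = p$1*q$4 + p$4*q$1 + p$2*q$3 - p$3*q$2"
  by (simp_all add: qmul_def)

lemma qone_nth [simp]: "qone $ 1 = 1" "qone $ 2 = 0" "qone $ 3 = 0" "qone $ 4 = 0"
  by (simp_all add: qone_def)

lemma qim_nth [simp]: "qim u $ 1 = 0" "qim u $ 2 = u$1" "qim u $ 3 = u$2" "qim u $ 4 = u$3"
  by (simp_all add: qim_def)

lemma qconj_nth [simp]: "qconj q $ 1 = q$1" "qconj q $ 2 = - (q$2)" "qconj q $ 3 = - (q$3)" "qconj q $ 4 = - (q$4)"
  by (simp_all add: qconj_def)

lemma norm4_sq: "(norm (q::real^4))\<^sup>2 = (q$1)\<^sup>2 + (q$2)\<^sup>2 + (q$3)\<^sup>2 + (q$4)\<^sup>2"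
  unfolding power2_norm_eq_inner inner_vec_def sum_4 by (simp add: power2_eq_square)

lemma norm3_sq: "(norm (u::real^3))\<^sup>2 = (u$1)\<^sup>2 + (u$2)\<^sup>2 + (u$3)\<^sup>2"
  unfolding power2_norm_eq_inner inner_vec_def sum_3 by (simp add: power2_eq_square)

lemma norm_qmul: "norm (qmul p q) = norm p * norm q"
proof -
  have "(norm (qmul p q))\<^sup>2 = (norm p * norm q)\<^sup>2"
    unfolding power_mult_distrib norm4_sq by (simp add: power2_eq_square algebra_simps)
  then show ?thesis by (simp add: power2_eq_iff_nonneg)
qed

lemma norm_qone [simp]: "norm qone = 1"
proof -
  have "(norm qone)\<^sup>2 = 1\<^sup>2" unfolding norm4_sq by simp
  then show ?thesis by (subst (asm) power2_eq_iff_nonneg) simp_all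
qed

lemma norm_qim [simp]: "norm (qim u) = norm u"
proof -
  have "(norm (qim u))\<^sup>2 = (norm u)\<^sup>2" unfolding norm4_sq norm3_sq by simp
  then show ?thesis by (simp add: power2_eq_iff_nonneg)
qed

lemma norm_qconj [simp]: "norm (qconj q) = norm q"
proof -
  have "(norm (qconj q))\<^sup>2 = (norm q)\<^sup>2" unfolding norm4_sq by simp
  then show ?thesis by (simp add: power2_eq_iff_nonneg)
qed

lemma qmul_assoc: "qmul (qmul p q) r = qmul p (qmul q r)"
  by (simp add: vec4_eq_iff algebra_simps)

lemma qmul_qone [simp]: "qmul q qone = q" "qmul qone q = q"
  by (simp_all add: vec4_eq_iff)

lemma qmul_qconj: "norm q = 1 \<Longrightarrow> qmul (qconj q) q = qone"
  using norm4_sq[of q] by (simp add: vec4_eq_iff power2_eq_square algebra_simps)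

lemma bounded_bilinear_qmul: "bounded_bilinear qmul"
proof
  show "\<exists>K. \<forall>a b. norm (qmul a b) \<le> norm a * norm b * K"
    by (rule exI[of _ 1]) (simp add: norm_qmul)
qed (simp_all add: vec4_eq_iff algebra_simps)

interpretation qmul: bounded_bilinear qmul by (rule bounded_bilinear_qmul)

lemma bounded_linear_qim: "bounded_linear qim"
proof
  show "\<exists>K. \<forall>x. norm (qim x) \<le> norm x * K" by (rule exI[of _ 1]) simp
qed (simp_all add: vec4_eq_iff)

lemma bounded_linear_qconj: "bounded_linear qconj"
proof
  show "\<exists>K. \<forall>x. norm (qconj x) \<le> norm x * K" by (rule exI[of _ 1]) simp
qed (simp_all add: vec4_eq_iff)

lemma qmul_qim_qim: "norm u = 1 \<Longrightarrow> qmul (qim u) (qim u) = - qone"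
  using norm3_sq[of u] by (simp add: vec4_eq_iff power2_eq_square algebra_simps)

text \<open>For a unit vector \<open>u\<close> this is the exponential of the imaginary quaternion \<open>\<theta>u\<close>.\<close>

definition qexp :: "real \<Rightarrow> real^3 \<Rightarrow> real^4" where
  "qexp \<theta> u = cos \<theta> *\<^sub>R qone + sin \<theta> *\<^sub>R qim u"

lemma qexp_nth [simp]:
  "qexp \<theta> u $ 1 = cos \<theta>" "qexp \<theta> u $ 2 = sin \<theta> * u$1" "qexp \<theta> u $ 3 = sin \<theta> * u$2" "qexp \<theta> u $ 4 = sin \<theta> * u$3"
  by (simp_all add: qexp_def)

lemma norm_qexp: assumes "norm u = 1" shows "norm (qexp \<theta> u) = 1"
proof -
  have "(norm (qexp \<theta> u))\<^sup>2 = (cos \<theta>)\<^sup>2 + (sin \<theta>)\<^sup>2 * (norm u)\<^sup>2"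
    unfolding norm4_sq norm3_sq by (simp add: algebra_simps power_mult_distrib)
  then have "(norm (qexp \<theta> u))\<^sup>2 = 1\<^sup>2" using assms by simp
  then show ?thesis by (subst (asm) power2_eq_iff_nonneg) simp_all
qed

lemma qexp_add:
  assumes "norm u = 1" shows "qmul (qexp \<theta> u) (qexp \<psi> u) = qexp (\<theta> + \<psi>) u"
proof -
  have "qmul (qexp \<theta> u) (qexp \<psi> u) =
     (cos \<theta> * cos \<psi>) *\<^sub>R qone + (cos \<theta> * sin \<psi>) *\<^sub>R qim u + (sin \<theta> * cos \<psi>) *\<^sub>R qim u
     + (sin \<theta> * sin \<psi>) *\<^sub>R qmul (qim u) (qim u)"
    by (simp add: qexp_def qmul.add_left qmul.add_right qmul.scaleR_left qmul.scaleR_right algebra_simps)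
  then show ?thesis
    by (simp add: qexp_def qmul_qim_qim[OF assms] cos_add sin_add algebra_simps)
qed

lemma qexp_0 [simp]: "qexp 0 u = qone" by (simp add: qexp_def)

definition qsquare :: "real^4 \<Rightarrow> real^4" where "qsquare q = qmul q q"

lemma qsquare_qexp: "norm u = 1 \<Longrightarrow> qsquare (qexp \<theta> u) = qexp (2 * \<theta>) u"
  using qexp_add[of u \<theta> \<theta>] by (simp add: qsquare_def)

lemma qsquare_pow_qexp: "norm u = 1 \<Longrightarrow> (qsquare ^^ n) (qexp \<theta> u) = qexp (2 ^ n * \<theta>) u"
  by (induction n) (simp_all add: qsquare_qexp algebra_simps)

abbreviation S3 :: "(real^4) set" where "S3 \<equiv> sphere 0 1"

lemma continuous_on_qsquare: "continuous_on S qsquare"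
  unfolding qsquare_def by (intro qmul.continuous_on continuous_on_id)

lemma qsquare_sphere: "qsquare ` S3 \<subseteq> S3"
  by (auto simp: qsquare_def norm_qmul)

lemma qsquare_pow_sphere: "x \<in> S3 \<Longrightarrow> (qsquare ^^ n) x \<in> S3"
  by (induction n) (simp_all add: qsquare_def norm_qmul)

lemma continuous_on_qsquare_pow: "continuous_on S3 (qsquare ^^ n)"
proof (induction n)
  case (Suc n)
  have "continuous_on S3 (qsquare \<circ> (qsquare ^^ n))"
    by (intro continuous_on_compose Suc continuous_on_qsquare)
  then show ?case by (simp add: o_def)
qed (simp add: id_def continuous_on_id)

text \<open>The angle is the arc cosine of the real part. The direction \<open>u\<close> is arbitrary at the poles
  \<open>\<plusminus>1\<close>.\<close>

lemma qexp_surj: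
  assumes "q \<in> S3"
  shows "\<exists>t\<in>{0..1}. \<exists>u. norm u = 1 \<and> q = qexp (pi * t) u"
proof -
  have n: "(q$1)\<^sup>2 + (q$2)\<^sup>2 + (q$3)\<^sup>2 + (q$4)\<^sup>2 = 1"
    using assms norm4_sq[of q] by simp
  have "(q$1)\<^sup>2 \<le> 1" using n zero_le_power2[of "q$2"] zero_le_power2[of "q$3"] zero_le_power2[of "q$4"] by linarith
  then have le: "\<bar>q$1\<bar> \<le> 1" by (simp add: abs_square_le_1)
  define \<tau> where "\<tau> = arccos (q$1)"
  have \<tau>: "0 \<le> \<tau>" "\<tau> \<le> pi" and c: "cos \<tau> = q$1"
    using le by (auto simp: \<tau>_def arccos_lbound arccos_ubound cos_arccos_abs)
  define v :: "real^3" where "v = (\<chi> i. if i = 1 then q$2 else if i = 2 then q$3 else q$4)"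
  have v [simp]: "v$1 = q$2" "v$2 = q$3" "v$3 = q$4" by (simp_all add: v_def)
  have "(norm v)\<^sup>2 = (sin \<tau>)\<^sup>2"
    unfolding norm3_sq using n c by (simp add: sin_squared_eq)
  moreover have s: "sin \<tau> \<ge> 0" using \<tau> by (simp add: sin_ge_zero)
  ultimately have nv: "norm v = sin \<tau>" by (simp add: power2_eq_iff_nonneg)
  obtain u :: "real^3" where u: "norm u = 1" "v = sin \<tau> *\<^sub>R u"
  proof (cases "v = 0")
    case True
    then show ?thesis using that[of "axis 1 1"] nv by simp
  next
    case False
    then have "v = norm v *\<^sub>R sgn v" "norm (sgn v) = 1" by (simp_all add: sgn_div_norm)
    then show ?thesis using that[of "sgn v"] nv by metis
  qed
  have "v $ i = sin \<tau> * u $ i" for i by (subst u(2)) simp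
  then have "q = qexp \<tau> u"
    using c v by (simp add: vec4_eq_iff)
  then show ?thesis using \<tau> u by (intro bexI[of _ "\<tau>/pi"]) auto
qed

text \<open>The map \<open>(s, t, u) \<mapsto> (s, exp (\<pi>tu))\<close> from the compact set \<open>[0,1]\<^sup>2 \<times> S\<^sup>2\<close> onto \<open>[0,1] \<times> S\<^sup>3\<close> is a
  quotient map, and it identifies only points with \<open>t = 0\<close> or with \<open>t = 1\<close>, where \<open>H\<close> is constant.
  So \<open>H\<close> descends to a continuous map on the quotient, the required homotopy.\<close>

lemma homotopic_clutching:
  fixes H :: "real \<Rightarrow> real \<Rightarrow> real^3 \<Rightarrow> real^4"
  assumes H: "continuous_on ({0..1} \<times> {0..1} \<times> sphere 0 1) (\<lambda>(s,t,u). H s t u)"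
    and HS: "\<And>s t u. s \<in> {0..1} \<Longrightarrow> t \<in> {0..1} \<Longrightarrow> norm u = 1 \<Longrightarrow> H s t u \<in> S3"
    and H0: "\<And>s u. s \<in> {0..1} \<Longrightarrow> norm u = 1 \<Longrightarrow> H s 0 u = qone"
    and H1: "\<And>s u. s \<in> {0..1} \<Longrightarrow> norm u = 1 \<Longrightarrow> H s 1 u = qone"
    and F: "\<And>t u. t \<in> {0..1} \<Longrightarrow> norm u = 1 \<Longrightarrow> H 0 t u = F (qexp (pi * t) u)"
    and G: "\<And>t u. t \<in> {0..1} \<Longrightarrow> norm u = 1 \<Longrightarrow> H 1 t u = G (qexp (pi * t) u)"
  shows "homotopic_with_canon (\<lambda>_. True) S3 S3 F G"
proof -
  define T where "T = {0..1::real} \<times> {0..1::real} \<times> sphere (0::real^3) 1"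
  define \<Phi> where "\<Phi> = (\<lambda>(s::real, t::real, u). (s, qexp (pi * t) u))"
  \<comment> \<open>The value of \<open>H\<close> at any preimage: by \<open>inj\<close> the choice does not matter.\<close>
  define K where "K = (\<lambda>(s, q). let (t, u) = (SOME (t, u). t \<in> {0..1} \<and> norm u = 1 \<and> q = qexp (pi * t) u) in H s t u)"
  have inj: "H s t u = H s t' u'"
    if "s \<in> {0..1}" "t \<in> {0..1}" "t' \<in> {0..1}" "norm u = 1" "norm u' = 1" "qexp (pi * t) u = qexp (pi * t') u'"
    for s t u t' u'
  proof -
    have "cos (pi * t) = cos (pi * t')" using that(6) qexp_nth(1) by metis
    then have "pi * t = pi * t'"
      using that(2,3) by (rule_tac cos_inj_pi) (auto simp: mult_le_cancel_left1)
    then have tt: "t = t'" by simp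
    show ?thesis
    proof (cases "sin (pi * t) = 0")
      case True
      have "t = 0 \<or> t = 1"
      proof (rule ccontr)
        assume "\<not> (t = 0 \<or> t = 1)"
        then have "0 < pi * t" "pi * t < pi" using that(2) by auto
        then have "sin (pi * t) > 0" by (rule sin_gt_zero)
        then show False using True by simp
      qed
      then show ?thesis using tt H0 H1 that by auto
    next
      case False
      have "u = u'"
        using that(6) False tt by (simp add: vec4_eq_iff vec_eq_iff forall_3)
      then show ?thesis using tt by simp
    qed
  qed
  have K\<Phi>: "K (\<Phi> z) = (case z of (s,t,u) \<Rightarrow> H s t u)" if z: "z \<in> T" for z
  proof -
    obtain s t u where zz: "z = (s,t,u)" "s \<in> {0..1}" "t \<in> {0..1}" "norm u = 1"
      using z by (auto simp: T_def)
    obtain t' u' where some: "(SOME (t', u'). t' \<in> {0..1} \<and> norm u' = 1 \<and> qexp (pi * t) u = qexp (pi * t') u') = (t', u')"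
      by fastforce
    have ex: "\<exists>w. case w of (t', u') \<Rightarrow> t' \<in> {0..1} \<and> norm u' = 1 \<and> qexp (pi * t) u = qexp (pi * t') u'"
      using zz by (intro exI[of _ "(t,u)"]) auto
    have "case (t',u') of (t', u') \<Rightarrow> t' \<in> {0..1} \<and> norm u' = 1 \<and> qexp (pi * t) u = qexp (pi * t') u'"
      using someI_ex[OF ex] unfolding some .
    then have *: "t' \<in> {0..1}" "norm u' = 1" "qexp (pi * t') u' = qexp (pi * t) u" by auto
    have "H s t' u' = H s t u" by (rule inj[OF zz(2) *(1) zz(3) *(2) zz(4) *(3)])
    then show ?thesis unfolding K_def \<Phi>_def zz case_prod_conv Let_def some by simp
  qed
  have cT: "compact T" by (auto simp: T_def intro!: compact_Times)
  have c\<Phi>: "continuous_on T \<Phi>"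
    unfolding \<Phi>_def qexp_def case_prod_beta
    by (intro continuous_intros bounded_linear.continuous_on[OF bounded_linear_qim])
  have im: "\<Phi> ` T = {0..1} \<times> S3"
  proof (intro equalityI subsetI)
    fix y assume "y \<in> \<Phi> ` T" then show "y \<in> {0..1} \<times> S3"
      by (auto simp: T_def \<Phi>_def norm_qexp)
  next
    fix y assume "y \<in> {0..1::real} \<times> S3"
    then obtain s q where y: "y = (s,q)" "s \<in> {0..1}" "q \<in> S3" by auto
    obtain t u where "t\<in>{0..1}" "norm u = 1" "q = qexp (pi * t) u" using qexp_surj[OF y(3)] by blast
    then show "y \<in> \<Phi> ` T" using y by (intro image_eqI[of _ _ "(s,t,u)"]) (auto simp: T_def \<Phi>_def)
  qed
  have "quotient_map (top_of_set T) (top_of_set ({0..1} \<times> S3)) \<Phi>"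
    by (rule T1_Spaces.continuous_imp_quotient_map)
      (use c\<Phi> im cT in \<open>auto simp: compact_space_subtopology compactin_euclidean_iff Hausdorff_space_subtopology\<close>)
  moreover have "continuous_map (top_of_set T) (top_of_set S3) (K \<circ> \<Phi>)"
  proof -
    have "continuous_on T (K \<circ> \<Phi>)"
      using H unfolding T_def[symmetric] by (rule continuous_on_eq) (simp add: K\<Phi>)
    moreover have "(K \<circ> \<Phi>) ` T \<subseteq> S3"
    proof
      fix y assume "y \<in> (K \<circ> \<Phi>) ` T"
      then obtain z where z: "z \<in> T" "y = K (\<Phi> z)" by auto
      then show "y \<in> S3" using K\<Phi>[OF z(1)] HS by (auto simp: T_def)
    qed
    ultimately show ?thesis by (simp add: image_subset_iff_funcset o_def)
  qed
  ultimately have cK: "continuous_map (top_of_set ({0..1} \<times> S3)) (top_of_set S3) K"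
    by (rule continuous_compose_quotient_map)
  have K0: "K (0, q) = F q" and K1: "K (1, q) = G q" if q: "q \<in> S3" for q
  proof -
    obtain t u where tu: "t\<in>{0..1}" "norm u = 1" "q = qexp (pi * t) u" using qexp_surj[OF q] by blast
    show "K (0, q) = F q"
      using K\<Phi>[of "(0,t,u)"] tu F by (simp add: T_def \<Phi>_def)
    show "K (1, q) = G q"
      using K\<Phi>[of "(1,t,u)"] tu G by (simp add: T_def \<Phi>_def)
  qed
  show ?thesis
    using cK K0 K1 by (subst homotopic_with) (auto simp: intro!: exI[of _ K] simp flip: subtopology_Times euclidean_product_topology)
qed

text \<open>The segment between non-antipodal unit vectors misses the origin, so the straight-line
  homotopy can be normalised.\<close>

lemma homotopic_sphere_maps_nonantipodal:
  fixes f g :: "'a::euclidean_space \<Rightarrow> 'b::euclidean_space"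
  assumes f: "continuous_on S f" "f ` S \<subseteq> sphere 0 1" and g: "continuous_on S g" "g ` S \<subseteq> sphere 0 1"
    and na: "\<And>x. x \<in> S \<Longrightarrow> g x \<noteq> - f x"
  shows "homotopic_with_canon (\<lambda>_. True) S (sphere 0 1) f g"
proof -
  define l where "l = (\<lambda>(t::real, x). (1 - t) *\<^sub>R f x + t *\<^sub>R g x)"
  have nz: "l (t, x) \<noteq> 0" if "t \<in> {0..1}" "x \<in> S" for t x
  proof
    assume z: "l (t, x) = 0"
    have n: "norm (f x) = 1" "norm (g x) = 1" using f g that by auto
    have eq: "(1 - t) *\<^sub>R f x = - (t *\<^sub>R g x)" using z by (simp add: l_def eq_neg_iff_add_eq_0)
    then have "norm ((1 - t) *\<^sub>R f x) = norm (t *\<^sub>R g x)" by simp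
    then have th: "t = 1/2" using n that by simp
    have "(1/2) *\<^sub>R f x = (1/2) *\<^sub>R (- g x)" using eq[unfolded th] by simp
    then have "f x = - g x" by (simp only: scaleR_cancel_left) simp
    then show False using na[OF that(2)] by simp
  qed
  have cl: "continuous_on ({0..1} \<times> S) l"
    unfolding l_def case_prod_beta
    by (intro continuous_intros continuous_on_compose2[OF f(1)] continuous_on_compose2[OF g(1)]) auto
  have c: "continuous_on ({0..1} \<times> S) (\<lambda>z. l z /\<^sub>R norm (l z))"
    by (intro continuous_intros cl) (use nz in auto)
  have im: "(\<lambda>z. l z /\<^sub>R norm (l z)) ` ({0..1} \<times> S) \<subseteq> sphere 0 1"
    using nz by auto
  have e: "l (0, x) /\<^sub>R norm (l (0, x)) = f x" "l (1, x) /\<^sub>R norm (l (1, x)) = g x" if "x \<in> S" for x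
    using f g that by (auto simp: l_def)
  show ?thesis
    by (subst homotopic_with)
      (use c im e in \<open>auto intro!: exI[of _ "\<lambda>z. l z /\<^sub>R norm (l z)"] simp flip: subtopology_Times euclidean_product_topology\<close>)
qed

text \<open>The real part is moved to the last coordinate, where \<open>Brouwer_degree2_pinch\<close> expects the
  height.\<close>

definition to_nsphere :: "real^4 \<Rightarrow> nat \<Rightarrow> real" where
  "to_nsphere q = (\<lambda>i. if i = 0 then q$2 else if i = 1 then q$3 else if i = 2 then q$4 else if i = 3 then q$1 else 0)"

definition from_nsphere :: "(nat \<Rightarrow> real) \<Rightarrow> real^4" where
  "from_nsphere x = x 3 *\<^sub>R axis 1 1 + x 0 *\<^sub>R axis 2 1 + x 1 *\<^sub>R axis 3 1 + x 2 *\<^sub>R axis 4 1"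

lemma from_nsphere_nth [simp]: "from_nsphere x $ 1 = x 3" "from_nsphere x $ 2 = x 0" "from_nsphere x $ 3 = x 1" "from_nsphere x $ 4 = x 2"
  by (simp_all add: from_nsphere_def axis_def)

lemma to_nsphere_nth: "to_nsphere q 0 = q$2" "to_nsphere q 1 = q$3" "to_nsphere q (Suc 0) = q$3" "to_nsphere q 2 = q$4" "to_nsphere q 3 = q$1"
  by (simp_all add: to_nsphere_def)

lemma from_nsphere_to_nsphere [simp]: "from_nsphere (to_nsphere q) = q"
  by (simp add: vec4_eq_iff to_nsphere_nth)

lemma topspace_nsphere3: "x \<in> topspace (nsphere 3) \<longleftrightarrow> (x 0)\<^sup>2 + (x 1)\<^sup>2 + (x 2)\<^sup>2 + (x 3)\<^sup>2 = 1 \<and> (\<forall>i>3. x i = 0)"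
  by (simp add: nsphere numeral_3_eq_3 numeral_2_eq_2)

lemma to_nsphere_from_nsphere: assumes "x \<in> topspace (nsphere 3)" shows "to_nsphere (from_nsphere x) = x"
proof
  fix i :: nat
  have "i = 0 \<or> i = 1 \<or> i = 2 \<or> i = 3 \<or> i > 3" by arith
  then show "to_nsphere (from_nsphere x) i = x i"
    using assms by (auto simp: topspace_nsphere3 to_nsphere_def)
qed

lemma continuous_map_to_nsphere: "continuous_map (top_of_set S3) (nsphere 3) to_nsphere"
proof -
  have "continuous_map (top_of_set S3) euclideanreal (\<lambda>q. to_nsphere q i)" for i
    by (cases "i = 0"; cases "i = 1"; cases "i = 2"; cases "i = 3")
      (simp_all add: to_nsphere_def linear_continuous_on[OF bounded_linear_vec_nth])
  moreover have "to_nsphere q \<in> topspace (nsphere 3)" if "q \<in> S3" for q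
    using that norm4_sq[of q] unfolding topspace_nsphere3 to_nsphere_nth by (simp add: to_nsphere_def)
  ultimately show ?thesis
    unfolding nsphere by (auto simp: continuous_map_in_subtopology continuous_map_componentwise_UNIV nsphere)
qed

lemma continuous_map_from_nsphere: "continuous_map (nsphere 3) (top_of_set S3) from_nsphere"
proof -
  have c: "continuous_map (nsphere 3) euclidean (\<lambda>x. x k *\<^sub>R (v::real^4))" for k v
  proof -
    have "continuous_map (nsphere 3) euclidean ((\<lambda>r::real. r *\<^sub>R v) \<circ> (\<lambda>x. x k))"
      by (rule continuous_map_compose[OF continuous_map_nsphere_projection]) (auto intro!: continuous_intros)
    then show ?thesis by (simp add: o_def)
  qed
  have "continuous_map (nsphere 3) euclidean from_nsphere"
    unfolding from_nsphere_def by (intro continuous_map_add c)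
  moreover have "from_nsphere x \<in> S3" if "x \<in> topspace (nsphere 3)" for x
  proof -
    have "(norm (from_nsphere x))\<^sup>2 = 1\<^sup>2"
      using that unfolding norm4_sq topspace_nsphere3 by simp
    then have "norm (from_nsphere x) = 1" by (subst (asm) power2_eq_iff_nonneg) simp_all
    then show ?thesis by simp
  qed
  ultimately show ?thesis by (auto simp: continuous_map_in_subtopology)
qed

definition S3_degree :: "(real^4 \<Rightarrow> real^4) \<Rightarrow> int" where
  "S3_degree F = Brouwer_degree2 3 (to_nsphere \<circ> F \<circ> from_nsphere)"

lemma S3_degree_homotopic:
  assumes "homotopic_with_canon (\<lambda>_. True) S3 S3 F G" shows "S3_degree F = S3_degree G"
  unfolding S3_degree_def
  by (intro Brouwer_degree2_homotopic homotopic_with_compose_continuous_map_right[OF _ continuous_map_from_nsphere]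
     homotopic_with_compose_continuous_map_left[OF assms continuous_map_to_nsphere]) auto

lemma continuous_map_conj_nsphere:
  assumes "continuous_on S3 F" "F ` S3 \<subseteq> S3"
  shows "continuous_map (nsphere 3) (nsphere 3) (to_nsphere \<circ> F \<circ> from_nsphere)"
  using assms by (intro continuous_map_compose[OF continuous_map_from_nsphere] continuous_map_compose[OF _ continuous_map_to_nsphere]) 
    (auto simp: image_subset_iff_funcset)

lemma S3_degree_compose:
  assumes "continuous_on S3 F" "F ` S3 \<subseteq> S3" "continuous_on S3 G" "G ` S3 \<subseteq> S3"
  shows "S3_degree (F \<circ> G) = S3_degree F * S3_degree G"
proof -
  have "to_nsphere \<circ> (F \<circ> G) \<circ> from_nsphere = (to_nsphere \<circ> F \<circ> from_nsphere) \<circ> (to_nsphere \<circ> G \<circ> from_nsphere)"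
    by (simp add: fun_eq_iff)
  then show ?thesis
    unfolding S3_degree_def using Brouwer_degree2_compose continuous_map_conj_nsphere assms by metis
qed

lemma S3_degree_id: "S3_degree id = 1"
proof -
  have "Brouwer_degree2 3 (to_nsphere \<circ> id \<circ> from_nsphere) = Brouwer_degree2 3 id"
    by (rule Brouwer_degree2_eq) (simp add: to_nsphere_from_nsphere)
  then show ?thesis by (simp add: S3_degree_def)
qed

lemma S3_degree_const: "S3_degree (\<lambda>_. c) = 0"
  unfolding S3_degree_def by (simp add: o_def Brouwer_degree2_const)

text \<open>Multiplication by \<open>exp (\<pi>ti)\<close> is a homotopy from the identity to the antipodal map.\<close>

lemma S3_degree_antipode: "S3_degree uminus = 1"
proof -
  let ?J = "\<lambda>t. qexp (pi * t) (axis 1 1)"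
  have "homotopic_with_canon (\<lambda>_. True) S3 S3 id (uminus :: real^4 \<Rightarrow> _)"
  proof (subst homotopic_with)
    define k :: "real \<times> (real^4) \<Rightarrow> real^4" where "k = (\<lambda>(t, q). qmul (?J t) q)"
    have c: "continuous_on ({0..1} \<times> S3) k"
      unfolding k_def case_prod_beta qexp_def by (intro qmul.continuous_on continuous_intros)
    have im: "k ` ({0..1} \<times> S3) \<subseteq> S3"
      by (auto simp: k_def norm_qmul norm_qexp)
    have e: "k (0, q) = q" "k (1, q) = - q" for q
      by (simp_all add: k_def qexp_def qmul.minus_left)
    show "\<exists>k. continuous_map (prod_topology (top_of_set {0..1::real}) (top_of_set S3)) (top_of_set S3) k \<and>
        (\<forall>x\<in>topspace (top_of_set S3). k (0, x) = id x) \<and>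
        (\<forall>x\<in>topspace (top_of_set S3). k (1, x) = - x) \<and> (\<forall>t\<in>{0..1::real}. True)"
      by (intro exI[of _ k]) (use c im e in \<open>auto simp flip: subtopology_Times euclidean_product_topology\<close>)
  qed auto
  then show ?thesis using S3_degree_homotopic S3_degree_id by metis
qed

lemma S3_degree_pinch:
  assumes P: "P \<in> S3" and h: "continuous_on S3 h" "h ` S3 \<subseteq> S3"
    and hE: "\<And>q. q \<in> S3 \<Longrightarrow> q$1 = 0 \<Longrightarrow> h q = P"
  shows "S3_degree h = S3_degree (\<lambda>q. if q$1 \<ge> 0 then h q else P) + S3_degree (\<lambda>q. if q$1 \<le> 0 then h q else P)"
proof -
  have im: "from_nsphere x \<in> S3" if "x \<in> topspace (nsphere 3)" for x
    using continuous_map_image_subset_topspace[OF continuous_map_from_nsphere] that by auto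
  have "to_nsphere P \<in> topspace (nsphere 3)"
    using continuous_map_image_subset_topspace[OF continuous_map_to_nsphere] P by auto
  then have "Brouwer_degree2 3 (to_nsphere \<circ> h \<circ> from_nsphere) =
     Brouwer_degree2 3 (\<lambda>x. if x 3 \<ge> 0 then (to_nsphere \<circ> h \<circ> from_nsphere) x else to_nsphere P) +
     Brouwer_degree2 3 (\<lambda>x. if x 3 \<le> 0 then (to_nsphere \<circ> h \<circ> from_nsphere) x else to_nsphere P)"
    using continuous_map_conj_nsphere[OF h] by (intro Brouwer_degree2_pinch) (auto intro!: arg_cong[of _ _ to_nsphere] hE im)
  moreover have "(\<lambda>x. if x 3 \<ge> 0 then (to_nsphere \<circ> h \<circ> from_nsphere) x else to_nsphere P) = to_nsphere \<circ> (\<lambda>q. if q$1 \<ge> 0 then h q else P) \<circ> from_nsphere"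
    "(\<lambda>x. if x 3 \<le> 0 then (to_nsphere \<circ> h \<circ> from_nsphere) x else to_nsphere P) = to_nsphere \<circ> (\<lambda>q. if q$1 \<le> 0 then h q else P) \<circ> from_nsphere"
    by (auto simp: fun_eq_iff)
  ultimately show ?thesis by (simp add: S3_degree_def)
qed

text \<open>On the hemisphere of non-negative real part squaring, extended by \<open>-1\<close>, is a map \<open>F\<close> that is
  nowhere antipodal to the identity: \<open>q\<^sup>2 = -q\<close> would mean \<open>q = -1\<close>. So \<open>F\<close> has degree 1. Since
  \<open>(-q)\<^sup>2 = q\<^sup>2\<close>, the other hemisphere contributes the degree of \<open>F\<close> composed with the antipodal map,
  which is 1 as well.\<close>

lemma S3_degree_qsquare: "S3_degree qsquare = 2"
proof -
  define F where "F = (\<lambda>q::real^4. if q$1 \<ge> 0 then qsquare q else - qone)"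
  have sqE: "qsquare q = - qone" if "q \<in> S3" "q$1 = 0" for q
    using that norm4_sq[of q] by (simp add: qsquare_def vec4_eq_iff power2_eq_square)
  have cF: "continuous_on S3 F"
  proof -
    have "continuous_on ({q\<in>S3. 0 \<le> q$1} \<union> {q\<in>S3. q$1 \<le> 0}) F"
      unfolding F_def
    proof (rule continuous_on_cases)
      have "closed (S3 \<inter> {q. 0 \<le> q$1})" "closed (S3 \<inter> {q. q$1 \<le> 0})"
        by (intro closed_Int closed_sphere closed_Collect_le linear_continuous_on[OF bounded_linear_vec_nth] continuous_on_const)+
      then show "closed {q\<in>S3. 0 \<le> q$1}" "closed {q\<in>S3. q$1 \<le> 0}"
        by (simp_all add: Int_def)
    qed (use sqE in \<open>auto intro!: continuous_on_qsquare continuous_intros\<close>)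
    moreover have "{q\<in>S3. 0 \<le> q$1} \<union> {q\<in>S3. q$1 \<le> 0} = S3" by auto
    ultimately show ?thesis by simp
  qed
  have FS: "F ` S3 \<subseteq> S3" by (auto simp: F_def qsquare_def norm_qmul)
  have "homotopic_with_canon (\<lambda>_. True) S3 S3 id F"
  proof (rule homotopic_sphere_maps_nonantipodal)
    fix q :: "real^4" assume q: "q \<in> S3"
    show "F q \<noteq> - id q"
    proof
      assume eq: "F q = - id q"
      show False
      proof (cases "q$1 \<ge> 0")
        case True
        then have "qmul q q = - q" using eq by (simp add: F_def qsquare_def)
        then have "qmul (qconj q) (qmul q q) = - qmul (qconj q) q" by (simp add: qmul.minus_right)
        then have "q = - qone" using q by (simp add: qmul_assoc[symmetric] qmul_qconj)
        then show False using True by simp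
      next
        case False
        then have "q = qone" using eq by (simp add: F_def)
        then show False using False by simp
      qed
    qed
  qed (use cF FS in \<open>auto simp: id_def\<close>)
  then have dF: "S3_degree F = 1" using S3_degree_homotopic S3_degree_id by metis
  have "S3_degree qsquare = S3_degree F + S3_degree (\<lambda>q. if q$1 \<le> 0 then qsquare q else - qone)"
    unfolding F_def by (rule S3_degree_pinch) (use sqE qsquare_sphere continuous_on_qsquare in auto)
  also have "(\<lambda>q. if q$1 \<le> 0 then qsquare q else - qone) = F \<circ> uminus"
    by (auto simp: F_def qsquare_def qmul.minus_left qmul.minus_right fun_eq_iff)
  also have "S3_degree (F \<circ> uminus) = 1"
    by (subst S3_degree_compose) (use cF FS dF S3_degree_antipode in \<open>auto intro!: continuous_intros\<close>)
  finally show ?thesis using dF by simp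
qed

lemma S3_degree_qsquare_pow: "S3_degree (qsquare ^^ n) = 2 ^ n"
proof (induction n)
  case 0 then show ?case using S3_degree_id by (simp add: id_def)
next
  case (Suc n)
  have "S3_degree (qsquare \<circ> (qsquare ^^ n)) = S3_degree qsquare * S3_degree (qsquare ^^ n)"
    by (rule S3_degree_compose) (use qsquare_pow_sphere qsquare_sphere continuous_on_qsquare continuous_on_qsquare_pow in auto)
  then show ?case using Suc S3_degree_qsquare by (simp add: o_def)
qed

section \<open>Calculus of smooth maps\<close>

lemma iter_deriv_append: "iter_deriv (vs @ ws) f = iter_deriv vs (iter_deriv ws f)"
  by (induction vs) simp_all

lemma frechet_derivative_cong_open:
  assumes "open U" "x \<in> U" "\<And>y. y \<in> U \<Longrightarrow> f y = g y"
  shows "frechet_derivative f (at x) = frechet_derivative g (at x)"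
proof -
  have "(f has_derivative f') (at x) \<longleftrightarrow> (g has_derivative f') (at x)" for f'
    using has_derivative_transform_within_open[OF _ assms(1,2)] assms(3) by metis
  then show ?thesis by (simp add: frechet_derivative_def)
qed

lemma iter_deriv_cong_open:
  assumes "open U" "\<And>y. y \<in> U \<Longrightarrow> f y = g y" "x \<in> U"
  shows "iter_deriv vs f x = iter_deriv vs g x"
  using assms(3)
proof (induction vs arbitrary: x)
  case (Cons v vs)
  then show ?case using frechet_derivative_cong_open[OF assms(1) Cons.prems, of "iter_deriv vs f" "iter_deriv vs g"] by simp
qed (use assms(2) in simp)

lemma differentiable_cong_open:
  assumes "f differentiable (at x)" "open U" "x \<in> U" "\<And>y. y \<in> U \<Longrightarrow> f y = g y"
  shows "g differentiable (at x)"
  using assms(1) has_derivative_transform_within_open[OF _ assms(2,3)] assms(4)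
  unfolding differentiable_def by metis

lemma smooth_cong:
  assumes f: "smooth_on_open U f" and eq: "\<And>y. y \<in> U \<Longrightarrow> f y = g y"
  shows "smooth_on_open U g"
  unfolding smooth_on_open_def
proof (intro conjI allI impI)
  show o: "open U" using f by (simp add: smooth_on_open_def)
  fix vs :: "'a list" assume "set vs \<subseteq> Basis"
  then have d: "iter_deriv vs f differentiable_on U" using f by (simp add: smooth_on_open_def)
  show "iter_deriv vs g differentiable_on U"
    unfolding differentiable_on_eq_differentiable_at[OF o]
  proof
    fix x assume x: "x \<in> U"
    have "iter_deriv vs f differentiable at x"
      using d x unfolding differentiable_on_eq_differentiable_at[OF o] by blast
    then show "iter_deriv vs g differentiable at x"
      by (rule differentiable_cong_open[OF _ o x]) (rule iter_deriv_cong_open[OF o eq])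
  qed
qed

text \<open>Smoothness is the greatest property that implies differentiability and is inherited by all
  partial derivatives. The rules for sums, products, composites and elementary functions apply this
  to classes of functions that are closed under partial derivatives.\<close>

lemma smooth_coinduct:
  fixes f :: "'a::euclidean_space \<Rightarrow> 'b::real_normed_vector"
  assumes "open U" and P: "P f"
    and d: "\<And>f x. P f \<Longrightarrow> x \<in> U \<Longrightarrow> f differentiable (at x)"
    and der: "\<And>f v. P f \<Longrightarrow> v \<in> Basis \<Longrightarrow> \<exists>g. P g \<and> (\<forall>x\<in>U. frechet_derivative f (at x) v = g x)"
  shows "smooth_on_open U f"
  unfolding smooth_on_open_def
proof (intro conjI allI impI assms(1))
  fix vs :: "'a list" assume vs: "set vs \<subseteq> Basis"
  then have "\<exists>g. P g \<and> (\<forall>x\<in>U. iter_deriv vs f x = g x)"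
  proof (induction vs)
    case (Cons v vs)
    then obtain g where g: "P g" "\<forall>x\<in>U. iter_deriv vs f x = g x" by auto
    obtain h where "P h" "\<forall>x\<in>U. frechet_derivative g (at x) v = h x" using der[OF g(1), of v] Cons.prems by auto
    then show ?case using g(2) frechet_derivative_cong_open[OF assms(1), of _ "iter_deriv vs f" g] by auto
  qed (use P in auto)
  then obtain g where g: "P g" "\<forall>x\<in>U. g x = iter_deriv vs f x" by metis
  show "iter_deriv vs f differentiable_on U"
    unfolding differentiable_on_eq_differentiable_at[OF assms(1)]
    using differentiable_cong_open[OF d[OF g(1)] assms(1)] g(2) by blast
qed

lemma smooth_imp_open: "smooth_on_open U f \<Longrightarrow> open U"
  by (simp add: smooth_on_open_def)

lemma smooth_subset:
  assumes "smooth_on_open U f" "open V" "V \<subseteq> U" shows "smooth_on_open V f"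
  using assms differentiable_on_subset unfolding smooth_on_open_def by blast

lemma smooth_iter_deriv:
  "smooth_on_open U f \<Longrightarrow> set vs \<subseteq> Basis \<Longrightarrow> smooth_on_open U (iter_deriv vs f)"
  by (simp add: smooth_on_open_def flip: iter_deriv_append)

lemma smooth_partial:
  "smooth_on_open U f \<Longrightarrow> v \<in> Basis \<Longrightarrow> smooth_on_open U (\<lambda>x. frechet_derivative f (at x) v)"
  using smooth_iter_deriv[of U f "[v]"] by simp

lemma smooth_differentiable:
  assumes "smooth_on_open U f" "x \<in> U" shows "f differentiable (at x)"
proof -
  have "iter_deriv [] f differentiable_on U"
    using assms(1)[unfolded smooth_on_open_def, THEN conjunct2, rule_format, of "[]"] by simp
  moreover have "open U" using assms(1) by (simp add: smooth_on_open_def)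
  ultimately show ?thesis using assms(2) by (simp add: differentiable_on_eq_differentiable_at)
qed

lemma smooth_has_derivative:
  "smooth_on_open U f \<Longrightarrow> x \<in> U \<Longrightarrow> (f has_derivative frechet_derivative f (at x)) (at x)"
  using smooth_differentiable frechet_derivative_works by blast

lemma smooth_continuous: "smooth_on_open U f \<Longrightarrow> continuous_on U f"
  using smooth_differentiable differentiable_imp_continuous_within continuous_at_imp_continuous_on by metis

lemma frechet_derivative_eqI: "(f has_derivative f') (at x) \<Longrightarrow> frechet_derivative f (at x) = f'"
  using frechet_derivative_at by metis

lemma smooth_local:
  assumes "\<And>x. x \<in> S \<Longrightarrow> \<exists>U g. x \<in> U \<and> smooth_on_open U g \<and> (\<forall>y\<in>S \<inter> U. g y = f y)" "open S"
  shows "smooth_on_open S f"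
  unfolding smooth_on_open_def
proof (intro conjI allI impI assms(2))
  fix vs :: "'a list" assume vs: "set vs \<subseteq> Basis"
  show "iter_deriv vs f differentiable_on S"
    unfolding differentiable_on_eq_differentiable_at[OF assms(2)]
  proof
    fix x assume x: "x \<in> S"
    obtain U g where U: "x \<in> U" "smooth_on_open U g" "\<forall>y\<in>S \<inter> U. g y = f y" using assms(1)[OF x] by blast
    have "smooth_on_open (S \<inter> U) g"
      using smooth_subset[OF U(2)] smooth_imp_open[OF U(2)] assms(2) by auto
    then have "smooth_on_open (S \<inter> U) f" by (rule smooth_cong) (use U in auto)
    from smooth_differentiable[OF smooth_iter_deriv[OF this vs]]
    show "iter_deriv vs f differentiable at x" using x U(1) by simp
  qed
qed

lemma smooth_UNIV_I: "smooth_on_open UNIV f \<Longrightarrow> open U \<Longrightarrow> smooth_on_open U f"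
  by (rule smooth_subset) auto

text \<open>The product rule and the chain rule lead from products and composites to sums of such
  functions, so the classes to which coinduction is applied consist of finite sums.\<close>

inductive sums_of ::
  "(('a::euclidean_space \<Rightarrow> 'b::real_normed_vector) \<Rightarrow> bool) \<Rightarrow> ('a \<Rightarrow> 'b) \<Rightarrow> bool" for P where
  base: "P f \<Longrightarrow> sums_of P f"
| add: "sums_of P f \<Longrightarrow> sums_of P g \<Longrightarrow> sums_of P (\<lambda>x. f x + g x)"

lemma sums_of_sum:
  assumes "finite I" "I \<noteq> {}" "\<And>i. i \<in> I \<Longrightarrow> P (f i)"
  shows "sums_of P (\<lambda>x. \<Sum>i\<in>I. f i x)"
  using assms
proof (induction I rule: finite_ne_induct)
  case (insert i I)
  then show ?case using sums_of.add[OF sums_of.base[of P "f i"], of "\<lambda>x. \<Sum>i\<in>I. f i x"] by simp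
qed (simp add: sums_of.base)

lemma smooth_sums_coinduct:
  fixes f :: "'a::euclidean_space \<Rightarrow> 'b::real_normed_vector"
  assumes "open U" and f: "sums_of P f"
    and der: "\<And>f. P f \<Longrightarrow> \<exists>f'. (\<forall>x\<in>U. (f has_derivative f' x) (at x)) \<and> (\<forall>v\<in>Basis. sums_of P (\<lambda>x. f' x v))"
  shows "smooth_on_open U f"
proof -
  have *: "\<exists>f'. (\<forall>x\<in>U. (f has_derivative f' x) (at x)) \<and> (\<forall>v\<in>Basis. sums_of P (\<lambda>x. f' x v))" if "sums_of P f" for f
    using that
  proof induction
    case (add f g)
    obtain f' where f': "\<forall>x\<in>U. (f has_derivative f' x) (at x)" "\<forall>v\<in>Basis. sums_of P (\<lambda>x. f' x v)"
      using add.IH by blast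
    obtain g' where g': "\<forall>x\<in>U. (g has_derivative g' x) (at x)" "\<forall>v\<in>Basis. sums_of P (\<lambda>x. g' x v)"
      using add.IH by blast
    show ?case
      by (rule exI[of _ "\<lambda>x v. f' x v + g' x v"]) (use f' g' in \<open>auto intro: has_derivative_add sums_of.add\<close>)
  qed (rule der)
  show ?thesis
  proof (rule smooth_coinduct[where P="sums_of P", OF assms(1) f])
    fix f x assume "sums_of P f" "x \<in> U"
    then show "f differentiable at x" using *[of f] by (auto simp: differentiable_def)
  next
    fix f and v :: 'a assume "sums_of P f" and v: "v \<in> Basis"
    then obtain f' where f': "\<forall>x\<in>U. (f has_derivative f' x) (at x)" "\<forall>v\<in>Basis. sums_of P (\<lambda>x. f' x v)"
      using * by blast
    then have "\<forall>x\<in>U. frechet_derivative f (at x) v = f' x v" using frechet_derivative_eqI by metis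
    then show "\<exists>g. sums_of P g \<and> (\<forall>x\<in>U. frechet_derivative f (at x) v = g x)" using f'(2) v by blast
  qed
qed

lemma smooth_const: "open U \<Longrightarrow> smooth_on_open U (\<lambda>_. c)"
  by (rule smooth_coinduct[where P="\<lambda>f. \<exists>c. f = (\<lambda>_. c)"]) auto

lemma smooth_add:
  assumes "smooth_on_open U f" "smooth_on_open U g"
  shows "smooth_on_open U (\<lambda>x. f x + g x)"
proof (rule smooth_sums_coinduct[where P="smooth_on_open U"])
  fix f :: "'a \<Rightarrow> 'b" assume f: "smooth_on_open U f"
  show "\<exists>f'. (\<forall>x\<in>U. (f has_derivative f' x) (at x)) \<and> (\<forall>v\<in>Basis. sums_of (smooth_on_open U) (\<lambda>x. f' x v))"
    by (rule exI[of _ "\<lambda>x. frechet_derivative f (at x)"])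
      (use f in \<open>auto intro: smooth_has_derivative sums_of.base smooth_partial\<close>)
qed (use assms in \<open>auto intro: sums_of.intros smooth_imp_open\<close>)

lemma smooth_bilinear:
  fixes f :: "'d::euclidean_space \<Rightarrow> 'a::real_normed_vector" and g :: "'d \<Rightarrow> 'b::real_normed_vector"
    and B :: "'a \<Rightarrow> 'b \<Rightarrow> 'c::real_normed_vector"
  assumes B: "bounded_bilinear B" and "smooth_on_open U f" "smooth_on_open U g"
  shows "smooth_on_open U (\<lambda>x. B (f x) (g x))"
proof -
  define P where "P = (\<lambda>h. \<exists>f g. smooth_on_open U f \<and> smooth_on_open U g \<and> h = (\<lambda>x. B (f x) (g x)))"
  have base: "sums_of P (\<lambda>x. B (f x) (g x))" if "smooth_on_open U f" "smooth_on_open U g" for f g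
    by (rule sums_of.base) (use that in \<open>auto simp: P_def\<close>)
  show ?thesis
  proof (rule smooth_sums_coinduct[where P=P])
    fix h assume "P h"
    then obtain f g where f: "smooth_on_open U f" and g: "smooth_on_open U g" and h: "h = (\<lambda>x. B (f x) (g x))"
      unfolding P_def by blast
    let ?h' = "\<lambda>x v. B (f x) (frechet_derivative g (at x) v) + B (frechet_derivative f (at x) v) (g x)"
    have "\<forall>x\<in>U. (h has_derivative ?h' x) (at x)"
      unfolding h by (intro ballI bounded_bilinear.FDERIV[OF B] smooth_has_derivative[OF f] smooth_has_derivative[OF g])
    moreover have "\<forall>v\<in>Basis. sums_of P (\<lambda>x. ?h' x v)"
      by (intro ballI sums_of.add base f g smooth_partial)
    ultimately show "\<exists>h'. (\<forall>x\<in>U. (h has_derivative h' x) (at x)) \<and> (\<forall>v\<in>Basis. sums_of P (\<lambda>x. h' x v))"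
      by (intro exI[of _ ?h'] conjI)
  qed (use assms base smooth_imp_open in auto)
qed

lemmas smooth_mult = smooth_bilinear[OF bounded_bilinear_mult]
lemmas smooth_scaleR = smooth_bilinear[OF bounded_bilinear_scaleR]
lemmas smooth_inner = smooth_bilinear[OF bounded_bilinear_inner]

text \<open>By the chain rule the partial derivatives of \<open>h \<circ> g\<close> are sums of functions \<open>a (h' \<circ> g)\<close> with
  \<open>h'\<close> a partial derivative of \<open>h\<close> and \<open>a\<close> one of a component of \<open>g\<close>. The class of all sums of
  functions \<open>a (h \<circ> g)\<close> is therefore closed under partial derivatives.\<close>

lemma smooth_compose:
  fixes g :: "'d::euclidean_space \<Rightarrow> 'a::euclidean_space" and h :: "'a \<Rightarrow> 'b::real_normed_vector"
  assumes g: "smooth_on_open U g" and h: "smooth_on_open V h" and gV: "g ` U \<subseteq> V"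
  shows "smooth_on_open U (\<lambda>x. h (g x))"
proof -
  note o = smooth_imp_open[OF g]
  define P where "P = (\<lambda>k :: 'd \<Rightarrow> 'b. \<exists>a h. smooth_on_open U a \<and> smooth_on_open V h \<and> k = (\<lambda>x. a x *\<^sub>R h (g x)))"
  have base: "P (\<lambda>x. a x *\<^sub>R h (g x))" if "smooth_on_open U a" "smooth_on_open V h" for a h
    using that by (auto simp: P_def)
  have "smooth_on_open U (\<lambda>x. 1 *\<^sub>R h (g x))"
  proof (rule smooth_sums_coinduct[where P=P, OF o])
    show "sums_of P (\<lambda>x. 1 *\<^sub>R h (g x))" by (intro sums_of.base base h smooth_const o)
  next
    fix k assume "P k"
    then obtain a h where a: "smooth_on_open U a" and h: "smooth_on_open V h" and k: "k = (\<lambda>x. a x *\<^sub>R h (g x))"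
      unfolding P_def by blast
    let ?dg = "\<lambda>x. frechet_derivative g (at x)" and ?da = "\<lambda>x. frechet_derivative a (at x)"
      and ?dh = "\<lambda>y. frechet_derivative h (at y)"
    define k' where "k' = (\<lambda>x v. (\<Sum>b\<in>Basis. (a x * (?dg x v \<bullet> b)) *\<^sub>R ?dh (g x) b) + ?da x v *\<^sub>R h (g x))"
    have "(k has_derivative k' x) (at x)" if x: "x \<in> U" for x
    proof -
      have gx: "g x \<in> V" using gV x by auto
      note dh = smooth_has_derivative[OF h gx]
      have "?dh (g x) w = (\<Sum>b\<in>Basis. (w \<bullet> b) *\<^sub>R ?dh (g x) b)" for w
        by (subst euclidean_representation[of w, symmetric])
          (simp only: linear_sum[OF has_derivative_linear[OF dh]] linear_cmul[OF has_derivative_linear[OF dh]])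
      then have "a x *\<^sub>R ?dh (g x) (?dg x v) = (\<Sum>b\<in>Basis. (a x * (?dg x v \<bullet> b)) *\<^sub>R ?dh (g x) b)" for v
        by (metis (no_types, lifting) scaleR_scaleR scaleR_sum_right sum.cong)
      then have "k' x = (\<lambda>v. a x *\<^sub>R ?dh (g x) (?dg x v) + ?da x v *\<^sub>R h (g x))"
        by (simp add: k'_def)
      then show ?thesis
        unfolding k using has_derivative_scaleR[OF smooth_has_derivative[OF a x]
            has_derivative_compose[OF smooth_has_derivative[OF g x] dh]] by simp
    qed
    moreover have "sums_of P (\<lambda>x. k' x v)" if v: "v \<in> Basis" for v
      unfolding k'_def
      by (intro sums_of.add sums_of_sum sums_of.base base[where h="\<lambda>y. ?dh y _"] base[where h=h]
          smooth_mult smooth_inner smooth_const smooth_partial a g h v o) auto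
    ultimately show "\<exists>k'. (\<forall>x\<in>U. (k has_derivative k' x) (at x)) \<and> (\<forall>v\<in>Basis. sums_of P (\<lambda>x. k' x v))"
      by blast
  qed
  then show ?thesis by simp
qed

lemma smooth_bounded_linear:
  assumes "bounded_linear L" "open U" shows "smooth_on_open U L"
proof (rule smooth_sums_coinduct[where P="\<lambda>f. f = L \<or> (\<exists>c. f = (\<lambda>_. c))", OF assms(2)])
  fix f assume "f = L \<or> (\<exists>c. f = (\<lambda>_. c))"
  then show "\<exists>f'. (\<forall>x\<in>U. (f has_derivative f' x) (at x)) \<and> (\<forall>v\<in>Basis. sums_of (\<lambda>f. f = L \<or> (\<exists>c. f = (\<lambda>_. c))) (\<lambda>x. f' x v))"
  proof
    assume "f = L"
    then show ?thesis
      by (intro exI[of _ "\<lambda>x. L"]) (auto intro: bounded_linear_imp_has_derivative[OF assms(1)] sums_of.base)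
  next
    assume "\<exists>c. f = (\<lambda>_. c)"
    then show ?thesis by (intro exI[of _ "\<lambda>x v. 0"]) (auto intro: sums_of.base)
  qed
qed (auto intro: sums_of.base)

lemma smooth_compose_linear:
  fixes f :: "'d::euclidean_space \<Rightarrow> 'a::real_normed_vector" and L :: "'a \<Rightarrow> 'b::real_normed_vector"
  assumes L: "bounded_linear L" and "smooth_on_open U f"
  shows "smooth_on_open U (\<lambda>x. L (f x))"
proof (rule smooth_sums_coinduct[where P="\<lambda>h. \<exists>f. smooth_on_open U f \<and> h = (\<lambda>x. L (f x))"])
  fix h assume "\<exists>f. smooth_on_open U f \<and> h = (\<lambda>x. L (f x))"
  then obtain f where f: "smooth_on_open U f" "h = (\<lambda>x. L (f x))" by blast
  show "\<exists>h'. (\<forall>x\<in>U. (h has_derivative h' x) (at x)) \<and>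
      (\<forall>v\<in>Basis. sums_of (\<lambda>h. \<exists>f. smooth_on_open U f \<and> h = (\<lambda>x. L (f x))) (\<lambda>x. h' x v))"
    by (rule exI[of _ "\<lambda>x v. L (frechet_derivative f (at x) v)"])
      (use f in \<open>auto intro!: sums_of.base bounded_linear.has_derivative[OF L] smooth_has_derivative intro: smooth_partial\<close>)
qed (use assms smooth_imp_open in \<open>auto intro!: sums_of.base\<close>)

lemma smooth_id: "open U \<Longrightarrow> smooth_on_open U (\<lambda>x. x)"
  by (rule smooth_bounded_linear[OF bounded_linear_ident])

lemma smooth_minus: "smooth_on_open U f \<Longrightarrow> smooth_on_open U (\<lambda>x. - f x)"
  using smooth_scaleR[OF smooth_const[OF smooth_imp_open], of U f f "-1"] by simp

lemma smooth_diff: "smooth_on_open U f \<Longrightarrow> smooth_on_open U g \<Longrightarrow> smooth_on_open U (\<lambda>x. f x - g x)"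
  using smooth_add[OF _ smooth_minus] by fastforce

lemma smooth_prod:
  fixes f :: "'i \<Rightarrow> 'a::euclidean_space \<Rightarrow> real"
  assumes "open U" "\<And>i. i \<in> I \<Longrightarrow> smooth_on_open U (f i)"
  shows "smooth_on_open U (\<lambda>x. \<Prod>i\<in>I. f i x)"
  using assms(2)
proof (induction I rule: infinite_finite_induct)
  case (insert i I)
  then show ?case using smooth_mult[of U "f i" "\<lambda>x. \<Prod>i\<in>I. f i x"] by simp
qed (use smooth_const[OF assms(1)] in auto)

lemma smooth_Pair:
  assumes "smooth_on_open U f" "smooth_on_open U g"
  shows "smooth_on_open U (\<lambda>x. (f x, g x))"
proof -
  have "smooth_on_open U (\<lambda>x. (f x, 0) + (0, g x))"
    by (intro smooth_add smooth_compose_linear[OF _ assms(1)] smooth_compose_linear[OF _ assms(2)]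
       bounded_linear_Pair bounded_linear_ident bounded_linear_zero)
  then show ?thesis by simp
qed

lemma smooth_fst: "smooth_on_open U f \<Longrightarrow> smooth_on_open U (\<lambda>x. fst (f x))"
  by (rule smooth_compose_linear[OF bounded_linear_fst])

lemma smooth_snd: "smooth_on_open U f \<Longrightarrow> smooth_on_open U (\<lambda>x. snd (f x))"
  by (rule smooth_compose_linear[OF bounded_linear_snd])

lemma smooth_real_coinduct:
  fixes f :: "real \<Rightarrow> real"
  assumes "open U" and P: "P f"
    and d: "\<And>f. P f \<Longrightarrow> \<exists>g. sums_of P g \<and> (\<forall>x\<in>U. (f has_real_derivative g x) (at x))"
  shows "smooth_on_open U f"
proof (rule smooth_sums_coinduct[where P=P, OF assms(1) sums_of.base[of P, OF P]])
  fix f assume "P f"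
  then obtain g where g: "sums_of P g" "\<forall>x\<in>U. (f has_real_derivative g x) (at x)" using d by blast
  then show "\<exists>f'. (\<forall>x\<in>U. (f has_derivative f' x) (at x)) \<and> (\<forall>v\<in>Basis. sums_of P (\<lambda>x. f' x v))"
    by (intro exI[of _ "\<lambda>x. (*) (g x)"]) (auto simp: has_field_derivative_def)
qed

lemma smooth_exp: "smooth_on_open UNIV (exp :: real \<Rightarrow> real)"
  by (rule smooth_real_coinduct[where P="\<lambda>f. f = exp"]) (auto intro!: sums_of.base DERIV_exp)

lemma smooth_sin_cos:
  "smooth_on_open UNIV (sin :: real \<Rightarrow> real)" "smooth_on_open UNIV (cos :: real \<Rightarrow> real)"
proof -
  have "smooth_on_open UNIV (\<lambda>x::real. a * sin x + b * cos x)" for a b :: real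
  proof (rule smooth_real_coinduct[where P="\<lambda>f. \<exists>a b. f = (\<lambda>x::real. a * sin x + b * cos x)"])
    fix f assume "\<exists>a b. f = (\<lambda>x::real. a * sin x + b * cos x)"
    then obtain a b where f: "f = (\<lambda>x::real. a * sin x + b * cos x)" by auto
    show "\<exists>g. sums_of (\<lambda>f. \<exists>a b. f = (\<lambda>x::real. a * sin x + b * cos x)) g \<and> (\<forall>x\<in>UNIV. (f has_real_derivative g x) (at x))"
      unfolding f
      by (intro exI[of _ "\<lambda>x. (- b) * sin x + a * cos x"] conjI sums_of.base exI[of _ "-b"] exI[of _ a])
        (auto intro!: derivative_eq_intros)
  qed auto
  from this[of 1 0] this[of 0 1] show "smooth_on_open UNIV (sin :: real \<Rightarrow> real)" "smooth_on_open UNIV (cos :: real \<Rightarrow> real)"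
    by simp_all
qed

text \<open>The real powers \<open>c x\<^sup>a\<close> on the positive half-line are closed under differentiation.\<close>

lemma smooth_sqrt: "smooth_on_open {0<..} sqrt"
proof -
  have "smooth_on_open {0<..} (\<lambda>x::real. c * x powr a)" for a c :: real
  proof (rule smooth_real_coinduct[where P="\<lambda>f. \<exists>c a. f = (\<lambda>x::real. c * x powr a)"])
    fix f assume "\<exists>c a. f = (\<lambda>x::real. c * x powr a)"
    then obtain c a where f: "f = (\<lambda>x::real. c * x powr a)" by auto
    show "\<exists>g. sums_of (\<lambda>f. \<exists>c a. f = (\<lambda>x::real. c * x powr a)) g \<and> (\<forall>x\<in>{0<..}. (f has_real_derivative g x) (at x))"
      unfolding f
      by (intro exI[of _ "\<lambda>x. (c * a) * x powr (a - 1)"] conjI sums_of.base exI[of _ "c * a"] exI[of _ "a - 1"])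
        (auto intro!: derivative_eq_intros)
  qed auto
  from this[of 1 "1/2"] show ?thesis
    by (rule smooth_cong) (simp add: powr_half_sqrt)
qed

text \<open>These functions \<open>t\<^bsup>-n\<^esup> exp (-1/t)\<close> are considered together because the derivatives of the
  standard flat function, the case \<open>n = 0\<close>, are linear combinations of them.\<close>

definition flat_fun :: "nat \<Rightarrow> real \<Rightarrow> real" where
  "flat_fun n t = (if t > 0 then inverse t ^ n * exp (- inverse t) else 0)"

text \<open>From \<open>exp y \<ge> y\<^bsup>n+2\<^esup> / (n+2)!\<close> with \<open>y = 1/t\<close>. The quadratic bound makes the derivative at 0
  vanish.\<close>

lemma flat_fun_le: "\<bar>flat_fun n t\<bar> \<le> fact (n + 2) * t\<^sup>2"
proof (cases "t > 0")
  case True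
  define y where "y = inverse t"
  have y: "y > 0" using True by (simp add: y_def)
  have "y ^ (n + 2) / fact (n + 2) \<le> exp y"
  proof -
    have "(\<Sum>i\<in>{n+2}. y ^ i /\<^sub>R fact i) \<le> suminf (\<lambda>i. y ^ i /\<^sub>R fact i)"
      by (rule sum_le_suminf) (use y summable_exp_generic[of y] in auto)
    then show ?thesis by (simp add: exp_def divide_inverse mult_ac)
  qed
  then have "y ^ (n + 2) * exp (- y) \<le> fact (n + 2)"
    by (simp add: exp_minus divide_simps mult.commute)
  then have "y ^ n * exp (- y) \<le> fact (n + 2) / y\<^sup>2"
    using y by (simp add: divide_simps power_add power2_eq_square mult_ac)
  then show ?thesis using True by (simp add: flat_fun_def y_def divide_inverse power_inverse)
qed (simp add: flat_fun_def)

lemma flat_fun_derivative: "(flat_fun n has_real_derivative (flat_fun (n + 2) t - real n * flat_fun (n + 1) t)) (at t)"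
proof -
  consider "t > 0" | "t < 0" | "t = 0" by linarith
  then show ?thesis
  proof cases
    case 1
    have "((\<lambda>t. inverse t ^ n * exp (- inverse t)) has_real_derivative
        (real n * inverse t ^ (n - 1) * (- (inverse t * inverse t))) * exp (- inverse t) +
        inverse t ^ n * (exp (- inverse t) * (inverse t * inverse t))) (at t)"
      using 1 by (auto intro!: derivative_eq_intros)
    also have "(real n * inverse t ^ (n - 1) * (- (inverse t * inverse t))) * exp (- inverse t) +
        inverse t ^ n * (exp (- inverse t) * (inverse t * inverse t)) = flat_fun (n + 2) t - real n * flat_fun (n + 1) t"
      using 1 by (cases n) (simp_all add: flat_fun_def algebra_simps)
    finally have "((\<lambda>t. inverse t ^ n * exp (- inverse t)) has_real_derivative (flat_fun (n + 2) t - real n * flat_fun (n + 1) t)) (at t)" .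
    then show ?thesis
      by (rule has_field_derivative_transform_within_open[where S="{0<..}"]) (use 1 in \<open>auto simp: flat_fun_def\<close>)
  next
    case 2
    have "((\<lambda>t. 0) has_real_derivative (flat_fun (n + 2) t - real n * flat_fun (n + 1) t)) (at t)"
      using 2 by (auto simp: flat_fun_def)
    then show ?thesis
      by (rule has_field_derivative_transform_within_open[where S="{..<0}"]) (use 2 in \<open>auto simp: flat_fun_def\<close>)
  next
    case 3
    have "((\<lambda>h. flat_fun n h / h) \<longlongrightarrow> 0) (at 0)"
    proof (rule Lim_null_comparison)
      show "\<forall>\<^sub>F h in at 0. norm (flat_fun n h / h) \<le> fact (n + 2) * \<bar>h\<bar>"
        unfolding eventually_at
      proof (intro exI[of _ 1] conjI ballI impI)
        fix h :: real assume "h \<noteq> 0 \<and> dist h 0 < 1"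
        then show "norm (flat_fun n h / h) \<le> fact (n + 2) * \<bar>h\<bar>"
          using flat_fun_le[of n h] by (simp add: divide_simps power2_eq_square abs_mult mult.assoc)
      qed simp
      show "((\<lambda>h. fact (n + 2) * \<bar>h\<bar>) \<longlongrightarrow> 0) (at (0::real))"
        by (auto intro!: tendsto_eq_intros)
    qed
    then show ?thesis using 3 by (simp add: DERIV_def flat_fun_def)
  qed
qed

lemma smooth_flat_fun: "smooth_on_open UNIV (flat_fun n)"
proof -
  define P where "P = (\<lambda>f. \<exists>c n. f = (\<lambda>t. c * flat_fun n t))"
  have base: "sums_of P (\<lambda>t. c * flat_fun n t)" for c n
    by (rule sums_of.base) (auto simp: P_def)
  have "smooth_on_open UNIV (\<lambda>t. 1 * flat_fun n t)"
  proof (rule smooth_real_coinduct[where P=P])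
    show "P (\<lambda>t. 1 * flat_fun n t)" unfolding P_def by blast
    fix f assume "P f"
    then obtain c n where f: "f = (\<lambda>t. c * flat_fun n t)" unfolding P_def by blast
    have "(f has_real_derivative (c * flat_fun (n + 2) t + (- (c * real n)) * flat_fun (n + 1) t)) (at t)" for t
      unfolding f by (auto intro!: derivative_eq_intros flat_fun_derivative simp: algebra_simps)
    then show "\<exists>g. sums_of P g \<and> (\<forall>x\<in>UNIV. (f has_real_derivative g x) (at x))"
      using sums_of.add[OF base base] by blast
  qed auto
  then show ?thesis by simp
qed

lemma smooth_imp_smooth_on: "smooth_on_open U f \<Longrightarrow> S \<subseteq> U \<Longrightarrow> smooth_on S f"
  unfolding smooth_on_def by blast

lemma smooth_on_imp_smooth_on_open: "smooth_on S f \<Longrightarrow> open S \<Longrightarrow> smooth_on_open S f"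
  unfolding smooth_on_def by (rule smooth_local) blast+

lemma smooth_on_subset: assumes "smooth_on S f" "T \<subseteq> S" shows "smooth_on T f"
  unfolding smooth_on_def
proof
  fix x assume "x \<in> T"
  then obtain U g where "x \<in> U" "smooth_on_open U g" "\<forall>y\<in>S \<inter> U. g y = f y"
    using assms unfolding smooth_on_def by blast
  then show "\<exists>U g. x \<in> U \<and> smooth_on_open U g \<and> (\<forall>y\<in>T \<inter> U. g y = f y)" using assms(2) by blast
qed

lemma smooth_on_cong:
  assumes "smooth_on S f" and eq: "\<And>x. x \<in> S \<Longrightarrow> f x = g x" shows "smooth_on S g"
  unfolding smooth_on_def
proof
  fix x assume "x \<in> S"
  then obtain U h where "x \<in> U" "smooth_on_open U h" "\<forall>y\<in>S \<inter> U. h y = f y"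
    using assms(1) unfolding smooth_on_def by blast
  then show "\<exists>U h. x \<in> U \<and> smooth_on_open U h \<and> (\<forall>y\<in>S \<inter> U. h y = g y)" using eq by auto
qed

lemma smooth_on_imp_continuous_on:
  assumes "smooth_on S f" shows "continuous_on S f"
  unfolding continuous_on_eq_continuous_within
proof
  fix x assume x: "x \<in> S"
  then obtain U g where U: "x \<in> U" "smooth_on_open U g" "\<forall>y\<in>S \<inter> U. g y = f y"
    using assms unfolding smooth_on_def by blast
  have "continuous (at x within S) g"
    using smooth_continuous[OF U(2)] smooth_imp_open[OF U(2)] U(1)
    by (metis continuous_at_imp_continuous_at_within continuous_on_eq_continuous_at)
  then show "continuous (at x within S) f"
    by (rule continuous_transform_within_openin[of x S g "S \<inter> U"])
      (use U x smooth_imp_open[OF U(2)] in \<open>auto simp: openin_open\<close>)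
qed

lemma smooth_on_compose:
  assumes f: "smooth_on S f" and g: "smooth_on T g" and fT: "f ` S \<subseteq> T"
  shows "smooth_on S (\<lambda>x. g (f x))"
  unfolding smooth_on_def
proof
  fix x assume x: "x \<in> S"
  obtain U f' where U: "x \<in> U" "smooth_on_open U f'" "\<forall>y\<in>S \<inter> U. f' y = f y"
    using f x unfolding smooth_on_def by blast
  obtain V g' where V: "f x \<in> V" "smooth_on_open V g'" "\<forall>y\<in>T \<inter> V. g' y = g y"
    using g x fT unfolding smooth_on_def by blast
  define W where "W = U \<inter> f' -` V"
  have oW: "open W"
    unfolding W_def Int_commute[of U]
    using continuous_open_vimage smooth_continuous[OF U(2)] smooth_imp_open[OF U(2)] smooth_imp_open[OF V(2)]
    by (metis Int_commute continuous_on_open_vimage)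
  have "smooth_on_open W (\<lambda>x. g' (f' x))"
    by (rule smooth_compose[OF smooth_subset[OF U(2) oW] V(2)]) (auto simp: W_def)
  moreover have "x \<in> W" using U V x by (auto simp: W_def)
  moreover have "\<forall>y\<in>S \<inter> W. g' (f' y) = g (f y)" using U V fT by (auto simp: W_def)
  ultimately show "\<exists>U h. x \<in> U \<and> smooth_on_open U h \<and> (\<forall>y\<in>S \<inter> U. h y = g (f y))" by blast
qed

text \<open>Continuous dependence of the derivatives of the slices on the parameter \<open>s\<close> reduces by this to
  continuity of the derivatives of \<open>G\<close>.\<close>

lemma iter_deriv_slice:
  fixes G :: "real \<times> 'a::euclidean_space \<Rightarrow> 'b::real_normed_vector"
  assumes G: "smooth_on_open Q G" and vs: "set vs \<subseteq> Basis" and y: "(s, y) \<in> Q"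
  shows "iter_deriv vs (\<lambda>y. G (s, y)) y = iter_deriv (map (Pair 0) vs) G (s, y)"
  using vs y
proof (induction vs arbitrary: y)
  case (Cons v vs)
  let ?D = "iter_deriv (map (Pair 0) vs) G"
  have o: "open {y. (s, y) \<in> Q}"
    using open_vimage[OF smooth_imp_open[OF G], of "Pair s"] by (simp add: vimage_def continuous_intros)
  have "set (map (Pair 0) vs) \<subseteq> (Basis :: (real \<times> 'a) set)"
    using Cons.prems(1) by (auto simp: Basis_prod_def)
  then have D: "(?D has_derivative frechet_derivative ?D (at (s, y))) (at (s, y))"
    using smooth_has_derivative[OF smooth_iter_deriv[OF G]] Cons.prems(2) by blast
  have "((\<lambda>y. ?D (s, y)) has_derivative (\<lambda>v. frechet_derivative ?D (at (s, y)) (0, v))) (at y)"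
    by (rule has_derivative_compose[where g="?D" and f="Pair s", simplified])
      (use D in \<open>auto intro!: derivative_eq_intros\<close>)
  then have "frechet_derivative (\<lambda>y. ?D (s, y)) (at y) v = frechet_derivative ?D (at (s, y)) (0, v)"
    by (simp add: frechet_derivative_eqI)
  moreover have "frechet_derivative (iter_deriv vs (\<lambda>y. G (s, y))) (at y) = frechet_derivative (\<lambda>y. ?D (s, y)) (at y)"
    by (rule frechet_derivative_cong_open[OF o]) (use Cons in auto)
  ultimately show ?case by simp
qed simp

lemma iter_deriv_diff:
  assumes "smooth_on_open U f" "smooth_on_open U g" "set vs \<subseteq> Basis" "x \<in> U"
  shows "iter_deriv vs (\<lambda>x. f x - g x) x = iter_deriv vs f x - iter_deriv vs g x"
  using assms(3,4)
proof (induction vs arbitrary: x)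
  case (Cons v vs)
  have "frechet_derivative (iter_deriv vs (\<lambda>x. f x - g x)) (at x) =
     frechet_derivative (\<lambda>x. iter_deriv vs f x - iter_deriv vs g x) (at x)"
    by (rule frechet_derivative_cong_open[OF smooth_imp_open[OF assms(1)] Cons.prems(2)]) (use Cons in auto)
  also have "\<dots> = (\<lambda>v. frechet_derivative (iter_deriv vs f) (at x) v - frechet_derivative (iter_deriv vs g) (at x) v)"
    by (intro frechet_derivative_eqI has_derivative_diff smooth_has_derivative[OF smooth_iter_deriv] assms)
      (use Cons.prems assms in auto)
  finally show ?case by simp
qed simp

section \<open>Weak derivatives and the Sobolev norm\<close>

lemma integral_translation:
  fixes f :: "'e::euclidean_space \<Rightarrow> 'f::euclidean_space"
  assumes "f \<in> borel_measurable borel"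
  shows "(LINT x|lborel. f (x + c)) = (LINT x|lborel. f x)"
proof -
  have "(LINT x|lborel. f x) = (LINT x|distr lborel borel ((+) c). f x)"
    by (simp add: lborel_distr_plus)
  also have "\<dots> = (LINT x|lborel. f (c + x))"
    by (rule integral_distr) (use assms in simp_all)
  finally show ?thesis by (simp add: add.commute)
qed

lemma iter_deriv_eq_0_outside:
  fixes f :: "'a::euclidean_space \<Rightarrow> 'b::real_normed_vector"
  assumes "closed K" "\<And>x. x \<notin> K \<Longrightarrow> f x = 0" "x \<notin> K"
  shows "iter_deriv vs f x = 0"
proof -
  have z: "iter_deriv vs (\<lambda>_::'a. 0::'b) = (\<lambda>_. 0)"
    by (induction vs) simp_all
  have "iter_deriv vs f x = iter_deriv vs (\<lambda>_. 0) x"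
    by (rule iter_deriv_cong_open[of "- K"]) (use assms in auto)
  then show ?thesis using z by simp
qed

text \<open>By translation invariance the difference quotients of \<open>\<psi>\<close> in the direction \<open>v\<close> have integral
  zero. They are bounded by the maximum of the derivative and supported in a fixed compact set, so
  dominated convergence gives the same for the derivative.\<close>

lemma integral_partial_derivative_eq_0:
  fixes \<psi> :: "'e::euclidean_space \<Rightarrow> 'f::euclidean_space"
  assumes \<psi>: "smooth_on_open UNIV \<psi>" and K: "compact K" and supp: "\<And>x. x \<notin> K \<Longrightarrow> \<psi> x = 0" and v: "v \<in> Basis"
  shows "(LINT x|lborel. frechet_derivative \<psi> (at x) v) = 0"
proof -
  define D where "D = (\<lambda>x. frechet_derivative \<psi> (at x) v)"
  have cD: "continuous_on UNIV D"
    unfolding D_def by (rule smooth_continuous[OF smooth_partial[OF \<psi> v]])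
  have c\<psi>: "continuous_on UNIV \<psi>" by (rule smooth_continuous[OF \<psi>])
  have D0: "D x = 0" if "x \<notin> K" for x
    using iter_deriv_eq_0_outside[of K \<psi> x "[v]"] supp that compact_imp_closed[OF K] by (simp add: D_def)
  have "bounded (D ` K)"
    by (rule compact_imp_bounded[OF compact_continuous_image[OF continuous_on_subset[OF cD] K]]) simp
  then obtain B where B: "B > 0" "\<forall>x\<in>K. norm (D x) \<le> B" by (auto simp: bounded_pos)
  then have DB: "norm (D x) \<le> B" for x using D0[of x] by (cases "x \<in> K") auto
  \<comment> \<open>Outside \<open>K'\<close> all difference quotients of step at most 1 vanish.\<close>
  define K' where "K' = (\<lambda>(x, s). x - s *\<^sub>R v) ` (K \<times> {0..1::real})"
  have K': "compact K'"
    unfolding K'_def by (intro compact_continuous_image compact_Times K) (auto simp: case_prod_beta intro!: continuous_intros)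
  define q where "q = (\<lambda>n x. (\<psi> (x + inverse (real (Suc n)) *\<^sub>R v) - \<psi> x) /\<^sub>R inverse (real (Suc n)))"
  have int\<psi>: "integrable lborel \<psi>"
  proof -
    have "\<psi> = (\<lambda>x. indicator K x *\<^sub>R \<psi> x)" using supp by (auto simp: indicator_def)
    then show ?thesis using borel_integrable_compact[OF K, of \<psi>] continuous_on_subset[OF c\<psi>] by simp
  qed
  have meas: "\<psi> \<in> borel_measurable borel" using c\<psi> by (simp add: borel_measurable_continuous_onI)
  have int\<psi>': "integrable lborel (\<lambda>x. \<psi> (x + c))" for c
  proof -
    have "integrable (distr lborel borel ((+) c)) \<psi>" using int\<psi> by (simp add: lborel_distr_plus)
    then show ?thesis by (subst (asm) integrable_distr_eq) (use meas in \<open>simp_all add: add.commute\<close>)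
  qed
  have q0: "(LINT x|lborel. q n x) = 0" for n
    unfolding q_def by (simp add: int\<psi> int\<psi>' integral_translation[OF meas])
  have bound: "norm (\<psi> (x + t *\<^sub>R v) - \<psi> x) \<le> B * t" if t: "0 \<le> t" for x t
  proof -
    have "norm (\<psi> (x + t *\<^sub>R v) - \<psi> (x + 0 *\<^sub>R v)) \<le> B * norm (t - 0)"
    proof (rule differentiable_bound[where S="{0..t}" and f="\<lambda>s. \<psi> (x + s *\<^sub>R v)" and f'="\<lambda>s h. h *\<^sub>R D (x + s *\<^sub>R v)"])
      fix s assume "s \<in> {0..t}"
      have d: "(\<psi> has_derivative frechet_derivative \<psi> (at (x + s *\<^sub>R v))) (at (x + s *\<^sub>R v))"
        by (rule smooth_has_derivative[OF \<psi>]) simp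
      have "((\<lambda>s. \<psi> (x + s *\<^sub>R v)) has_derivative (\<lambda>h. frechet_derivative \<psi> (at (x + s *\<^sub>R v)) (h *\<^sub>R v))) (at s within {0..t})"
        by (rule has_derivative_compose[where f="\<lambda>s. x + s *\<^sub>R v" and g=\<psi>, OF _ d]) (auto intro!: derivative_eq_intros)
      moreover have "frechet_derivative \<psi> (at (x + s *\<^sub>R v)) (h *\<^sub>R v) = h *\<^sub>R D (x + s *\<^sub>R v)" for h
        unfolding D_def using linear_cmul[OF has_derivative_linear[OF d]] by simp
      ultimately show "((\<lambda>s. \<psi> (x + s *\<^sub>R v)) has_derivative (\<lambda>h. h *\<^sub>R D (x + s *\<^sub>R v))) (at s within {0..t})"
        by simp
      show "onorm (\<lambda>h. h *\<^sub>R D (x + s *\<^sub>R v)) \<le> B"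
        by (rule onorm_bound) (use B DB in \<open>auto simp: mult.commute[of B] intro: mult_left_mono\<close>)
    qed (use t in auto)
    then show ?thesis using t by simp
  qed
  have qB: "norm (q n x) \<le> B * indicator K' x" for n x
  proof (cases "x \<in> K'")
    case True
    have "norm (q n x) = norm (\<psi> (x + inverse (real (Suc n)) *\<^sub>R v) - \<psi> x) / inverse (real (Suc n))"
      by (simp add: q_def divide_inverse mult.commute)
    also have "\<dots> \<le> B"
      using bound[of "inverse (real (Suc n))" x] by (subst pos_divide_le_eq) auto
    finally show ?thesis using True by simp
  next
    case False
    have "x + s *\<^sub>R v \<notin> K" if "s \<in> {0..1}" for s
    proof
      assume "x + s *\<^sub>R v \<in> K"
      then have "x \<in> K'" using that unfolding K'_def by (intro image_eqI[of _ _ "(x + s *\<^sub>R v, s)"]) auto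
      then show False using False by simp
    qed
    from this[of 0] this[of "inverse (real (Suc n))"] have "q n x = 0"
      using supp by (simp add: q_def field_simps)
    then show ?thesis using B(1) by (simp add: indicator_def)
  qed
  have qlim: "(\<lambda>n. q n x) \<longlonglongrightarrow> D x" for x
  proof -
    have d: "(\<psi> has_derivative frechet_derivative \<psi> (at x)) (at x)"
      by (rule smooth_has_derivative[OF \<psi>]) simp
    have "((\<lambda>s. \<psi> (x + s *\<^sub>R v)) has_derivative (\<lambda>h. frechet_derivative \<psi> (at x) (h *\<^sub>R v))) (at 0)"
      by (rule has_derivative_compose[where f="\<lambda>s. x + s *\<^sub>R v", of "\<lambda>h. h *\<^sub>R v"]) (use d in \<open>auto intro!: derivative_eq_intros\<close>)
    moreover have "frechet_derivative \<psi> (at x) (h *\<^sub>R v) = h *\<^sub>R D x" for h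
      unfolding D_def using linear_cmul[OF has_derivative_linear[OF d]] by simp
    ultimately have "((\<lambda>s. \<psi> (x + s *\<^sub>R v)) has_derivative (\<lambda>h. h *\<^sub>R D x)) (at 0)"
      by simp
    then have "((\<lambda>h. norm (\<psi> (x + h *\<^sub>R v) - \<psi> x - h *\<^sub>R D x) / norm h) \<longlongrightarrow> 0) (at 0)"
      by (simp add: has_derivative_at)
    then have "((\<lambda>h. norm ((\<psi> (x + h *\<^sub>R v) - \<psi> x) /\<^sub>R h - D x)) \<longlongrightarrow> 0) (at 0)"
    proof (rule Lim_transform_eventually)
      have "norm (\<psi> (x + h *\<^sub>R v) - \<psi> x - h *\<^sub>R D x) / norm h = norm ((\<psi> (x + h *\<^sub>R v) - \<psi> x) /\<^sub>R h - D x)"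
        if h: "h \<noteq> 0" for h :: real
      proof -
        have "(\<psi> (x + h *\<^sub>R v) - \<psi> x) /\<^sub>R h - D x = inverse h *\<^sub>R (\<psi> (x + h *\<^sub>R v) - \<psi> x - h *\<^sub>R D x)"
          using h by (simp add: scaleR_diff_right)
        then show ?thesis by (simp only: norm_scaleR) (simp add: divide_inverse mult.commute)
      qed
      then show "\<forall>\<^sub>F h in at 0. norm (\<psi> (x + h *\<^sub>R v) - \<psi> x - h *\<^sub>R D x) / norm h =
          norm ((\<psi> (x + h *\<^sub>R v) - \<psi> x) /\<^sub>R h - D x)"
        by (simp add: eventually_at_filter)
    qed
    then have "((\<lambda>h. (\<psi> (x + h *\<^sub>R v) - \<psi> x) /\<^sub>R h) \<longlongrightarrow> D x) (at 0)"
      by (simp add: tendsto_norm_zero_iff LIM_zero_iff)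
    moreover have "filterlim (\<lambda>n. inverse (real (Suc n))) (at 0) sequentially"
      by (intro filterlim_atI LIMSEQ_inverse_real_of_nat) auto
    ultimately show ?thesis unfolding q_def by (rule filterlim_compose)
  qed
  have "(\<lambda>n. LINT x|lborel. q n x) \<longlonglongrightarrow> (LINT x|lborel. D x)"
  proof (rule integral_dominated_convergence[where w="\<lambda>x. B * indicator K' x"])
    show "integrable lborel (\<lambda>x. B * indicator K' x)"
      using borel_integrable_compact[OF K', of "\<lambda>_. B"] by (simp add: mult.commute)
    show "D \<in> borel_measurable lborel" using cD by (simp add: borel_measurable_continuous_onI)
    show "q n \<in> borel_measurable lborel" for n
      using c\<psi> unfolding q_def
      by (auto intro!: borel_measurable_continuous_onI continuous_intros continuous_on_compose2[OF c\<psi>])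
  qed (use qB qlim in auto)
  then have "(\<lambda>n. 0) \<longlonglongrightarrow> (LINT x|lborel. D x)" using q0 by simp
  then have "(LINT x|lborel. D x) = 0" using LIMSEQ_unique tendsto_const by blast
  then show ?thesis by (simp add: D_def)
qed

lemma test_function_support:
  assumes "test_function \<Omega> \<phi>"
  obtains K where "compact K" "K \<subseteq> \<Omega>" "\<And>x. x \<notin> K \<Longrightarrow> \<phi> x = 0"
proof (rule that)
  show "compact (closure {x. \<phi> x \<noteq> 0})" "closure {x. \<phi> x \<noteq> 0} \<subseteq> \<Omega>"
    using assms by (auto simp: test_function_def)
  show "\<phi> x = 0" if "x \<notin> closure {x. \<phi> x \<noteq> 0}" for x
    using that closure_subset[of "{x. \<phi> x \<noteq> 0}"] by auto
qed

lemma test_functionI: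
  assumes "smooth_on_open UNIV \<phi>" "compact K" "K \<subseteq> \<Omega>" "\<And>x. x \<notin> K \<Longrightarrow> \<phi> x = 0"
  shows "test_function \<Omega> \<phi>"
proof -
  have "closure {x. \<phi> x \<noteq> 0} \<subseteq> K"
    by (rule closure_minimal) (use assms compact_imp_closed in auto)
  moreover have "compact (closure {x. \<phi> x \<noteq> 0})"
    using compact_closure bounded_subset[OF compact_imp_bounded[OF assms(2)], of "{x. \<phi> x \<noteq> 0}"] assms(4) by blast
  ultimately show ?thesis using assms by (auto simp: test_function_def)
qed

lemma test_function_iter_deriv:
  assumes "test_function \<Omega> \<phi>" "set vs \<subseteq> Basis"
  shows "test_function \<Omega> (iter_deriv vs \<phi>)"
proof -
  obtain K where K: "compact K" "K \<subseteq> \<Omega>" "\<And>x. x \<notin> K \<Longrightarrow> \<phi> x = 0" by (rule test_function_support[OF assms(1)]) (rule that)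
  show ?thesis
    by (rule test_functionI[OF smooth_iter_deriv[OF _ assms(2)] K(1,2)])
      (use assms(1) iter_deriv_eq_0_outside[OF compact_imp_closed[OF K(1)] K(3)] in \<open>auto simp: test_function_def\<close>)
qed

lemma set_integrable_supported:
  fixes f :: "'e::euclidean_space \<Rightarrow> 'f::euclidean_space"
  assumes "compact K" "K \<subseteq> \<Omega>" "continuous_on \<Omega> f" "\<And>x. x \<in> \<Omega> \<Longrightarrow> x \<notin> K \<Longrightarrow> f x = 0"
  shows "set_integrable lborel \<Omega> f"
proof -
  have "(\<lambda>x. indicator \<Omega> x *\<^sub>R f x) = (\<lambda>x. indicator K x *\<^sub>R f x)"
    using assms(2,4) by (auto simp: indicator_def fun_eq_iff)
  then show ?thesis
    using borel_integrable_compact[OF assms(1) continuous_on_subset[OF assms(3,2)]] by (simp add: set_integrable_def)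
qed

text \<open>The product of \<open>u\<close> with a test function, extended by zero, is smooth with compact support on the
  whole space, so the integral of its derivative vanishes.\<close>

lemma integral_by_parts:
  fixes u :: "'e::euclidean_space \<Rightarrow> 'f::euclidean_space"
  assumes \<phi>: "test_function \<Omega> \<phi>" and u: "smooth_on_open \<Omega> u" and v: "v \<in> Basis"
  shows "(LINT x:\<Omega>|lborel. frechet_derivative \<phi> (at x) v *\<^sub>R u x) =
    - (LINT x:\<Omega>|lborel. \<phi> x *\<^sub>R frechet_derivative u (at x) v)"
proof -
  obtain K where K: "compact K" "K \<subseteq> \<Omega>" and supp: "\<And>x. x \<notin> K \<Longrightarrow> \<phi> x = 0" by (rule test_function_support[OF \<phi>]) (rule that)
  have s\<phi>: "smooth_on_open UNIV \<phi>" using \<phi> by (simp add: test_function_def)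
  note o = smooth_imp_open[OF u]
  have s\<phi>': "smooth_on_open \<Omega> \<phi>" by (rule smooth_UNIV_I[OF s\<phi> o])
  define \<psi> where "\<psi> = (\<lambda>x. if x \<in> \<Omega> then \<phi> x *\<^sub>R u x else 0)"
  have s\<psi>\<Omega>: "smooth_on_open \<Omega> \<psi>"
    by (rule smooth_cong[OF smooth_scaleR[OF s\<phi>' u]]) (simp add: \<psi>_def)
  have \<psi>0: "\<psi> x = 0" if "x \<notin> K" for x using supp[OF that] by (simp add: \<psi>_def)
  have oK: "open (- K)" using compact_imp_closed[OF K(1)] by auto
  have s\<psi>: "smooth_on_open UNIV \<psi>"
  proof (rule smooth_local)
    fix x :: 'e
    show "\<exists>U g. x \<in> U \<and> smooth_on_open U g \<and> (\<forall>y\<in>UNIV \<inter> U. g y = \<psi> y)"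
    proof (cases "x \<in> \<Omega>")
      case True
      then show ?thesis using s\<psi>\<Omega> by blast
    next
      case False
      then show ?thesis using K(2) \<psi>0 smooth_const[OF oK, of "0::'f"]
        by (intro exI[of _ "- K"] exI[of _ "\<lambda>_. 0"]) auto
    qed
  qed simp
  have d\<psi>: "frechet_derivative \<psi> (at x) v = frechet_derivative \<phi> (at x) v *\<^sub>R u x + \<phi> x *\<^sub>R frechet_derivative u (at x) v"
    if x: "x \<in> \<Omega>" for x
  proof -
    have "frechet_derivative \<psi> (at x) = frechet_derivative (\<lambda>x. \<phi> x *\<^sub>R u x) (at x)"
      by (rule frechet_derivative_cong_open[OF o x]) (simp add: \<psi>_def)
    also have "\<dots> = (\<lambda>v. \<phi> x *\<^sub>R frechet_derivative u (at x) v + frechet_derivative \<phi> (at x) v *\<^sub>R u x)"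
      by (intro frechet_derivative_eqI has_derivative_scaleR smooth_has_derivative[OF s\<phi>' x] smooth_has_derivative[OF u x])
    finally show ?thesis by (simp add: add.commute)
  qed
  have d\<psi>0: "frechet_derivative \<psi> (at x) v = 0" if "x \<notin> K" for x
    using iter_deriv_eq_0_outside[of K \<psi> x "[v]"] \<psi>0 that compact_imp_closed[OF K(1)] by simp
  have d\<phi>0: "frechet_derivative \<phi> (at x) v = 0" if "x \<notin> K" for x
    using iter_deriv_eq_0_outside[of K \<phi> x "[v]"] supp that compact_imp_closed[OF K(1)] by simp
  have i1: "set_integrable lborel \<Omega> (\<lambda>x. frechet_derivative \<phi> (at x) v *\<^sub>R u x)"
    by (rule set_integrable_supported[OF K])
      (use d\<phi>0 in \<open>auto intro!: smooth_continuous smooth_scaleR u smooth_partial s\<phi>' v\<close>)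
  have i2: "set_integrable lborel \<Omega> (\<lambda>x. \<phi> x *\<^sub>R frechet_derivative u (at x) v)"
    by (rule set_integrable_supported[OF K])
      (use supp in \<open>auto intro!: smooth_continuous smooth_scaleR u smooth_partial s\<phi>' v\<close>)
  have "0 = (LINT x|lborel. frechet_derivative \<psi> (at x) v)"
    using integral_partial_derivative_eq_0[OF s\<psi> K(1) \<psi>0 v] by simp
  also have "\<dots> = (LINT x:\<Omega>|lborel. frechet_derivative \<phi> (at x) v *\<^sub>R u x + \<phi> x *\<^sub>R frechet_derivative u (at x) v)"
    unfolding set_lebesgue_integral_def
  proof (rule Bochner_Integration.integral_cong[OF refl])
    fix x
    show "frechet_derivative \<psi> (at x) v = indicator \<Omega> x *\<^sub>R
         (frechet_derivative \<phi> (at x) v *\<^sub>R u x + \<phi> x *\<^sub>R frechet_derivative u (at x) v)"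
      using d\<psi>[of x] d\<psi>0[of x] K(2) by (cases "x \<in> \<Omega>") auto
  qed
  also have "\<dots> = (LINT x:\<Omega>|lborel. frechet_derivative \<phi> (at x) v *\<^sub>R u x) + (LINT x:\<Omega>|lborel. \<phi> x *\<^sub>R frechet_derivative u (at x) v)"
    by (rule set_integral_add(2)[OF i1 i2])
  finally show ?thesis by (simp add: eq_neg_iff_add_eq_0)
qed

text \<open>Integration by parts moves the outermost derivative of the test function to \<open>u\<close> first; this
  reverses the order of differentiation.\<close>

lemma has_weak_deriv_smooth:
  assumes "smooth_on_open \<Omega> u" "set vs \<subseteq> Basis"
  shows "has_weak_deriv \<Omega> vs u (iter_deriv (rev vs) u)"
  unfolding has_weak_deriv_def
proof (intro allI impI)
  fix \<phi> assume "test_function \<Omega> \<phi>"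
  then show "(LINT x:\<Omega>|lborel. iter_deriv vs \<phi> x *\<^sub>R u x) = (- 1) ^ length vs *\<^sub>R (LINT x:\<Omega>|lborel. \<phi> x *\<^sub>R iter_deriv (rev vs) u x)"
    using assms
  proof (induction vs arbitrary: u)
    case (Cons v vs)
    have v: "v \<in> Basis" "set vs \<subseteq> Basis" using Cons.prems by auto
    have "(LINT x:\<Omega>|lborel. iter_deriv (v # vs) \<phi> x *\<^sub>R u x) =
       - (LINT x:\<Omega>|lborel. iter_deriv vs \<phi> x *\<^sub>R iter_deriv [v] u x)"
      using integral_by_parts[OF test_function_iter_deriv[OF Cons.prems(1) v(2)] Cons.prems(2) v(1)] by simp
    also have "(LINT x:\<Omega>|lborel. iter_deriv vs \<phi> x *\<^sub>R iter_deriv [v] u x) =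
       (- 1) ^ length vs *\<^sub>R (LINT x:\<Omega>|lborel. \<phi> x *\<^sub>R iter_deriv (rev vs) (iter_deriv [v] u) x)"
      by (rule Cons.IH) (use Cons.prems v smooth_partial in auto)
    finally show ?case by (simp add: iter_deriv_append)
  qed simp
qed

text \<open>Boxes form an intersection-stable generator of the Borel sets, so \<open>g\<close> integrates to zero over
  every Borel set, in particular over the sets where it is positive and where it is negative.\<close>

lemma integral_zero_boxes_imp_AE_zero:
  fixes g :: "'e::euclidean_space \<Rightarrow> real"
  assumes g: "integrable lborel g" and z: "\<And>a b. (LINT x:box a b|lborel. g x) = 0"
    and zU: "(LINT x|lborel. g x) = 0"
  shows "AE x in lborel. g x = 0"
proof -
  have si: "set_integrable lborel A g" if "A \<in> sets borel" for A
    unfolding set_integrable_def by (rule integrable_mult_indicator) (use that g in auto)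
  have "(LINT x:A|lborel. g x) = 0" if "A \<in> sigma_sets UNIV (range (\<lambda>(a, b). box a b :: 'e set))" for A
  proof -
    have "Int_stable (range (\<lambda>(a, b). box a b :: 'e set))"
    proof (rule Int_stableI)
      fix A B assume "A \<in> range (\<lambda>(a, b). box a b :: 'e set)" "B \<in> range (\<lambda>(a, b). box a b :: 'e set)"
      then obtain a b c d where "A = box a b" "B = box c d" by auto
      then have "A \<inter> B = (\<lambda>(a, b). box a b) (\<Sum>i\<in>Basis. max (a \<bullet> i) (c \<bullet> i) *\<^sub>R i, \<Sum>i\<in>Basis. min (b \<bullet> i) (d \<bullet> i) *\<^sub>R i)"
        by (simp add: box_Int_box)
      then show "A \<inter> B \<in> range (\<lambda>(a, b). box a b :: 'e set)" by (rule range_eqI)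
    qed
    moreover have "range (\<lambda>(a, b). box a b :: 'e set) \<subseteq> Pow UNIV" by auto
    ultimately show ?thesis using that
    proof (induction rule: sigma_sets_induct_disjoint)
      case (basic A)
      then show ?case using z by auto
    next
      case empty
      then show ?case by (simp add: set_lebesgue_integral_def)
    next
      case (compl A)
      then have A: "A \<in> sets borel" by (simp add: borel_eq_box)
      have "(LINT x|lborel. g x) = (LINT x:A \<union> (UNIV - A)|lborel. g x)" by (simp add: set_lebesgue_integral_def)
      also have "\<dots> = (LINT x:A|lborel. g x) + (LINT x:UNIV - A|lborel. g x)"
        by (rule set_integral_Un) (use si A in auto)
      finally show ?case using zU compl by simp
    next
      case (union A)
      then have A: "A i \<in> sets borel" for i by (auto simp: borel_eq_box)
      have "(LINT x:(\<Union>i. A i)|lborel. g x) = suminf (\<lambda>i. LINT x:(A i)|lborel. g x)"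
        by (rule lebesgue_integral_countable_add) (use A si union in \<open>auto simp: disjoint_family_on_def\<close>)
      then show ?case using union by simp
    qed
  qed
  then have zb: "(LINT x:A|lborel. g x) = 0" if "A \<in> sets borel" for A
    using that by (simp add: borel_eq_box)
  have gm [measurable]: "g \<in> borel_measurable lborel" using g by auto
  have pos: "AE x in lborel. indicator A x * h x = (0::real)"
    if "integrable lborel h" "A \<in> sets borel" "(LINT x:A|lborel. h x) = 0" "\<And>x. x \<in> A \<Longrightarrow> h x \<ge> 0" for A and h :: "'e \<Rightarrow> real"
  proof -
    have i: "integrable lborel (\<lambda>x. indicator A x * h x)"
      using integrable_mult_indicator[of A lborel h] that by auto
    moreover have "(LINT x|lborel. indicator A x * h x) = 0" using that(3) by (simp add: set_lebesgue_integral_def)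
    ultimately show ?thesis
      using that(4) by (subst (asm) integral_nonneg_eq_0_iff_AE) (auto simp: indicator_def)
  qed
  have "{x \<in> space lborel. g x > 0} \<in> sets lborel" "{x \<in> space lborel. g x < 0} \<in> sets lborel"
    by measurable
  then have m1: "{x. g x > 0} \<in> sets borel" and m2: "{x. g x < 0} \<in> sets borel"
    by simp_all
  have "AE x in lborel. indicator {x. g x > 0} x * g x = 0"
    by (rule pos[OF g m1 zb[OF m1]]) auto
  moreover have "AE x in lborel. indicator {x. g x < 0} x * (- g x) = 0"
    by (rule pos[OF _ m2]) (use g zb[OF m2] in \<open>auto simp: set_lebesgue_integral_def\<close>)
  ultimately show ?thesis
    by eventually_elim (auto simp: indicator_def split: if_splits)
qed

text \<open>On sets of finite measure this bounds the integral of a function by that of its square.\<close>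

lemma le_one_plus_square: "(t::real) \<le> 1 + t\<^sup>2"
  using zero_le_power2[of "t - 1/2"] by (simp add: power2_eq_square algebra_simps)

lemma test_function_mult_integrable:
  assumes o: "open \<Omega>" and \<phi>: "test_function \<Omega> \<phi>" and u: "L2_on \<Omega> u"
  shows "set_integrable lborel \<Omega> (\<lambda>x. \<phi> x *\<^sub>R u x)"
proof -
  obtain K where K: "compact K" "K \<subseteq> \<Omega>" and supp: "\<And>x. x \<notin> K \<Longrightarrow> \<phi> x = 0" by (rule test_function_support[OF \<phi>]) (rule that)
  have c\<phi>: "continuous_on UNIV \<phi>" using \<phi> smooth_continuous by (auto simp: test_function_def)
  have "bounded (\<phi> ` K)"
    by (rule compact_imp_bounded[OF compact_continuous_image[OF continuous_on_subset[OF c\<phi>] K(1)]]) simp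
  then obtain B where B: "B > 0" "\<forall>x\<in>K. norm (\<phi> x) \<le> B" by (auto simp: bounded_pos)
  have i: "set_integrable lborel \<Omega> (\<lambda>x. (norm (u x))\<^sup>2)" and m: "set_borel_measurable lborel \<Omega> u"
    using u by (auto simp: L2_on_def)
  have "set_integrable lborel \<Omega> (indicator K :: _ \<Rightarrow> real)"
  proof -
    have "(\<lambda>x. indicator \<Omega> x *\<^sub>R (indicator K x :: real)) = (\<lambda>x. indicator K x *\<^sub>R 1)"
      using K(2) by (auto simp: indicator_def fun_eq_iff)
    then show ?thesis
      using borel_integrable_compact[OF K(1), of "\<lambda>_. 1::real"] by (simp add: set_integrable_def)
  qed
  then have "set_integrable lborel \<Omega> (\<lambda>x. B * (indicator K x + (norm (u x))\<^sup>2))"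
    by (intro set_integrable_mult_right set_integral_add(1) i)
  then show ?thesis
  proof (rule set_integrable_bound)
    have "\<phi> \<in> borel_measurable lborel" using c\<phi> by (simp add: borel_measurable_continuous_onI)
    then have "(\<lambda>x. \<phi> x *\<^sub>R (indicator \<Omega> x *\<^sub>R u x)) \<in> borel_measurable lborel"
      using m unfolding set_borel_measurable_def by (rule borel_measurable_scaleR)
    then show "set_borel_measurable lborel \<Omega> (\<lambda>x. \<phi> x *\<^sub>R u x)"
      unfolding set_borel_measurable_def by (simp add: mult.commute)
    have le: "norm (u x) \<le> 1 + (norm (u x))\<^sup>2" for x by (rule le_one_plus_square)
    have "norm (\<phi> x *\<^sub>R u x) \<le> norm (B * (indicator K x + (norm (u x))\<^sup>2))" for x
    proof (cases "x \<in> K")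
      case True
      have "norm (\<phi> x *\<^sub>R u x) \<le> B * (1 + (norm (u x))\<^sup>2)"
        using True B le by (auto intro!: mult_mono)
      then show ?thesis using True B by simp
    qed (use supp B in simp)
    then show "AE x in lborel. x \<in> \<Omega> \<longrightarrow> norm (\<phi> x *\<^sub>R u x) \<le> norm (B * (indicator K x + (norm (u x))\<^sup>2))" by simp
  qed
qed

text \<open>A product of flat functions is positive exactly on the open box. If \<open>\<beta>\<close> is this product, then
  \<open>1 - exp (-n\<beta>)\<close> is a smooth function that increases to the indicator function.\<close>

lemma test_function_bump:
  fixes a b :: "'e::euclidean_space"
  assumes "cbox a b \<subseteq> \<Omega>"
  obtains \<phi> :: "nat \<Rightarrow> 'e \<Rightarrow> real" where "\<And>n. test_function \<Omega> (\<phi> n)" "\<And>n x. \<bar>\<phi> n x\<bar> \<le> indicator (cbox a b) x"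
    "\<And>x. (\<lambda>n. \<phi> n x) \<longlonglongrightarrow> indicator (box a b) x"
proof -
  define \<beta> where "\<beta> = (\<lambda>x::'e. \<Prod>i\<in>Basis. flat_fun 0 ((x - a) \<bullet> i) * flat_fun 0 ((b - x) \<bullet> i))"
  define \<phi> where "\<phi> = (\<lambda>n::nat. \<lambda>x. 1 - exp (- (real n * \<beta> x)))"
  have sl: "smooth_on_open UNIV (\<lambda>x::'e. (x - a) \<bullet> i)" "smooth_on_open UNIV (\<lambda>x::'e. (b - x) \<bullet> i)" for i
    by (intro smooth_inner smooth_diff smooth_id smooth_const open_UNIV)+
  have s\<beta>: "smooth_on_open UNIV \<beta>"
    unfolding \<beta>_def
    by (intro smooth_prod smooth_mult smooth_compose[OF sl(1) smooth_flat_fun]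
      smooth_compose[OF sl(2) smooth_flat_fun]) auto
  have s\<phi>: "smooth_on_open UNIV (\<phi> n)" for n
    unfolding \<phi>_def
    by (intro smooth_diff smooth_const open_UNIV smooth_compose[OF _ smooth_exp]
       smooth_minus smooth_mult s\<beta>) auto
  have \<beta>pos: "\<beta> x > 0" if "x \<in> box a b" for x
    unfolding \<beta>_def using that by (intro prod_pos) (auto simp: flat_fun_def mem_box inner_diff_left)
  have \<beta>0: "\<beta> x = 0" if nb: "x \<notin> box a b" for x
  proof -
    obtain i where "i \<in> Basis" "\<not> (a \<bullet> i < x \<bullet> i \<and> x \<bullet> i < b \<bullet> i)" using nb unfolding mem_box by blast
    then show ?thesis unfolding \<beta>_def
      by (intro prod_zero bexI[of _ i]) (auto simp: flat_fun_def inner_diff_left)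
  qed
  show ?thesis
  proof
    fix n x
    have n0: "\<phi> n x = 0" if "x \<notin> box a b" for x using \<beta>0[OF that] by (simp add: \<phi>_def)
    show "test_function \<Omega> (\<phi> n)"
      by (rule test_functionI[OF s\<phi> compact_cbox assms]) (use n0 box_subset_cbox in blast)
    show "\<bar>\<phi> n x\<bar> \<le> indicator (cbox a b) x"
    proof (cases "x \<in> box a b")
      case True
      then have "0 \<le> \<phi> n x" "\<phi> n x \<le> 1" using \<beta>pos[of x] by (auto simp: \<phi>_def)
      then show ?thesis using True box_subset_cbox[of a b] by auto
    qed (use n0 in simp)
    show "(\<lambda>n. \<phi> n x) \<longlonglongrightarrow> indicator (box a b) x"
    proof (cases "x \<in> box a b")
      case True
      have "(\<lambda>n. exp (- \<beta> x) ^ n) \<longlonglongrightarrow> 0"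
        by (rule LIMSEQ_power_zero) (use \<beta>pos[OF True] in simp)
      then have "(\<lambda>n. exp (- (real n * \<beta> x))) \<longlonglongrightarrow> 0"
        by (simp add: exp_of_nat_mult[symmetric])
      then have "(\<lambda>n. 1 - exp (- (real n * \<beta> x))) \<longlonglongrightarrow> 1 - 0" by (intro tendsto_diff tendsto_const)
      then show ?thesis using True by (simp add: \<phi>_def)
    qed (use \<beta>0 in \<open>simp add: \<phi>_def\<close>)
  qed
qed

text \<open>The fundamental lemma of the calculus of variations: by dominated convergence along the functions
  of \<open>test_function_bump\<close>, \<open>w\<close> integrates to zero over every box inside \<open>\<Omega>\<close>. Countably many such boxes
  cover \<open>\<Omega>\<close>.\<close>

lemma weak_zero_imp_AE_zero:
  fixes w :: "'e::euclidean_space \<Rightarrow> 'f::euclidean_space"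
  assumes o: "open \<Omega>" and w: "L2_on \<Omega> w"
    and z: "\<And>\<phi>. test_function \<Omega> \<phi> \<Longrightarrow> (LINT x:\<Omega>|lborel. \<phi> x *\<^sub>R w x) = 0"
  shows "AE x in lborel. x \<in> \<Omega> \<longrightarrow> w x = 0"
proof -
  have m: "set_borel_measurable lborel \<Omega> w" using w by (simp add: L2_on_def)
  have box0: "(LINT x:box a b|lborel. w x) = 0" and boxi: "set_integrable lborel (box a b) w" if ab: "cbox a b \<subseteq> \<Omega>" for a b
  proof -
    obtain \<phi> :: "nat \<Rightarrow> 'e \<Rightarrow> real" where \<phi>: "\<And>n. test_function \<Omega> (\<phi> n)"
      "\<And>n x. \<bar>\<phi> n x\<bar> \<le> indicator (cbox a b) x" "\<And>x. (\<lambda>n. \<phi> n x) \<longlonglongrightarrow> indicator (box a b) x"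
      using test_function_bump[OF ab] by blast
    have i: "set_integrable lborel \<Omega> (\<lambda>x. (norm (w x))\<^sup>2)" using w by (simp add: L2_on_def)
    have ic: "integrable lborel (indicator (cbox a b) :: 'e \<Rightarrow> real)"
      using borel_integrable_compact[OF compact_cbox, of a b "\<lambda>_. 1::real"] by simp
    have iw: "integrable lborel (\<lambda>x. indicator (cbox a b) x + indicator \<Omega> x *\<^sub>R (norm (w x))\<^sup>2)"
      using i ic by (intro Bochner_Integration.integrable_add) (auto simp: set_integrable_def)
    have le: "norm (w x) \<le> 1 + (norm (w x))\<^sup>2" for x by (rule le_one_plus_square)
    have mw: "(\<lambda>x. indicator \<Omega> x *\<^sub>R w x) \<in> borel_measurable lborel" using m by (simp add: set_borel_measurable_def)
    have ind: "indicator (box a b) x *\<^sub>R w x = indicator (box a b) x *\<^sub>R (indicator \<Omega> x *\<^sub>R w x)" for x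
      using ab box_subset_cbox[of a b] by (auto simp: indicator_def)
    have mb: "(\<lambda>x. indicator (box a b) x *\<^sub>R w x) \<in> borel_measurable lborel"
      unfolding ind by (intro borel_measurable_scaleR mw) auto
    have nb: "norm (indicator (box a b) x *\<^sub>R w x) \<le> norm (indicator (cbox a b) x + indicator \<Omega> x *\<^sub>R (norm (w x))\<^sup>2)" for x
      using ab box_subset_cbox[of a b] le[of x] by (auto simp: indicator_def)
    show "set_integrable lborel (box a b) w"
      unfolding set_integrable_def by (rule Bochner_Integration.integrable_bound[OF iw mb]) (use nb in auto)
    have "(\<lambda>n. LINT x|lborel. indicator \<Omega> x *\<^sub>R (\<phi> n x *\<^sub>R w x)) \<longlonglongrightarrow> (LINT x|lborel. indicator (box a b) x *\<^sub>R w x)"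
    proof (rule integral_dominated_convergence[OF mb _ iw])
      show "(\<lambda>x. indicator \<Omega> x *\<^sub>R (\<phi> n x *\<^sub>R w x)) \<in> borel_measurable lborel" for n
        using test_function_mult_integrable[OF o \<phi>(1) w, of n] by (auto simp: set_integrable_def)
      have l1: "(\<lambda>n. indicator \<Omega> x *\<^sub>R (\<phi> n x *\<^sub>R w x)) \<longlonglongrightarrow> indicator \<Omega> x *\<^sub>R (indicator (box a b) x *\<^sub>R w x)" for x
        by (intro tendsto_intros \<phi>)
      have eq: "indicator \<Omega> x *\<^sub>R (indicator (box a b) x *\<^sub>R w x) = indicator (box a b) x *\<^sub>R w x" for x
        using ab box_subset_cbox[of a b] by (auto simp: indicator_def)
      show "AE x in lborel. (\<lambda>n. indicator \<Omega> x *\<^sub>R (\<phi> n x *\<^sub>R w x)) \<longlonglongrightarrow> indicator (box a b) x *\<^sub>R w x"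
        by (rule AE_I2) (use l1 in \<open>simp only: eq\<close>)
      have "norm (indicator \<Omega> x *\<^sub>R (\<phi> n x *\<^sub>R w x)) \<le> indicator (cbox a b) x + indicator \<Omega> x *\<^sub>R (norm (w x))\<^sup>2" for n x
      proof (cases "x \<in> cbox a b")
        case True
        then have "\<bar>\<phi> n x\<bar> \<le> 1" using \<phi>(2)[of n x] by simp
        then have "\<bar>\<phi> n x\<bar> * norm (w x) \<le> 1 * (1 + (norm (w x))\<^sup>2)" using le by (intro mult_mono) auto
        then show ?thesis using True ab by auto
      qed (use \<phi>(2)[of n x] in auto)
      then show "AE x in lborel. norm (indicator \<Omega> x *\<^sub>R (\<phi> n x *\<^sub>R w x)) \<le> indicator (cbox a b) x + indicator \<Omega> x *\<^sub>R (norm (w x))\<^sup>2" for n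
        by simp
    qed
    moreover have "(LINT x|lborel. indicator \<Omega> x *\<^sub>R (\<phi> n x *\<^sub>R w x)) = 0" for n
      using z[OF \<phi>(1)] by (simp add: set_lebesgue_integral_def)
    ultimately have "(\<lambda>n. 0) \<longlonglongrightarrow> (LINT x|lborel. indicator (box a b) x *\<^sub>R w x)" by simp
    then have "(LINT x|lborel. indicator (box a b) x *\<^sub>R w x) = 0" using LIMSEQ_unique tendsto_const by blast
    then show "(LINT x:box a b|lborel. w x) = 0" by (simp add: set_lebesgue_integral_def)
  qed
  have AEbox: "AE x in lborel. x \<in> box a b \<longrightarrow> w x = 0" if ab: "cbox a b \<subseteq> \<Omega>" for a b
  proof -
    have "AE x in lborel. indicator (box a b) x * (w x \<bullet> i) = 0" if i: "i \<in> Basis" for i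
    proof (rule integral_zero_boxes_imp_AE_zero)
      have int: "integrable lborel (\<lambda>x. indicator (box a b) x *\<^sub>R w x)" using boxi[OF ab] by (simp add: set_integrable_def)
      then show "integrable lborel (\<lambda>x. indicator (box a b) x * (w x \<bullet> i))"
        using integrable_inner_left[of i lborel "\<lambda>x. indicator (box a b) x *\<^sub>R w x"] by simp
      show "(LINT x|lborel. indicator (box a b) x * (w x \<bullet> i)) = 0"
        using box0[OF ab] integral_inner_left[of i lborel "\<lambda>x. indicator (box a b) x *\<^sub>R w x"] int
        by (simp add: set_lebesgue_integral_def)
      fix c d
      define e where "e = (\<Sum>j\<in>Basis. max (a \<bullet> j) (c \<bullet> j) *\<^sub>R j)"
      define f where "f = (\<Sum>j\<in>Basis. min (b \<bullet> j) (d \<bullet> j) *\<^sub>R j)"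
      have ef: "box a b \<inter> box c d = box e f" "cbox a b \<inter> cbox c d = cbox e f"
        by (simp_all add: e_def f_def box_Int_box Int_interval)
      have sub: "cbox e f \<subseteq> \<Omega>" using ef ab by blast
      have "(LINT x|lborel. (indicator (box e f) x *\<^sub>R w x) \<bullet> i) = 0"
        using box0[OF sub] boxi[OF sub] integral_inner_left[of i lborel "\<lambda>x. indicator (box e f) x *\<^sub>R w x"]
        by (simp add: set_lebesgue_integral_def set_integrable_def)
      then show "(LINT x:box c d|lborel. indicator (box a b) x * (w x \<bullet> i)) = 0"
        unfolding set_lebesgue_integral_def ef(1)[symmetric] by (simp add: indicator_inter_arith mult_ac)
    qed
    then have "AE x in lborel. \<forall>i\<in>Basis. indicator (box a b) x * (w x \<bullet> i) = 0"
      by (subst AE_finite_all[OF finite_Basis]) auto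
    then show ?thesis
    proof eventually_elim
      case (elim x)
      then show ?case by (auto intro!: euclidean_eqI[where 'a='f])
    qed
  qed
  define \<F> where "\<F> = {box a b | a b. cbox a b \<subseteq> \<Omega>}"
  have U: "\<Union>\<F> = \<Omega>"
  proof
    show "\<Union>\<F> \<subseteq> \<Omega>" unfolding \<F>_def using box_subset_cbox by blast
    show "\<Omega> \<subseteq> \<Union>\<F>"
    proof
      fix x assume "x \<in> \<Omega>"
      then obtain a b where "cbox a b \<subseteq> \<Omega>" "x \<in> box a b" using open_contains_cbox[OF o] by metis
      then show "x \<in> \<Union>\<F>" unfolding \<F>_def by blast
    qed
  qed
  obtain \<G> where \<G>: "\<G> \<subseteq> \<F>" "countable \<G>" "\<Union>\<G> = \<Union>\<F>"
    by (rule Lindelof[of \<F>]) (auto simp: \<F>_def)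
  have "AE x in lborel. \<forall>S\<in>\<G>. x \<in> S \<longrightarrow> w x = 0"
  proof (subst AE_ball_countable[OF \<G>(2)], rule ballI)
    fix S assume "S \<in> \<G>"
    then obtain a b where "S = box a b" "cbox a b \<subseteq> \<Omega>" using \<G>(1) by (auto simp: \<F>_def)
    then show "AE x in lborel. x \<in> S \<longrightarrow> w x = 0" using AEbox by simp
  qed
  then show ?thesis
    by eventually_elim (use \<G>(3) U in blast)
qed

lemma L2_on_add:
  assumes o: "open \<Omega>" and u: "L2_on \<Omega> u" and v: "L2_on \<Omega> v"
  shows "L2_on \<Omega> (\<lambda>x. u x + v x)"
  unfolding L2_on_def
proof
  have m: "set_borel_measurable lborel \<Omega> u" "set_borel_measurable lborel \<Omega> v" using u v by (auto simp: L2_on_def)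
  show ms: "set_borel_measurable lborel \<Omega> (\<lambda>x. u x + v x)"
    using m unfolding set_borel_measurable_def scaleR_add_right by (rule borel_measurable_add)
  have "set_integrable lborel \<Omega> (\<lambda>x. 2 * (norm (u x))\<^sup>2 + 2 * (norm (v x))\<^sup>2)"
    using u v by (intro set_integral_add(1) set_integrable_mult_right) (auto simp: L2_on_def)
  then show "set_integrable lborel \<Omega> (\<lambda>x. (norm (u x + v x))\<^sup>2)"
  proof (rule set_integrable_bound)
    have "(\<lambda>x. (norm (indicator \<Omega> x *\<^sub>R (u x + v x)))\<^sup>2) \<in> borel_measurable lborel"
      using ms unfolding set_borel_measurable_def by measurable
    then show "set_borel_measurable lborel \<Omega> (\<lambda>x. (norm (u x + v x))\<^sup>2)"
      unfolding set_borel_measurable_def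
      by (rule measurable_cong[THEN iffD1, rotated]) (auto simp: indicator_def)
    have "(norm (u x + v x))\<^sup>2 \<le> 2 * (norm (u x))\<^sup>2 + 2 * (norm (v x))\<^sup>2" for x
    proof -
      have "(norm (u x + v x))\<^sup>2 \<le> (norm (u x) + norm (v x))\<^sup>2" by (intro power_mono norm_triangle_ineq) simp
      also have "\<dots> \<le> 2 * (norm (u x))\<^sup>2 + 2 * (norm (v x))\<^sup>2"
        using zero_le_power2[of "norm (u x) - norm (v x)"] by (simp add: power2_eq_square algebra_simps)
      finally show ?thesis .
    qed
    then show "AE x in lborel. x \<in> \<Omega> \<longrightarrow> norm ((norm (u x + v x))\<^sup>2) \<le> norm (2 * (norm (u x))\<^sup>2 + 2 * (norm (v x))\<^sup>2)"
      by simp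
  qed
qed

lemma L2_on_minus: "L2_on \<Omega> u \<Longrightarrow> L2_on \<Omega> (\<lambda>x. - u x)"
  unfolding L2_on_def set_borel_measurable_def by auto

lemma has_weak_deriv_add:
  assumes o: "open \<Omega>" and L: "L2_on \<Omega> u" "L2_on \<Omega> v" "L2_on \<Omega> a" "L2_on \<Omega> b" and vs: "set vs \<subseteq> Basis"
    and d: "has_weak_deriv \<Omega> vs u a" "has_weak_deriv \<Omega> vs v b"
  shows "has_weak_deriv \<Omega> vs (\<lambda>x. u x + v x) (\<lambda>x. a x + b x)"
  unfolding has_weak_deriv_def
proof (intro allI impI)
  fix \<phi> assume \<phi>: "test_function \<Omega> \<phi>"
  note \<phi>' = test_function_iter_deriv[OF \<phi> vs]
  have "(LINT x:\<Omega>|lborel. iter_deriv vs \<phi> x *\<^sub>R (u x + v x)) =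
     (LINT x:\<Omega>|lborel. iter_deriv vs \<phi> x *\<^sub>R u x) + (LINT x:\<Omega>|lborel. iter_deriv vs \<phi> x *\<^sub>R v x)"
    unfolding scaleR_add_right by (intro set_integral_add(2) test_function_mult_integrable[OF o \<phi>'] L)
  moreover have "(LINT x:\<Omega>|lborel. \<phi> x *\<^sub>R (a x + b x)) =
     (LINT x:\<Omega>|lborel. \<phi> x *\<^sub>R a x) + (LINT x:\<Omega>|lborel. \<phi> x *\<^sub>R b x)"
    unfolding scaleR_add_right by (intro set_integral_add(2) test_function_mult_integrable[OF o \<phi>] L)
  ultimately show "(LINT x:\<Omega>|lborel. iter_deriv vs \<phi> x *\<^sub>R (u x + v x)) =
     (- 1) ^ length vs *\<^sub>R (LINT x:\<Omega>|lborel. \<phi> x *\<^sub>R (a x + b x))"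
    using d \<phi> by (simp add: has_weak_deriv_def scaleR_add_right)
qed

lemma weak_deriv_unique:
  assumes o: "open \<Omega>" and L: "L2_on \<Omega> a" "L2_on \<Omega> b"
    and d: "has_weak_deriv \<Omega> vs u a" "has_weak_deriv \<Omega> vs u b"
  shows "AE x in lborel. x \<in> \<Omega> \<longrightarrow> a x = b x"
proof -
  have Ld: "L2_on \<Omega> (\<lambda>x. a x + - b x)" by (intro L2_on_add L2_on_minus o L)
  have "AE x in lborel. x \<in> \<Omega> \<longrightarrow> a x + - b x = 0"
  proof (rule weak_zero_imp_AE_zero[OF o Ld])
    fix \<phi> assume \<phi>: "test_function \<Omega> \<phi>"
    have "(- 1) ^ length vs *\<^sub>R (LINT x:\<Omega>|lborel. \<phi> x *\<^sub>R a x) = (- 1) ^ length vs *\<^sub>R (LINT x:\<Omega>|lborel. \<phi> x *\<^sub>R b x)"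
      using d \<phi> unfolding has_weak_deriv_def by metis
    then have "(LINT x:\<Omega>|lborel. \<phi> x *\<^sub>R a x) = (LINT x:\<Omega>|lborel. \<phi> x *\<^sub>R b x)" by simp
    then show "(LINT x:\<Omega>|lborel. \<phi> x *\<^sub>R (a x + - b x)) = 0"
      using set_integral_diff(2)[OF test_function_mult_integrable[OF o \<phi> L(1)] test_function_mult_integrable[OF o \<phi> L(2)]]
      by (simp add: scaleR_diff_right)
  qed
  then show ?thesis by eventually_elim auto
qed

lemma weak_deriv:
  assumes "u \<in> sobolev k \<Omega>" "vs \<in> deriv_indices k"
  shows "L2_on \<Omega> (weak_deriv \<Omega> vs u)" "has_weak_deriv \<Omega> vs u (weak_deriv \<Omega> vs u)"
proof -
  have "\<exists>w. L2_on \<Omega> w \<and> has_weak_deriv \<Omega> vs u w" using assms by (auto simp: sobolev_def)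
  then have "L2_on \<Omega> (weak_deriv \<Omega> vs u) \<and> has_weak_deriv \<Omega> vs u (weak_deriv \<Omega> vs u)"
    unfolding weak_deriv_def by (rule someI_ex)
  then show "L2_on \<Omega> (weak_deriv \<Omega> vs u)" "has_weak_deriv \<Omega> vs u (weak_deriv \<Omega> vs u)" by auto
qed

lemma finite_deriv_indices: "finite (deriv_indices k :: 'e::euclidean_space list set)"
proof -
  have "deriv_indices k = {vs :: 'e list. set vs \<subseteq> Basis \<and> length vs \<le> k}" by (simp add: deriv_indices_def)
  then show ?thesis using finite_lists_length_le[OF finite_Basis, of k] by simp
qed

lemma L2_on_bounded:
  fixes f :: "'e::euclidean_space \<Rightarrow> 'f::euclidean_space"
  assumes o: "open \<Omega>" and fin: "emeasure lborel \<Omega> < \<infinity>" and c: "continuous_on \<Omega> f" and B: "\<And>x. x \<in> \<Omega> \<Longrightarrow> norm (f x) \<le> B"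
  shows "L2_on \<Omega> f" "(LINT x:\<Omega>|lborel. (norm (f x))\<^sup>2) \<le> B\<^sup>2 * measure lborel \<Omega>"
proof -
  have m: "set_borel_measurable lborel \<Omega> f"
    using borel_measurable_continuous_on_indicator[OF _ c] o by (simp add: set_borel_measurable_def)
  have i: "set_integrable lborel \<Omega> (\<lambda>_. B\<^sup>2)"
    unfolding set_integrable_def using o fin by (auto simp: less_top)
  have le: "(norm (f x))\<^sup>2 \<le> B\<^sup>2" if "x \<in> \<Omega>" for x using B[OF that] by (intro power_mono) auto
  have i2: "set_integrable lborel \<Omega> (\<lambda>x. (norm (f x))\<^sup>2)"
  proof (rule set_integrable_bound[OF i])
    show "set_borel_measurable lborel \<Omega> (\<lambda>x. (norm (f x))\<^sup>2)"
      using borel_measurable_continuous_on_indicator[of \<Omega> "\<lambda>x. (norm (f x))\<^sup>2"] o c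
      by (simp add: set_borel_measurable_def continuous_intros)
  qed (use le in auto)
  then show "L2_on \<Omega> f" using m by (simp add: L2_on_def)
  have "(LINT x:\<Omega>|lborel. (norm (f x))\<^sup>2) \<le> (LINT x:\<Omega>|lborel. B\<^sup>2)"
    by (rule set_integral_mono[OF i2 i le])
  also have "\<dots> = B\<^sup>2 * measure lborel \<Omega>"
    using o fin by (simp add: set_lebesgue_integral_def mult.commute less_top)
  finally show "(LINT x:\<Omega>|lborel. (norm (f x))\<^sup>2) \<le> B\<^sup>2 * measure lborel \<Omega>" .
qed

lemma sobolev_smooth_bounded:
  fixes u :: "'e::euclidean_space \<Rightarrow> 'f::euclidean_space"
  assumes u: "smooth_on_open \<Omega> u" and fin: "emeasure lborel \<Omega> < \<infinity>"
    and B: "\<And>vs. vs \<in> deriv_indices k \<Longrightarrow> \<exists>B. \<forall>x\<in>\<Omega>. norm (iter_deriv vs u x) \<le> B"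
  shows "u \<in> sobolev k \<Omega>"
proof -
  note o = smooth_imp_open[OF u]
  have L: "L2_on \<Omega> (iter_deriv vs u)" if vs: "vs \<in> deriv_indices k" for vs
  proof -
    obtain B where "\<forall>x\<in>\<Omega>. norm (iter_deriv vs u x) \<le> B" using B[OF vs] by blast
    moreover have "set vs \<subseteq> Basis" using vs by (simp add: deriv_indices_def)
    ultimately show ?thesis
      by (intro L2_on_bounded(1)[OF o fin smooth_continuous[OF smooth_iter_deriv[OF u]]]) auto
  qed
  have "L2_on \<Omega> u" using L[of "[]"] by (simp add: deriv_indices_def)
  moreover have "\<exists>w. L2_on \<Omega> w \<and> has_weak_deriv \<Omega> vs u w" if vs: "vs \<in> deriv_indices k" for vs
    using L[of "rev vs"] has_weak_deriv_smooth[OF u, of vs] vs by (auto simp: deriv_indices_def)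
  ultimately show ?thesis by (simp add: sobolev_def)
qed

text \<open>In place of the triangle inequality for the norm the pointwise bound
  \<open>|a + b|\<^sup>2 \<le> (1 + \<delta>) |a|\<^sup>2 + (1 + 1/\<delta>) |b|\<^sup>2\<close> is integrated. With \<open>\<delta>\<close> small and then \<open>\<eta>\<close> small, it
  shows that a strict bound on the norm of \<open>u\<close> survives a small smooth perturbation.\<close>

lemma sobolev_add_smooth:
  fixes u D :: "'e::euclidean_space \<Rightarrow> 'f::euclidean_space"
  assumes u: "u \<in> sobolev k \<Omega>" and D: "smooth_on_open \<Omega> D" and fin: "emeasure lborel \<Omega> < \<infinity>"
    and \<eta>: "\<And>vs x. vs \<in> deriv_indices k \<Longrightarrow> x \<in> \<Omega> \<Longrightarrow> norm (iter_deriv vs D x) \<le> \<eta>"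
    and \<delta>: "\<delta> > 0"
  shows "(\<lambda>x. u x + D x) \<in> sobolev k \<Omega>"
    and "(sobolev_norm k \<Omega> (\<lambda>x. u x + D x))\<^sup>2 \<le> (1 + \<delta>) * (sobolev_norm k \<Omega> u)\<^sup>2 +
       (1 + 1 / \<delta>) * (real (card (deriv_indices k :: 'e list set)) * (\<eta>\<^sup>2 * measure lborel \<Omega>))"
proof -
  note o = smooth_imp_open[OF D]
  have rv: "rev vs \<in> deriv_indices k" "set vs \<subseteq> Basis" if "vs \<in> deriv_indices k" for vs :: "'e list"
    using that by (auto simp: deriv_indices_def)
  have Lu: "L2_on \<Omega> u" using u by (simp add: sobolev_def)
  have LD: "L2_on \<Omega> (iter_deriv vs D)" and ID: "(LINT x:\<Omega>|lborel. (norm (iter_deriv vs D x))\<^sup>2) \<le> \<eta>\<^sup>2 * measure lborel \<Omega>"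
    if vs: "vs \<in> deriv_indices k" for vs
    using L2_on_bounded[OF o fin smooth_continuous[OF smooth_iter_deriv[OF D rv(2)[OF vs]]] \<eta>[OF vs]] by auto
  have LD0: "L2_on \<Omega> D" using LD[of "[]"] by (simp add: deriv_indices_def)
  have wd: "has_weak_deriv \<Omega> vs (\<lambda>x. u x + D x) (\<lambda>x. weak_deriv \<Omega> vs u x + iter_deriv (rev vs) D x)"
    and Lw: "L2_on \<Omega> (\<lambda>x. weak_deriv \<Omega> vs u x + iter_deriv (rev vs) D x)" if vs: "vs \<in> deriv_indices k" for vs
    using has_weak_deriv_add[OF o Lu LD0 weak_deriv(1)[OF u vs] LD[OF rv(1)[OF vs]] rv(2)[OF vs] weak_deriv(2)[OF u vs]
        has_weak_deriv_smooth[OF D rv(2)[OF vs]]]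
      L2_on_add[OF o weak_deriv(1)[OF u vs] LD[OF rv(1)[OF vs]]] by auto
  show s: "(\<lambda>x. u x + D x) \<in> sobolev k \<Omega>"
    using L2_on_add[OF o Lu LD0] wd Lw unfolding sobolev_def by blast
  have each: "(LINT x:\<Omega>|lborel. (norm (weak_deriv \<Omega> vs (\<lambda>x. u x + D x) x))\<^sup>2) \<le>
     (1 + \<delta>) * (LINT x:\<Omega>|lborel. (norm (weak_deriv \<Omega> vs u x))\<^sup>2) + (1 + 1 / \<delta>) * (\<eta>\<^sup>2 * measure lborel \<Omega>)"
    if vs: "vs \<in> deriv_indices k" for vs
  proof -
    have i: "set_integrable lborel \<Omega> (\<lambda>x. (norm (weak_deriv \<Omega> vs u x))\<^sup>2)"
      "set_integrable lborel \<Omega> (\<lambda>x. (norm (iter_deriv (rev vs) D x))\<^sup>2)"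
      "set_integrable lborel \<Omega> (\<lambda>x. (norm (weak_deriv \<Omega> vs (\<lambda>x. u x + D x) x))\<^sup>2)"
      using weak_deriv(1)[OF u vs] LD[OF rv(1)[OF vs]] weak_deriv(1)[OF s vs] by (auto simp: L2_on_def)
    have pw: "(norm (a + b))\<^sup>2 \<le> (1 + \<delta>) * (norm a)\<^sup>2 + (1 + 1 / \<delta>) * (norm b)\<^sup>2" for a b :: 'f
    proof -
      have "(norm (a + b))\<^sup>2 \<le> (norm a + norm b)\<^sup>2" by (intro power_mono norm_triangle_ineq) simp
      also have "\<dots> \<le> (1 + \<delta>) * (norm a)\<^sup>2 + (1 + 1 / \<delta>) * (norm b)\<^sup>2"
      proof -
        have "0 \<le> (\<delta> * norm a - norm b)\<^sup>2 / \<delta>" using \<delta> by simp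
        then show ?thesis using \<delta> by (simp add: power2_eq_square field_simps)
      qed
      finally show ?thesis .
    qed
    have i2: "set_integrable lborel \<Omega> (\<lambda>x. (1 + \<delta>) * (norm (weak_deriv \<Omega> vs u x))\<^sup>2 + (1 + 1 / \<delta>) * (norm (iter_deriv (rev vs) D x))\<^sup>2)"
      by (intro set_integral_add(1) set_integrable_mult_right i)
    have "(LINT x:\<Omega>|lborel. (norm (weak_deriv \<Omega> vs (\<lambda>x. u x + D x) x))\<^sup>2) \<le>
      (LINT x:\<Omega>|lborel. (1 + \<delta>) * (norm (weak_deriv \<Omega> vs u x))\<^sup>2 + (1 + 1 / \<delta>) * (norm (iter_deriv (rev vs) D x))\<^sup>2)"
    proof (rule set_integral_mono_AE[OF i(3) i2])
      have "AE x in lborel. x \<in> \<Omega> \<longrightarrow> weak_deriv \<Omega> vs (\<lambda>x. u x + D x) x = weak_deriv \<Omega> vs u x + iter_deriv (rev vs) D x"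
        by (rule weak_deriv_unique[OF o weak_deriv(1)[OF s vs] Lw[OF vs] weak_deriv(2)[OF s vs] wd[OF vs]])
      then show "AE x \<in> \<Omega> in lborel. (norm (weak_deriv \<Omega> vs (\<lambda>x. u x + D x) x))\<^sup>2 \<le>
         (1 + \<delta>) * (norm (weak_deriv \<Omega> vs u x))\<^sup>2 + (1 + 1 / \<delta>) * (norm (iter_deriv (rev vs) D x))\<^sup>2"
        by eventually_elim (use pw in auto)
    qed
    also have "\<dots> = (1 + \<delta>) * (LINT x:\<Omega>|lborel. (norm (weak_deriv \<Omega> vs u x))\<^sup>2) + (1 + 1 / \<delta>) * (LINT x:\<Omega>|lborel. (norm (iter_deriv (rev vs) D x))\<^sup>2)"
      by (subst set_integral_add(2)) (use i in \<open>auto intro!: set_integrable_mult_right\<close>)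
    also have "\<dots> \<le> (1 + \<delta>) * (LINT x:\<Omega>|lborel. (norm (weak_deriv \<Omega> vs u x))\<^sup>2) + (1 + 1 / \<delta>) * (\<eta>\<^sup>2 * measure lborel \<Omega>)"
      using ID[OF rv(1)[OF vs]] \<delta> by (intro add_left_mono mult_left_mono) auto
    finally show ?thesis .
  qed
  have nn: "0 \<le> (LINT x:\<Omega>|lborel. (norm (f x))\<^sup>2)" for f :: "'e \<Rightarrow> 'f"
    unfolding set_lebesgue_integral_def by (rule Bochner_Integration.integral_nonneg) simp
  have sq: "(sobolev_norm k \<Omega> f)\<^sup>2 = (\<Sum>vs\<in>deriv_indices k. LINT x:\<Omega>|lborel. (norm (weak_deriv \<Omega> vs f x))\<^sup>2)" for f :: "'e \<Rightarrow> 'f"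
    unfolding sobolev_norm_def by (intro real_sqrt_pow2 sum_nonneg nn)
  have "(sobolev_norm k \<Omega> (\<lambda>x. u x + D x))\<^sup>2 \<le> (\<Sum>vs\<in>(deriv_indices k :: 'e list set).
     (1 + \<delta>) * (LINT x:\<Omega>|lborel. (norm (weak_deriv \<Omega> vs u x))\<^sup>2) + (1 + 1 / \<delta>) * (\<eta>\<^sup>2 * measure lborel \<Omega>))"
    unfolding sq by (rule sum_mono[OF each])
  also have "\<dots> = (1 + \<delta>) * (sobolev_norm k \<Omega> u)\<^sup>2 +
       (1 + 1 / \<delta>) * (real (card (deriv_indices k :: 'e list set)) * (\<eta>\<^sup>2 * measure lborel \<Omega>))"
    unfolding sq by (simp add: sum.distrib sum_distrib_left)
  finally show "(sobolev_norm k \<Omega> (\<lambda>x. u x + D x))\<^sup>2 \<le> (1 + \<delta>) * (sobolev_norm k \<Omega> u)\<^sup>2 +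
       (1 + 1 / \<delta>) * (real (card (deriv_indices k :: 'e list set)) * (\<eta>\<^sup>2 * measure lborel \<Omega>))" .
qed

section \<open>Smooth families in the Sobolev topology\<close>

lemma chartsD:
  assumes "c \<in> charts M"
  shows chart_openin: "openin (top_of_set M) (fst c)" and chart_subset: "fst c \<subseteq> M"
    and chart_open_image: "open (snd c ` fst c)" and chart_inj: "inj_on (snd c) (fst c)"
    and chart_smooth: "smooth_on (fst c) (snd c)"
    and chart_inv_smooth: "smooth_on_open (snd c ` fst c) (inv_into (fst c) (snd c))"
proof -
  obtain U \<phi> where c: "c = (U, \<phi>)" by fastforce
  have *: "openin (top_of_set M) U" "open (\<phi> ` U)" "inj_on \<phi> U" "smooth_on U \<phi>" "smooth_on (\<phi> ` U) (inv_into U \<phi>)"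
    using assms by (simp_all add: charts_def c)
  then show "openin (top_of_set M) (fst c)" "fst c \<subseteq> M" "open (snd c ` fst c)" "inj_on (snd c) (fst c)"
    "smooth_on (fst c) (snd c)" "smooth_on_open (snd c ` fst c) (inv_into (fst c) (snd c))"
    using openin_imp_subset smooth_on_imp_smooth_on_open by (simp_all add: c)
qed

lemma chart_inv_into:
  assumes "c \<in> charts M"
  shows "x \<in> fst c \<Longrightarrow> inv_into (fst c) (snd c) (snd c x) = x"
    and "y \<in> snd c ` fst c \<Longrightarrow> inv_into (fst c) (snd c) y \<in> fst c"
    and "y \<in> snd c ` fst c \<Longrightarrow> snd c (inv_into (fst c) (snd c) y) = y"
  using chart_inj[OF assms] by (simp_all add: inv_into_into f_inv_into_f)

lemma inv_into_subset_eq: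
  assumes "inj_on f A" "B \<subseteq> A" "y \<in> f ` B" shows "inv_into B f y = inv_into A f y"
proof -
  obtain x where x: "x \<in> B" "y = f x" using assms(3) by auto
  moreover have "inj_on f B" using assms(1,2) inj_on_subset by blast
  ultimately show ?thesis using assms by (simp add: subset_iff)
qed

lemma chart_restrict:
  assumes c: "c \<in> charts M" and W: "openin (top_of_set M) W"
  shows "(fst c \<inter> W, snd c) \<in> charts M"
proof -
  let ?U = "fst c" and ?\<phi> = "snd c"
  obtain W' where W': "open W'" "W = M \<inter> W'" using W by (auto simp: openin_open)
  have "?\<phi> ` (?U \<inter> W) = ?\<phi> ` ?U \<inter> inv_into ?U ?\<phi> -` W'"
    using chart_inv_into[OF c] chart_subset[OF c] W'(2) by (auto simp: image_iff)
  then have o: "open (?\<phi> ` (?U \<inter> W))"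
    using continuous_open_preimage[OF smooth_continuous[OF chart_inv_smooth[OF c]] chart_open_image[OF c] W'(1)] by simp
  have "smooth_on (?\<phi> ` (?U \<inter> W)) (inv_into (?U \<inter> W) ?\<phi>)"
  proof (rule smooth_on_cong[OF smooth_imp_smooth_on[OF chart_inv_smooth[OF c]]])
    fix y assume "y \<in> ?\<phi> ` (?U \<inter> W)"
    then show "inv_into ?U ?\<phi> y = inv_into (?U \<inter> W) ?\<phi> y"
      using inv_into_subset_eq[OF chart_inj[OF c], of "?U \<inter> W"] by auto
  qed auto
  moreover have "openin (top_of_set M) (?U \<inter> W)" using openin_Int chart_openin[OF c] W by blast
  moreover have "smooth_on (?U \<inter> W) ?\<phi>" by (rule smooth_on_subset[OF chart_smooth[OF c]]) auto
  moreover have "inj_on ?\<phi> (?U \<inter> W)" using chart_inj[OF c] inj_on_subset by blast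
  ultimately show ?thesis using o by (simp add: charts_def)
qed

text \<open>A chart is defined only on a relatively open part of \<open>M\<close>; composed with a smooth map into \<open>M\<close> from
  an open set it becomes a smooth function on an open set.\<close>

lemma chart_comp_smooth:
  fixes h :: "'p::euclidean_space \<Rightarrow> 'a::euclidean_space" and d :: "'a set \<times> ('a \<Rightarrow> 'e::euclidean_space)"
  assumes h: "smooth_on W h" and W: "open W" and hM: "h ` W \<subseteq> M" and d: "d \<in> charts M"
  shows "smooth_on_open {p \<in> W. h p \<in> fst d} (\<lambda>p. snd d (h p))"
proof -
  obtain V where V: "open V" "fst d = M \<inter> V" using chart_openin[OF d] by (auto simp: openin_open)
  have "{p \<in> W. h p \<in> fst d} = W \<inter> h -` V" using V(2) hM by auto
  then have o: "open {p \<in> W. h p \<in> fst d}"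
    using continuous_open_preimage[OF smooth_on_imp_continuous_on[OF h] W V(1)] by simp
  have "smooth_on {p \<in> W. h p \<in> fst d} (\<lambda>p. snd d (h p))"
    by (rule smooth_on_compose[OF smooth_on_subset[OF h] chart_smooth[OF d]]) auto
  then show ?thesis using o by (rule smooth_on_imp_smooth_on_open)
qed

definition covered_by_charts :: "'e::euclidean_space itself \<Rightarrow> 'a::euclidean_space set \<Rightarrow> bool" where
  "covered_by_charts E M \<longleftrightarrow> (\<forall>x\<in>M. \<exists>c :: 'a set \<times> ('a \<Rightarrow> 'e). c \<in> charts M \<and> x \<in> fst c)"

text \<open>Around each point the chart of the domain is shrunk to the preimage of a ball whose closure stays
  where the local representative is smooth. There all derivatives are bounded.\<close>

lemma smooth_imp_sobolev_maps:
  fixes M :: "'a::euclidean_space set"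
  assumes M: "covered_by_charts TYPE('e::euclidean_space) M" and F: "smooth_on M F" and FM: "F ` M \<subseteq> M"
  shows "restrict F M \<in> sobolev_maps TYPE('e) k M"
proof -
  have "\<exists>c\<in>charts M. \<exists>d\<in>charts M. x \<in> fst c \<and> restrict F M ` fst c \<subseteq> fst d \<and>
        (local_rep c d (restrict F M) :: 'e \<Rightarrow> 'e) \<in> sobolev k (snd c ` fst c)" if x: "x \<in> M" for x
  proof -
    obtain c0 :: "'a set \<times> ('a \<Rightarrow> 'e)" where c0: "c0 \<in> charts M" "x \<in> fst c0" using M x by (auto simp: covered_by_charts_def)
    obtain d :: "'a set \<times> ('a \<Rightarrow> 'e)" where d: "d \<in> charts M" "F x \<in> fst d" using M x FM unfolding covered_by_charts_def by blast
    let ?U = "fst c0" and ?\<phi> = "snd c0"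
    let ?\<iota> = "inv_into ?U ?\<phi>"
    define Q where "Q = {y \<in> ?\<phi> ` ?U. F (?\<iota> y) \<in> fst d}"
    have sF: "smooth_on (?\<phi> ` ?U) (\<lambda>y. F (?\<iota> y))"
      by (rule smooth_on_compose[OF smooth_imp_smooth_on[OF chart_inv_smooth[OF c0(1)]] F])
        (use chart_inv_into[OF c0(1)] chart_subset[OF c0(1)] in auto)
    have sR: "smooth_on_open Q (\<lambda>y. snd d (F (?\<iota> y)))"
      unfolding Q_def
      by (rule chart_comp_smooth[OF sF chart_open_image[OF c0(1)] _ d(1)])
        (use chart_inv_into[OF c0(1)] chart_subset[OF c0(1)] FM in blast)
    have "?\<phi> x \<in> Q" using c0 d chart_inv_into[OF c0(1)] by (auto simp: Q_def)
    then obtain r where r: "r > 0" "cball (?\<phi> x) r \<subseteq> Q"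
      using smooth_imp_open[OF sR] by (meson open_contains_cball)
    define B where "B = ball (?\<phi> x) r"
    have BQ: "B \<subseteq> Q" using r(2) ball_subset_cball unfolding B_def by blast
    define W where "W = {m \<in> ?U. ?\<phi> m \<in> B}"
    have "openin (top_of_set ?U) (?U \<inter> ?\<phi> -` B)"
      by (rule continuous_openin_preimage_gen[OF smooth_on_imp_continuous_on[OF chart_smooth[OF c0(1)]]]) (simp add: B_def)
    then have oW: "openin (top_of_set M) W"
      using openin_trans chart_openin[OF c0(1)] by (simp add: W_def Int_def vimage_def)
    have UW: "?U \<inter> W = W" by (auto simp: W_def)
    define c where "c = (W, ?\<phi>)"
    have c: "c \<in> charts M" using chart_restrict[OF c0(1) oW] UW by (simp add: c_def)
    have im: "?\<phi> ` W = B"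
    proof
      show "B \<subseteq> ?\<phi> ` W"
      proof
        fix y assume y: "y \<in> B"
        then have "y \<in> ?\<phi> ` ?U" using BQ by (auto simp: Q_def)
        then show "y \<in> ?\<phi> ` W" using y by (auto simp: W_def)
      qed
    qed (auto simp: W_def)
    have inv: "inv_into W ?\<phi> y = ?\<iota> y" if "y \<in> B" for y
      by (rule inv_into_subset_eq[OF chart_inj[OF c0(1)]]) (use that im in \<open>auto simp: W_def\<close>)
    have \<iota>M: "?\<iota> y \<in> M" if "y \<in> B" for y
      using that BQ chart_inv_into(2)[OF c0(1)] chart_subset[OF c0(1)] by (auto simp: Q_def)
    have rep: "local_rep c d (restrict F M) y = snd d (F (?\<iota> y))" if "y \<in> B" for y
      using inv[OF that] \<iota>M[OF that] by (simp add: local_rep_def c_def)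
    have sB: "smooth_on_open B (\<lambda>y. snd d (F (?\<iota> y)))"
      by (rule smooth_subset[OF sR _ BQ]) (simp add: B_def)
    have "(local_rep c d (restrict F M) :: 'e \<Rightarrow> 'e) \<in> sobolev k B"
    proof (rule sobolev_smooth_bounded)
      show "smooth_on_open B (local_rep c d (restrict F M))"
        by (rule smooth_cong[OF sB]) (simp add: rep)
      show "emeasure lborel B < \<infinity>" unfolding B_def by (rule emeasure_bounded_finite) simp
      fix vs :: "'e list" assume "vs \<in> deriv_indices k"
      then have "continuous_on Q (iter_deriv vs (\<lambda>y. snd d (F (?\<iota> y))))"
        by (intro smooth_continuous[OF smooth_iter_deriv[OF sR]]) (simp add: deriv_indices_def)
      then have "bounded (iter_deriv vs (\<lambda>y. snd d (F (?\<iota> y))) ` cball (?\<phi> x) r)"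
        by (intro compact_imp_bounded compact_continuous_image compact_cball) (rule continuous_on_subset[OF _ r(2)])
      then obtain K where K: "\<forall>y\<in>cball (?\<phi> x) r. norm (iter_deriv vs (\<lambda>y. snd d (F (?\<iota> y))) y) \<le> K"
        by (auto simp: bounded_iff)
      have "norm (iter_deriv vs (local_rep c d (restrict F M)) y) \<le> K" if y: "y \<in> B" for y
      proof -
        have "iter_deriv vs (local_rep c d (restrict F M)) y = iter_deriv vs (\<lambda>y. snd d (F (?\<iota> y))) y"
          by (rule iter_deriv_cong_open[of B]) (use y rep in \<open>auto simp: B_def\<close>)
        moreover have "y \<in> cball (?\<phi> x) r" using y by (simp add: B_def)
        ultimately show ?thesis using K by simp
      qed
      then show "\<exists>B'. \<forall>x\<in>B. norm (iter_deriv vs (local_rep c d (restrict F M)) x) \<le> B'" by blast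
    qed
    moreover have "x \<in> fst c" using c0 r(1) by (simp add: c_def W_def B_def)
    moreover have "restrict F M ` fst c \<subseteq> fst d"
    proof
      fix z assume "z \<in> restrict F M ` fst c"
      then obtain m where m: "m \<in> W" "z = F m" using chart_subset[OF c] by (auto simp: c_def)
      then have "?\<phi> m \<in> Q" "m \<in> ?U" using BQ by (auto simp: W_def)
      then show "z \<in> fst d" using m chart_inv_into(1)[OF c0(1)] by (simp add: Q_def)
    qed
    ultimately show ?thesis using c d(1) im by (intro bexI[of _ c] bexI[of _ d]) (auto simp: c_def)
  qed
  moreover have "continuous_on M (restrict F M)"
    using smooth_on_imp_continuous_on[OF F] by (rule continuous_on_eq) simp
  ultimately show ?thesis using FM by (auto simp: sobolev_maps_def)
qed

lemma smooth_imp_Diff: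
  fixes M :: "'a::euclidean_space set"
  assumes M: "covered_by_charts TYPE('e::euclidean_space) M"
    and F: "smooth_on M F" "F ` M \<subseteq> M" and G: "smooth_on M G" "G ` M \<subseteq> M"
    and GF: "\<And>x. x \<in> M \<Longrightarrow> G (F x) = x" and FG: "\<And>x. x \<in> M \<Longrightarrow> F (G x) = x"
  shows "restrict F M \<in> Diff TYPE('e) k M"
proof -
  have bij: "bij_betw (restrict F M) M M"
    by (rule bij_betw_byWitness[where f'=G]) (use F G GF FG in auto)
  have "inv_into M (restrict F M) x = G x" if x: "x \<in> M" for x
  proof -
    have "G x \<in> M" "restrict F M (G x) = x" using x G FG by auto
    then show ?thesis using bij by (metis bij_betw_def inv_into_f_f)
  qed
  then have "restrict (inv_into M (restrict F M)) M = restrict G M" by (auto simp: restrict_def fun_eq_iff)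
  then show ?thesis
    using bij smooth_imp_sobolev_maps[OF M F] smooth_imp_sobolev_maps[OF M G] by (simp add: Diff_def)
qed

text \<open>The set of all \<open>(s, y)\<close> with \<open>f (s, y)\<close> close to \<open>f (s0, y)\<close> is open and contains the
  compact slice \<open>{s0} \<times> K\<close>; apply the tube lemma.\<close>

lemma eventually_uniformly_close:
  fixes f :: "real \<times> 'e::euclidean_space \<Rightarrow> 'f::real_normed_vector"
  assumes Q: "open Q" and f: "continuous_on Q f" and K: "compact K" "{s0} \<times> K \<subseteq> Q" and \<eta>: "\<eta> > 0"
  shows "eventually (\<lambda>s. \<forall>y\<in>K. (s, y) \<in> Q \<and> norm (f (s, y) - f (s0, y)) < \<eta>) (nhds s0)"
proof -
  define Q0 where "Q0 = Q \<inter> (\<lambda>(s, y). (s0, y)) -` Q"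
  have cs: "continuous_on A (\<lambda>(s::real, y::'e). (s0, y))" for A
    unfolding case_prod_beta by (intro continuous_intros)
  have oQ0: "open Q0" unfolding Q0_def
    by (intro open_Int Q open_vimage cs)
  define g where "g = (\<lambda>(s, y). norm (f (s, y) - f (s0, y)))"
  have cg: "continuous_on Q0 g"
    unfolding g_def case_prod_beta
    by (intro continuous_intros continuous_on_compose2[OF f]) (auto simp: Q0_def)
  have oO: "open (Q0 \<inter> g -` {..<\<eta>})" by (rule continuous_open_preimage[OF cg oQ0]) simp
  have sub: "{s0} \<times> K \<subseteq> Q0 \<inter> g -` {..<\<eta>}" using K(2) \<eta> by (auto simp: Q0_def g_def)
  obtain X0 where X0: "s0 \<in> X0" "open X0" "X0 \<times> K \<subseteq> Q0 \<inter> g -` {..<\<eta>}"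
    using Elementary_Topology.tube_lemma[OF K(1) oO sub] by blast
  then have "\<forall>s\<in>X0. \<forall>y\<in>K. (s, y) \<in> Q \<and> norm (f (s, y) - f (s0, y)) < \<eta>"
    by (auto simp: Q0_def g_def)
  then show ?thesis using X0 unfolding eventually_nhds by blast
qed

lemma exists_small_perturbation:
  fixes \<epsilon> N C :: real
  assumes "0 \<le> N" "N < \<epsilon>" "0 \<le> C"
  obtains \<delta> \<eta> where "\<delta> > 0" "\<eta> > 0" "(1 + \<delta>) * N\<^sup>2 + (1 + 1 / \<delta>) * (C * \<eta>\<^sup>2) < \<epsilon>\<^sup>2"
proof -
  define e where "e = \<epsilon>\<^sup>2 - N\<^sup>2"
  have e: "e > 0" using assms by (simp add: e_def power_strict_mono)
  \<comment> \<open>The term with \<open>\<delta>\<close> uses up at most half of the gap \<open>e\<close>, the term with \<open>\<eta>\<close> at most a quarter.\<close>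
  define \<delta> where "\<delta> = e / (2 * (N\<^sup>2 + 1))"
  have N1: "N\<^sup>2 + 1 > 0" by (simp add: add_nonneg_pos)
  have \<delta>: "\<delta> > 0" using e N1 by (simp add: \<delta>_def)
  have "\<delta> * N\<^sup>2 \<le> \<delta> * (N\<^sup>2 + 1)" using \<delta> by simp
  also have "\<dots> = e / 2" using N1 unfolding \<delta>_def by (simp add: divide_simps)
  finally have d1: "\<delta> * N\<^sup>2 \<le> e / 2" .
  define \<eta> where "\<eta> = sqrt (e / (4 * (1 + 1 / \<delta>) * (C + 1)))"
  have p: "4 * (1 + 1 / \<delta>) * (C + 1) > 0" using \<delta> assms by (simp add: add_pos_pos add_nonneg_pos)
  have \<eta>: "\<eta> > 0" using e p by (simp add: \<eta>_def)
  have \<eta>2: "\<eta>\<^sup>2 = e / (4 * (1 + 1 / \<delta>) * (C + 1))" using e p by (simp add: \<eta>_def)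
  have "(1 + 1 / \<delta>) * (C * \<eta>\<^sup>2) \<le> (1 + 1 / \<delta>) * ((C + 1) * \<eta>\<^sup>2)"
    using \<delta> by (intro mult_left_mono mult_right_mono) auto
  also have "\<dots> = e / 4"
  proof -
    have "1 + 1 / \<delta> > 0" "C + 1 > 0" using \<delta> assms by (simp_all add: add_pos_pos add_nonneg_pos)
    then show ?thesis unfolding \<eta>2 by (simp add: divide_simps)
  qed
  finally have "(1 + \<delta>) * N\<^sup>2 + (1 + 1 / \<delta>) * (C * \<eta>\<^sup>2) \<le> N\<^sup>2 + e / 2 + e / 4"
    using d1 by (simp add: distrib_right)
  also have "\<dots> < N\<^sup>2 + e" using e by simp
  also have "N\<^sup>2 + e = \<epsilon>\<^sup>2" by (simp add: e_def)
  finally show ?thesis using that \<delta> \<eta> by blast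
qed

lemma sobolev_norm_nonneg: "0 \<le> sobolev_norm k \<Omega> u"
  unfolding sobolev_norm_def set_lebesgue_integral_def
  by (intro real_sqrt_ge_zero sum_nonneg Bochner_Integration.integral_nonneg) simp

lemma emeasure_interior_compact_image:
  assumes "compact K" shows "emeasure lborel (interior K) < \<infinity>"
  by (rule emeasure_bounded_finite) (use assms compact_imp_bounded bounded_interior in blast)

lemma topspace_sobolev_maps_topology_subset:
  "topspace (sobolev_maps_topology TYPE('e::euclidean_space) k M) \<subseteq> sobolev_maps TYPE('e) k M"
  by (auto simp: sobolev_maps_topology_def sobolev_nbhd_def topology_generated_by_topspace)

lemma local_rep_diff_self_sobolev:
  fixes c d :: "'a::euclidean_space set \<times> ('a \<Rightarrow> 'e::euclidean_space)"
  assumes c: "c \<in> charts M" and K: "compact K" "K \<subseteq> fst c"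
  shows "(\<lambda>y. local_rep c d f y - local_rep c d f y) \<in> sobolev k (interior (snd c ` K))"
proof (rule sobolev_smooth_bounded)
  have "compact (snd c ` K)"
    by (rule compact_continuous_image[OF continuous_on_subset[OF smooth_on_imp_continuous_on[OF chart_smooth[OF c]] K(2)] K(1)])
  then show "emeasure lborel (interior (snd c ` K)) < \<infinity>" by (rule emeasure_interior_compact_image)
  have z: "iter_deriv vs (\<lambda>_::'e. 0::'e) = (\<lambda>_. 0)" for vs
    by (induction vs) simp_all
  show "smooth_on_open (interior (snd c ` K)) (\<lambda>y. local_rep c d f y - local_rep c d f y)"
    by (simp add: smooth_const)
  show "\<exists>B. \<forall>x\<in>interior (snd c ` K). norm (iter_deriv vs (\<lambda>y. local_rep c d f y - local_rep c d f y) x) \<le> B" for vs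
    by (intro exI[of _ 0]) (simp add: z)
qed

text \<open>The radius is taken larger than the norm of the zero function.\<close>

lemma mem_sobolev_nbhd_self:
  fixes c d :: "'a::euclidean_space set \<times> ('a \<Rightarrow> 'e::euclidean_space)"
  assumes f: "f \<in> sobolev_maps TYPE('e) k M" and c: "c \<in> charts M" and K: "compact K" "K \<subseteq> fst c" and fK: "f ` K \<subseteq> fst d"
  obtains \<epsilon> where "\<epsilon> > 0" "f \<in> sobolev_nbhd k M c d K \<epsilon> f"
proof
  let ?N = "sobolev_norm k (interior (snd c ` K)) (\<lambda>y. local_rep c d f y - local_rep c d f y)"
  show "?N + 1 > 0" using sobolev_norm_nonneg[of k "interior (snd c ` K)" "\<lambda>y. local_rep c d f y - local_rep c d f y"] by linarith
  show "f \<in> sobolev_nbhd k M c d K (?N + 1) f"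
    using f fK local_rep_diff_self_sobolev[OF c K] by (simp add: sobolev_nbhd_def)
qed

lemma openin_sobolev_nbhd:
  fixes c d :: "'a::euclidean_space set \<times> ('a \<Rightarrow> 'e::euclidean_space)"
  assumes "f \<in> sobolev_maps TYPE('e) k M" "c \<in> charts M" "d \<in> charts M" "compact K" "K \<subseteq> fst c"
    "f ` K \<subseteq> fst d" "\<epsilon> > 0"
  shows "openin (sobolev_maps_topology TYPE('e) k M) (sobolev_nbhd k M c d K \<epsilon> f)"
  unfolding sobolev_maps_topology_def
  by (rule topology_generated_by_Basis, unfold mem_Collect_eq,
      rule exI[of _ c], rule exI[of _ d], rule exI[of _ K], rule exI[of _ \<epsilon>], rule exI[of _ f])
    (intro conjI refl assms)

text \<open>The empty chart gives each map a subbasic neighbourhood.\<close>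

lemma sobolev_maps_subset_topspace:
  fixes M :: "'a::euclidean_space set"
  shows "sobolev_maps TYPE('e::euclidean_space) k M \<subseteq> topspace (sobolev_maps_topology TYPE('e) k M)"
proof
  fix f assume f: "f \<in> sobolev_maps TYPE('e) k M"
  define c :: "'a set \<times> ('a \<Rightarrow> 'e)" where "c = ({}, \<lambda>_. 0)"
  have c: "c \<in> charts M" by (auto simp: c_def charts_def smooth_on_def)
  obtain \<epsilon> where \<epsilon>: "\<epsilon> > 0" "f \<in> sobolev_nbhd k M c c {} \<epsilon> f"
    using mem_sobolev_nbhd_self[OF f c, of "{}" c] by auto
  have "openin (sobolev_maps_topology TYPE('e) k M) (sobolev_nbhd k M c c {} \<epsilon> f)"
    by (rule openin_sobolev_nbhd[OF f c c _ _ _ \<epsilon>(1)]) auto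
  then show "f \<in> topspace (sobolev_maps_topology TYPE('e) k M)"
    using openin_subset \<epsilon>(2) by blast
qed

text \<open>If a member \<open>P s0\<close> of the family lies in a subbasic neighbourhood, then for \<open>s\<close> near \<open>s0\<close> the local
  representatives of \<open>P s\<close> and \<open>P s0\<close> differ by a smooth function whose derivatives up to order \<open>k\<close>
  are uniformly small on the compact set of the neighbourhood. By \<open>sobolev_add_smooth\<close> the strict
  bound on the norm is preserved.\<close>

lemma continuous_map_smooth_family:
  fixes G :: "real \<times> 'a::euclidean_space \<Rightarrow> 'a" and M :: "'a set"
  assumes M: "covered_by_charts TYPE('e::euclidean_space) M" and G: "smooth_on (UNIV \<times> M) G" and GM: "G ` (UNIV \<times> M) \<subseteq> M"
  shows "continuous_map euclideanreal (sobolev_maps_topology TYPE('e) k M) (\<lambda>s. restrict (\<lambda>m. G (s, m)) M)"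
proof -
  define P where "P = (\<lambda>s. restrict (\<lambda>m. G (s, m)) M)"
  have P: "P s \<in> sobolev_maps TYPE('e) k M" for s
    unfolding P_def
  proof (rule smooth_imp_sobolev_maps[OF M])
    have "smooth_on M (\<lambda>m. (s, m))"
      by (rule smooth_imp_smooth_on[of UNIV]) (auto intro!: smooth_Pair smooth_const smooth_id)
    then show "smooth_on M (\<lambda>m. G (s, m))" by (rule smooth_on_compose[OF _ G]) auto
  qed (use GM in auto)
  let ?S = "{sobolev_nbhd k M c d K \<epsilon> f | (c :: 'a set \<times> ('a \<Rightarrow> 'e)) d K \<epsilon> f.
        f \<in> sobolev_maps TYPE('e) k M \<and> c \<in> charts M \<and> d \<in> charts M \<and>
        compact K \<and> K \<subseteq> fst c \<and> f ` K \<subseteq> fst d \<and> \<epsilon> > 0}"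
  have "continuous_map euclideanreal (sobolev_maps_topology TYPE('e) k M) P"
    unfolding sobolev_maps_topology_def
  proof (rule continuous_on_generated_topo)
    show "P ` topspace euclideanreal \<subseteq> \<Union> ?S"
      using P sobolev_maps_subset_topspace[where 'e='e, of k M]
      unfolding sobolev_maps_topology_def topology_generated_by_topspace by blast
  next
    fix N assume "N \<in> ?S"
    then obtain c d :: "'a set \<times> ('a \<Rightarrow> 'e)" and K \<epsilon> f where N: "N = sobolev_nbhd k M c d K \<epsilon> f"
      and f: "f \<in> sobolev_maps TYPE('e) k M" and c: "c \<in> charts M" and d: "d \<in> charts M"
      and K: "compact K" "K \<subseteq> fst c" and \<epsilon>: "\<epsilon> > 0" by blast
    let ?U = "fst c" and ?\<phi> = "snd c"
    let ?\<iota> = "inv_into ?U ?\<phi>"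
    define \<Omega> where "\<Omega> = interior (?\<phi> ` K)"
    have cK: "compact (?\<phi> ` K)"
      by (rule compact_continuous_image[OF continuous_on_subset[OF smooth_on_imp_continuous_on[OF chart_smooth[OF c]] K(2)] K(1)])
    have fin: "emeasure lborel \<Omega> < \<infinity>" unfolding \<Omega>_def by (rule emeasure_interior_compact_image[OF cK])
    have \<Omega>K: "\<Omega> \<subseteq> ?\<phi> ` K" unfolding \<Omega>_def by (rule interior_subset)
    have KU: "?\<phi> ` K \<subseteq> ?\<phi> ` ?U" using K(2) by auto
    define H where "H = (\<lambda>(s, y). snd d (G (s, ?\<iota> y)))"
    define Q where "Q = {p \<in> UNIV \<times> ?\<phi> ` ?U. G (fst p, ?\<iota> (snd p)) \<in> fst d}"
    have \<iota>M: "?\<iota> y \<in> M" if "y \<in> ?\<phi> ` ?U" for y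
      using chart_inv_into(2)[OF c that] chart_subset[OF c] by auto
    have oW: "open (UNIV \<times> ?\<phi> ` ?U :: (real \<times> 'e) set)" using chart_open_image[OF c] by (intro open_Times) auto
    have s1: "smooth_on (UNIV \<times> ?\<phi> ` ?U) (\<lambda>p::real \<times> 'e. (fst p, ?\<iota> (snd p)))"
      by (rule smooth_imp_smooth_on[OF smooth_Pair])
        (auto intro!: smooth_compose[OF _ chart_inv_smooth[OF c]] smooth_fst smooth_snd smooth_id oW)
    have s2: "smooth_on (UNIV \<times> ?\<phi> ` ?U) (\<lambda>p::real \<times> 'e. G (fst p, ?\<iota> (snd p)))"
      by (rule smooth_on_compose[OF s1 G]) (use \<iota>M in auto)
    have sH: "smooth_on_open Q H"
      unfolding Q_def H_def case_prod_beta
      by (rule chart_comp_smooth[OF s2 oW _ d]) (use \<iota>M GM in \<open>auto simp: image_subset_iff\<close>)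
    note oQ = smooth_imp_open[OF sH]
    have rep: "local_rep c d (P s) y = H (s, y)" if "y \<in> ?\<phi> ` ?U" for s y
      using \<iota>M[OF that] by (simp add: local_rep_def P_def H_def)
    have PK: "P s ` K \<subseteq> fst d \<longleftrightarrow> {s} \<times> ?\<phi> ` K \<subseteq> Q" for s
    proof -
      have "P s m \<in> fst d \<longleftrightarrow> (s, ?\<phi> m) \<in> Q" if "m \<in> K" for m
      proof -
        have "m \<in> ?U" "m \<in> M" using that K(2) chart_subset[OF c] by auto
        then show ?thesis using chart_inv_into(1)[OF c, of m] by (simp add: P_def Q_def)
      qed
      then show ?thesis by auto
    qed
    have "open {s. P s \<in> N}"
    proof (subst open_subopen, intro ballI)
      fix s0 assume "s0 \<in> {s. P s \<in> N}"
      then have s0: "P s0 \<in> N" by simp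
      define u where "u = (\<lambda>y. local_rep c d (P s0) y - local_rep c d f y)"
      have u: "u \<in> sobolev k \<Omega>" "sobolev_norm k \<Omega> u < \<epsilon>" and s0Q: "{s0} \<times> ?\<phi> ` K \<subseteq> Q"
        using s0 PK unfolding N sobolev_nbhd_def u_def \<Omega>_def by auto
      define C where "C = real (card (deriv_indices k :: 'e list set)) * measure lborel \<Omega>"
      have "C \<ge> 0" by (simp add: C_def)
      then obtain \<delta> \<eta> where \<delta>: "\<delta> > 0" and \<eta>: "\<eta> > 0"
        and small: "(1 + \<delta>) * (sobolev_norm k \<Omega> u)\<^sup>2 + (1 + 1 / \<delta>) * (C * \<eta>\<^sup>2) < \<epsilon>\<^sup>2"
        using exists_small_perturbation[OF sobolev_norm_nonneg u(2)] by metis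
      have ind: "map (Pair 0) vs \<in> {ws. set ws \<subseteq> (Basis :: (real \<times> 'e) set)}" if "vs \<in> deriv_indices k" for vs :: "'e list"
        using that by (auto simp: deriv_indices_def Basis_prod_def)
      have "eventually (\<lambda>s. \<forall>vs\<in>(deriv_indices k :: 'e list set). \<forall>y\<in>?\<phi> ` K. (s, y) \<in> Q \<and>
          norm (iter_deriv (map (Pair 0) vs) H (s, y) - iter_deriv (map (Pair 0) vs) H (s0, y)) < \<eta>) (nhds s0)"
      proof (rule eventually_ball_finite[OF finite_deriv_indices], rule ballI)
        fix vs :: "'e list" assume vs: "vs \<in> deriv_indices k"
        show "eventually (\<lambda>s. \<forall>y\<in>?\<phi> ` K. (s, y) \<in> Q \<and>
          norm (iter_deriv (map (Pair 0) vs) H (s, y) - iter_deriv (map (Pair 0) vs) H (s0, y)) < \<eta>) (nhds s0)"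
          by (rule eventually_uniformly_close[OF oQ smooth_continuous[OF smooth_iter_deriv[OF sH]] cK s0Q \<eta>])
            (use ind[OF vs] in simp)
      qed
      then obtain T where T: "open T" "s0 \<in> T" and close: "\<And>s vs y. s \<in> T \<Longrightarrow> vs \<in> (deriv_indices k :: 'e list set) \<Longrightarrow> y \<in> ?\<phi> ` K \<Longrightarrow>
          (s, y) \<in> Q \<and> norm (iter_deriv (map (Pair 0) vs) H (s, y) - iter_deriv (map (Pair 0) vs) H (s0, y)) < \<eta>"
        unfolding eventually_nhds by blast
      have "P s \<in> N" if s: "s \<in> T" for s
      proof -
        have "[] \<in> (deriv_indices k :: 'e list set)" by (simp add: deriv_indices_def)
        then have sQ: "{s} \<times> ?\<phi> ` K \<subseteq> Q" using close[OF s] by blast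
        have sl: "smooth_on_open \<Omega> (\<lambda>y. H (t, y))" if "{t} \<times> ?\<phi> ` K \<subseteq> Q" for t
          by (rule smooth_compose[OF _ sH, where g="\<lambda>y. (t, y)"])
            (use that \<Omega>K in \<open>auto intro!: smooth_Pair smooth_const smooth_id simp: \<Omega>_def\<close>)
        \<comment> \<open>Defined by the representatives and not by \<open>H\<close>, so that \<open>u + D\<close> is the function in the
           definition of \<open>N\<close> also outside the image of the chart.\<close>
        define D where "D = (\<lambda>y. local_rep c d (P s) y - local_rep c d (P s0) y)"
        have DH: "D y = H (s, y) - H (s0, y)" if "y \<in> \<Omega>" for y
        proof -
          have "y \<in> ?\<phi> ` ?U" using that \<Omega>K KU by blast
          then show ?thesis by (simp add: D_def rep)
        qed
        have sD': "smooth_on_open \<Omega> (\<lambda>y. H (s, y) - H (s0, y))"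
          by (intro smooth_diff sl sQ s0Q)
        have sD: "smooth_on_open \<Omega> D"
          by (rule smooth_cong[OF sD']) (simp add: DH)
        have bD: "norm (iter_deriv vs D y) \<le> \<eta>" if vs: "vs \<in> deriv_indices k" and y: "y \<in> \<Omega>" for vs y
        proof -
          have B: "set vs \<subseteq> Basis" using vs by (simp add: deriv_indices_def)
          have "iter_deriv vs D y = iter_deriv vs (\<lambda>y. H (s, y) - H (s0, y)) y"
            by (rule iter_deriv_cong_open[OF smooth_imp_open[OF sD]]) (use DH y in auto)
          also have "\<dots> = iter_deriv vs (\<lambda>y. H (s, y)) y - iter_deriv vs (\<lambda>y. H (s0, y)) y"
            by (rule iter_deriv_diff[OF sl[OF sQ] sl[OF s0Q] B y])
          also have "\<dots> = iter_deriv (map (Pair 0) vs) H (s, y) - iter_deriv (map (Pair 0) vs) H (s0, y)"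
          proof -
            have "(s, y) \<in> Q" "(s0, y) \<in> Q" using sQ s0Q y \<Omega>K by blast+
            then show ?thesis by (simp only: iter_deriv_slice[OF sH B])
          qed
          finally show ?thesis using close[OF s vs, of y] y \<Omega>K by auto
        qed
        have eq: "(\<lambda>y. u y + D y) = (\<lambda>y. local_rep c d (P s) y - local_rep c d f y)"
          by (simp add: u_def D_def)
        have mem: "(\<lambda>y. local_rep c d (P s) y - local_rep c d f y) \<in> sobolev k \<Omega>"
          using sobolev_add_smooth(1)[OF u(1) sD fin bD \<delta>] unfolding eq .
        have "(sobolev_norm k \<Omega> (\<lambda>y. local_rep c d (P s) y - local_rep c d f y))\<^sup>2 < \<epsilon>\<^sup>2"
          using sobolev_add_smooth(2)[OF u(1) sD fin bD \<delta>] small unfolding eq C_def by (simp add: mult_ac)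
        then have "sobolev_norm k \<Omega> (\<lambda>y. local_rep c d (P s) y - local_rep c d f y) < \<epsilon>"
          using \<epsilon> by (simp add: power_less_imp_less_base)
        then show ?thesis
          using mem P sQ PK unfolding N sobolev_nbhd_def \<Omega>_def by blast
      qed
      then show "\<exists>T. open T \<and> s0 \<in> T \<and> T \<subseteq> {s. P s \<in> N}" using T by blast
    qed
    then show "openin euclideanreal (P -` N \<inter> topspace euclideanreal)"
      by (simp add: vimage_def)
  qed
  then show ?thesis by (simp add: P_def)
qed

text \<open>A subbasic neighbourhood of \<open>f\<close> consists of maps \<open>g\<close> with \<open>g ` K \<subseteq> fst d\<close>. When the chart \<open>d\<close> is
  restricted to a given neighbourhood of \<open>f m\<close> and \<open>K\<close> is a small compact neighbourhood of \<open>m\<close> in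
  \<open>M\<close>, this forces \<open>g\<close> to map all points near \<open>m\<close> close to \<open>f m\<close>.\<close>

lemma evaluation_jointly_continuous:
  fixes H :: "'z::topological_space \<Rightarrow> 'a::euclidean_space \<Rightarrow> 'a" and M :: "'a set"
  assumes M: "compact M"
    and H: "continuous_map (top_of_set T) (sobolev_maps_topology TYPE('e::euclidean_space) k M) H"
  shows "continuous_on (T \<times> M) (\<lambda>(z, m). H z m)"
  unfolding continuous_on_topological
proof (intro ballI allI impI)
  fix p :: "'z \<times> 'a" and B
  assume "p \<in> T \<times> M" and B: "open B" "(case p of (z, m) \<Rightarrow> H z m) \<in> B"
  then obtain z0 m0 where p: "p = (z0, m0)" "z0 \<in> T" "m0 \<in> M" and HB: "H z0 m0 \<in> B" by auto
  have f: "H z0 \<in> sobolev_maps TYPE('e) k M"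
    using continuous_map_image_subset_topspace[OF H] topspace_sobolev_maps_topology_subset p(2) by fastforce
  then have fc: "continuous_on M (H z0)" and fM: "H z0 \<in> M \<rightarrow> M"
    and loc: "\<forall>x\<in>M. \<exists>c\<in>charts M. \<exists>d\<in>charts M. x \<in> fst c \<and> H z0 ` fst c \<subseteq> fst d \<and>
        (local_rep c d (H z0) :: 'e \<Rightarrow> 'e) \<in> sobolev k (snd c ` fst c)"
    unfolding sobolev_maps_def by auto
  obtain c d :: "'a set \<times> ('a \<Rightarrow> 'e)" where c: "c \<in> charts M" and d: "d \<in> charts M"
    and m0: "m0 \<in> fst c" and fcd: "H z0 ` fst c \<subseteq> fst d"
    using bspec[OF loc p(3)] by (elim bexE conjE) (rule that)
  define d' where "d' = (fst d \<inter> (M \<inter> B), snd d)"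
  have d': "d' \<in> charts M" unfolding d'_def by (intro chart_restrict[OF d] openin_open_Int B)
  have "openin (top_of_set M) (fst c \<inter> (M \<inter> H z0 -` B))"
    by (intro openin_Int chart_openin[OF c] continuous_openin_preimage_gen[OF fc B(1)])
  moreover have "m0 \<in> fst c \<inter> (M \<inter> H z0 -` B)" using m0 p(3) HB by auto
  ultimately obtain r where r: "r > 0" "cball m0 r \<inter> M \<subseteq> fst c \<inter> (M \<inter> H z0 -` B)"
    unfolding openin_contains_cball by meson
  define K where "K = cball m0 r \<inter> M"
  have K: "compact K" "K \<subseteq> fst c" using r(2) M by (auto simp: K_def intro: compact_Int)
  have fK: "H z0 ` K \<subseteq> fst d'" using r(2) fcd fM by (auto simp: K_def d'_def)
  obtain \<epsilon> where \<epsilon>: "\<epsilon> > 0" "H z0 \<in> sobolev_nbhd k M c d' K \<epsilon> (H z0)"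
    using mem_sobolev_nbhd_self[OF f c K fK] by blast
  define N where "N = sobolev_nbhd k M c d' K \<epsilon> (H z0)"
  have "openin (sobolev_maps_topology TYPE('e) k M) N"
    unfolding N_def by (rule openin_sobolev_nbhd[OF f c d' K fK \<epsilon>(1)])
  then have "openin (top_of_set T) {z \<in> topspace (top_of_set T). H z \<in> N}"
    by (rule openin_continuous_map_preimage[OF H])
  then obtain A where A: "open A" "{z \<in> T. H z \<in> N} = T \<inter> A" by (auto simp: openin_open)
  have "\<forall>q\<in>T \<times> M. q \<in> A \<times> ball m0 r \<longrightarrow> (case q of (z, m) \<Rightarrow> H z m) \<in> B"
  proof (intro ballI impI)
    fix q assume "q \<in> T \<times> M" "q \<in> A \<times> ball m0 r"
    then obtain z m where q: "q = (z, m)" "z \<in> T" "m \<in> M" "z \<in> A" "m \<in> ball m0 r" by auto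
    then have "H z \<in> N" "m \<in> K" using A(2) by (auto simp: K_def)
    then have "H z m \<in> fst d'" by (auto simp: N_def sobolev_nbhd_def)
    then show "(case q of (z, m) \<Rightarrow> H z m) \<in> B" using q by (simp add: d'_def)
  qed
  moreover have "p \<in> A \<times> ball m0 r" using p r(1) A(2) \<epsilon>(2) by (auto simp: N_def)
  moreover have "open (A \<times> ball m0 r)" using A(1) by (intro open_Times) auto
  ultimately show "\<exists>A. open A \<and> p \<in> A \<and> (\<forall>y\<in>T \<times> M. y \<in> A \<longrightarrow> (case y of (z, m) \<Rightarrow> H z m) \<in> B)" by blast
qed

section \<open>The circle action on the product of spheres\<close>

lemma inner_add_orthogonal:
  fixes x p :: "'a::real_inner"
  assumes "x \<bullet> p = 0" "x \<bullet> x = 1" shows "(p + s *\<^sub>R x) \<bullet> (p + s *\<^sub>R x) = p \<bullet> p + s\<^sup>2"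
  using assms by (simp add: inner_add_left inner_add_right inner_commute[of p x] power2_eq_square)

text \<open>Project orthogonally to the product of the tangent spaces at \<open>x1\<close> and \<open>x2\<close>, which is isometric to
  the model space, on the part where both inner products are positive. The inverse adds to a tangent
  vector \<open>p\<close> the multiple \<open>sqrt (1 - |p|\<^sup>2)\<close> of the base point, which is smooth where \<open>|p| < 1\<close>.\<close>

lemma product_of_spheres_chart:
  fixes x1 :: "'a::euclidean_space" and x2 :: "'b::euclidean_space"
  assumes x: "norm x1 = 1" "norm x2 = 1" and dim: "DIM('e::euclidean_space) + 2 = DIM('a) + DIM('b)"
  shows "\<exists>c :: ('a \<times> 'b) set \<times> ('a \<times> 'b \<Rightarrow> 'e). c \<in> charts (sphere 0 1 \<times> sphere 0 1) \<and> (x1, x2) \<in> fst c"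
proof -
  define T1 where "T1 = {p. x1 \<bullet> p = 0}"
  define T2 where "T2 = {q. x2 \<bullet> q = 0}"
  have sT: "subspace T1" "subspace T2" by (simp_all add: T1_def T2_def subspace_hyperplane)
  have "dim T1 = DIM('a) - 1" "dim T2 = DIM('b) - 1"
    using x unfolding T1_def T2_def by (intro dim_hyperplane; auto)+
  moreover have "DIM('a) \<ge> 1" "DIM('b) \<ge> 1" by (simp_all add: Suc_leI)
  ultimately have d: "dim (UNIV :: 'e set) = dim (T1 \<times> T2)"
    using dim sT by (simp add: dim_Times)
  obtain f :: "'e \<Rightarrow> 'a \<times> 'b" and g where f: "linear f" "f ` UNIV = T1 \<times> T2" and g: "linear g"
    and gf: "\<And>y. g (f y) = y" and fg: "\<And>z. z \<in> T1 \<times> T2 \<Longrightarrow> f (g z) = z"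
    using isometries_subspaces[OF subspace_UNIV subspace_Times[OF sT] d] by (metis UNIV_I)
  have fT: "x1 \<bullet> fst (f y) = 0" "x2 \<bullet> snd (f y) = 0" for y
  proof -
    have "f y \<in> T1 \<times> T2" using f(2) by auto
    then show "x1 \<bullet> fst (f y) = 0" "x2 \<bullet> snd (f y) = 0" by (auto simp: T1_def T2_def)
  qed
  define proj where "proj = (\<lambda>m. (fst m - (x1 \<bullet> fst m) *\<^sub>R x1, snd m - (x2 \<bullet> snd m) *\<^sub>R x2))"
  define \<phi> where "\<phi> = (\<lambda>m. g (proj m))"
  define \<theta> where "\<theta> = (\<lambda>y. (fst (f y) + sqrt (1 - fst (f y) \<bullet> fst (f y)) *\<^sub>R x1, snd (f y) + sqrt (1 - snd (f y) \<bullet> snd (f y)) *\<^sub>R x2))"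
  define M :: "('a \<times> 'b) set" where "M = sphere 0 1 \<times> sphere 0 1"
  define U where "U = {m \<in> M. x1 \<bullet> fst m > 0 \<and> x2 \<bullet> snd m > 0}"
  define V where "V = {y. fst (f y) \<bullet> fst (f y) < 1 \<and> snd (f y) \<bullet> snd (f y) < 1}"
  have x11: "x1 \<bullet> x1 = 1" "x2 \<bullet> x2 = 1" using x by (simp_all add: dot_square_norm)
  have lf: "bounded_linear f" and lg: "bounded_linear g" using f(1) g linear_conv_bounded_linear by auto
  note sf = smooth_bounded_linear[OF lf open_UNIV]
  have V: "open V"
    unfolding V_def Collect_conj_eq
    by (intro open_Int open_Collect_less continuous_intros linear_continuous_on[OF lf])
  have \<theta>U: "\<theta> y \<in> U" and \<phi>\<theta>: "\<phi> (\<theta> y) = y" if y: "y \<in> V" for y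
  proof -
    let ?p = "fst (f y)" and ?q = "snd (f y)"
    let ?s = "sqrt (1 - ?p \<bullet> ?p)" and ?t = "sqrt (1 - ?q \<bullet> ?q)"
    have s: "?s > 0" "?t > 0" "?s\<^sup>2 = 1 - ?p \<bullet> ?p" "?t\<^sup>2 = 1 - ?q \<bullet> ?q" using y by (auto simp: V_def)
    have px: "x1 \<bullet> (?p + ?s *\<^sub>R x1) = ?s" "x2 \<bullet> (?q + ?t *\<^sub>R x2) = ?t"
      by (simp_all add: inner_add_right fT x11)
    have "(?p + ?s *\<^sub>R x1) \<bullet> (?p + ?s *\<^sub>R x1) = 1" "(?q + ?t *\<^sub>R x2) \<bullet> (?q + ?t *\<^sub>R x2) = 1"
      using s(3,4) by (simp_all only: inner_add_orthogonal[OF fT(1) x11(1)] inner_add_orthogonal[OF fT(2) x11(2)])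
    then have "norm (?p + ?s *\<^sub>R x1) = 1" "norm (?q + ?t *\<^sub>R x2) = 1"
      by (simp_all add: norm_eq_sqrt_inner)
    then show "\<theta> y \<in> U" using px s by (simp add: U_def M_def \<theta>_def)
    have "proj (\<theta> y) = f y"
      using px by (simp add: proj_def \<theta>_def)
    then show "\<phi> (\<theta> y) = y" by (simp add: \<phi>_def gf)
  qed
  have \<phi>V: "\<phi> m \<in> V" and \<theta>\<phi>: "\<theta> (\<phi> m) = m" if m: "m \<in> U" for m
  proof -
    have n: "fst m \<bullet> fst m = 1" "snd m \<bullet> snd m = 1" and pos: "x1 \<bullet> fst m > 0" "x2 \<bullet> snd m > 0"
      using m by (auto simp: U_def M_def dot_square_norm)
    have "proj m \<in> T1 \<times> T2" by (simp add: proj_def T1_def T2_def inner_diff_right x11)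
    then have fm: "f (\<phi> m) = proj m" by (simp add: \<phi>_def fg)
    have pp: "fst (proj m) \<bullet> fst (proj m) = 1 - (x1 \<bullet> fst m)\<^sup>2" "snd (proj m) \<bullet> snd (proj m) = 1 - (x2 \<bullet> snd m)\<^sup>2"
      by (simp_all add: proj_def inner_diff_left inner_diff_right n x11 inner_commute power2_eq_square)
    show "\<phi> m \<in> V" using pos by (simp add: V_def fm pp)
    have "sqrt (1 - fst (proj m) \<bullet> fst (proj m)) = x1 \<bullet> fst m" "sqrt (1 - snd (proj m) \<bullet> snd (proj m)) = x2 \<bullet> snd m"
      using pos by (simp_all add: pp)
    then show "\<theta> (\<phi> m) = m" by (simp add: \<theta>_def fm) (simp add: proj_def)
  qed
  have im: "\<phi> ` U = V" using \<theta>U \<phi>\<theta> \<phi>V by (metis (no_types, lifting) image_eqI subsetI subset_antisym image_subsetI)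
  have inj: "inj_on \<phi> U" by (rule inj_on_inverseI[where g=\<theta>]) (rule \<theta>\<phi>)
  have inv: "inv_into U \<phi> y = \<theta> y" if "y \<in> V" for y
    using inv_into_f_f[OF inj \<theta>U[OF that]] \<phi>\<theta>[OF that] by simp
  have s\<phi>: "smooth_on U \<phi>"
  proof (rule smooth_imp_smooth_on)
    show "smooth_on_open UNIV \<phi>"
      unfolding \<phi>_def proj_def
      by (intro smooth_compose_linear[OF lg] smooth_Pair smooth_diff smooth_scaleR
         smooth_inner smooth_fst smooth_snd smooth_id smooth_const open_UNIV)
  qed simp
  have sV: "smooth_on_open V f" by (rule smooth_UNIV_I[OF sf V])
  have s\<theta>: "smooth_on_open V \<theta>"
    unfolding \<theta>_def
    by (intro smooth_Pair smooth_add smooth_scaleR smooth_compose[OF _ smooth_sqrt]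
        smooth_diff smooth_inner smooth_fst smooth_snd sV smooth_const V)
      (auto simp: V_def)
  have "smooth_on (\<phi> ` U) (inv_into U \<phi>)"
    unfolding im by (rule smooth_on_cong[OF smooth_imp_smooth_on[OF s\<theta>]]) (use inv in auto)
  moreover have "openin (top_of_set M) U"
  proof -
    have "U = M \<inter> {m. x1 \<bullet> fst m > 0 \<and> x2 \<bullet> snd m > 0}" by (auto simp: U_def)
    moreover have "open {m. x1 \<bullet> fst m > 0 \<and> x2 \<bullet> snd m > (0::real)}"
      unfolding Collect_conj_eq by (intro open_Int open_Collect_less continuous_intros)
    ultimately show ?thesis by (metis openin_open_Int)
  qed
  ultimately have "(U, \<phi>) \<in> charts M" using inj s\<phi> V by (simp add: charts_def im)
  moreover have "(x1, x2) \<in> U" using x x11 by (simp add: U_def M_def)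
  ultimately show ?thesis unfolding M_def by (metis fst_conv)
qed

lemma S2xS3_covered_by_charts: "covered_by_charts TYPE(real^5) S2xS3"
  unfolding covered_by_charts_def
proof
  fix x assume "x \<in> S2xS3"
  then obtain a b where "x = (a, b)" "norm a = 1" "norm b = 1" by (auto simp: S2xS3_def)
  then show "\<exists>c :: ((real^3) \<times> (real^4)) set \<times> ((real^3) \<times> (real^4) \<Rightarrow> real^5). c \<in> charts S2xS3 \<and> x \<in> fst c"
    using product_of_spheres_chart[of a b, where 'e="real^5"] by (simp add: S2xS3_def)
qed

text \<open>The point \<open>u\<close> is fixed along an orbit, and \<open>\<theta> \<mapsto> exp (\<theta>u)\<close> is a homomorphism for fixed \<open>u\<close>;
  this is why left multiplication on the second factor is an action.\<close>

definition fibre_rotation :: "real \<Rightarrow> (real^3) \<times> (real^4) \<Rightarrow> (real^3) \<times> (real^4)" where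
  "fibre_rotation \<theta> m = (fst m, qmul (qexp \<theta> (fst m)) (snd m))"

lemma smooth_fibre_rotation: "smooth_on_open UNIV (\<lambda>p. fibre_rotation (fst p) (snd p))"
  unfolding fibre_rotation_def qexp_def
  by (intro smooth_Pair smooth_bilinear[OF bounded_bilinear_qmul] smooth_add smooth_scaleR
     smooth_compose[OF _ smooth_sin_cos(1)] smooth_compose[OF _ smooth_sin_cos(2)]
     smooth_compose_linear[OF bounded_linear_qim] smooth_fst smooth_snd smooth_id smooth_const open_UNIV)
    auto

lemma S2xS3_iff: "m \<in> S2xS3 \<longleftrightarrow> norm (fst m) = 1 \<and> norm (snd m) = 1"
  by (cases m) (simp add: S2xS3_def)

lemma fibre_rotation_in_S2xS3: "m \<in> S2xS3 \<Longrightarrow> fibre_rotation \<theta> m \<in> S2xS3"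
  by (simp add: S2xS3_iff fibre_rotation_def norm_qmul norm_qexp)

lemma fibre_rotation_0 [simp]: "fibre_rotation 0 m = m" by (simp add: fibre_rotation_def)

lemma fibre_rotation_add: "m \<in> S2xS3 \<Longrightarrow> fibre_rotation \<theta> (fibre_rotation \<psi> m) = fibre_rotation (\<theta> + \<psi>) m"
  by (simp add: S2xS3_iff fibre_rotation_def qmul_assoc[symmetric] qexp_add)

lemma fibre_rotation_period: "fibre_rotation (\<theta> + 2 * pi) m = fibre_rotation \<theta> m"
  by (simp add: fibre_rotation_def qexp_def)

lemma fibre_rotation_full_turns: "fibre_rotation (2 * pi * 2 ^ j) m = m"
proof -
  have "cos (2 * pi * 2 ^ j) = 1" "sin (2 * pi * 2 ^ j) = 0"
    using cos_int_2pin[of "2 ^ j"] sin_int_2pin[of "2 ^ j"] by simp_all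
  then show ?thesis by (simp add: fibre_rotation_def qexp_def)
qed

lemma S1_action_fibre_rotation: "S1_action S2xS3 fibre_rotation"
  unfolding S1_action_def
proof (intro conjI allI ballI)
  show "smooth_on (UNIV \<times> S2xS3) (\<lambda>(\<theta>, m). fibre_rotation \<theta> m)"
  proof -
    have "(\<lambda>(\<theta>, m). fibre_rotation \<theta> m) = (\<lambda>p. fibre_rotation (fst p) (snd p))" by auto
    then show ?thesis using smooth_imp_smooth_on[OF smooth_fibre_rotation] by simp
  qed
qed (auto simp: fibre_rotation_in_S2xS3 fibre_rotation_add fibre_rotation_period)

text \<open>Multiplied by the conjugate of its value at \<open>\<theta> = 0\<close>, the homotopy becomes a family as in
  \<open>homotopic_clutching\<close>. At one end it is \<open>exp (2\<pi>tu)\<close>, the square of \<open>exp (\<pi>tu)\<close>, at the other end it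
  is constant. But squaring has degree 2 and a constant map has degree 0.\<close>

lemma fibre_rotation_not_homotopic_to_trivial: "\<not> smoothly_homotopic S2xS3 fibre_rotation trivial_action"
proof
  assume "smoothly_homotopic S2xS3 fibre_rotation trivial_action"
  then obtain F :: "real \<Rightarrow> real \<Rightarrow> (real^3) \<times> (real^4) \<Rightarrow> (real^3) \<times> (real^4)" where "smooth_on ({0..1} \<times> UNIV \<times> S2xS3) (\<lambda>(t, \<theta>, m). F t \<theta> m) \<and>
      (\<forall>t\<in>{0..1}. \<forall>\<theta>. \<forall>m\<in>S2xS3. F t \<theta> m \<in> S2xS3 \<and> F t (\<theta> + 2 * pi) m = F t \<theta> m) \<and>
      (\<forall>\<theta>. \<forall>m\<in>S2xS3. F 0 \<theta> m = fibre_rotation \<theta> m \<and> F 1 \<theta> m = m)"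
    unfolding smoothly_homotopic_def trivial_action_def by blast
  then have F: "smooth_on ({0..1} \<times> UNIV \<times> S2xS3) (\<lambda>(t, \<theta>, m). F t \<theta> m)"
    and FM': "\<forall>t\<in>{0..1}. \<forall>\<theta>. \<forall>m\<in>S2xS3. F t \<theta> m \<in> S2xS3 \<and> F t (\<theta> + 2 * pi) m = F t \<theta> m"
    and F01': "\<forall>\<theta>. \<forall>m\<in>S2xS3. F 0 \<theta> m = fibre_rotation \<theta> m \<and> F 1 \<theta> m = m"
    by simp_all
  note FM = FM'[rule_format] and F01 = F01'[rule_format]
  define g where "g = (\<lambda>s t u. snd (F s (2 * pi * t) (u, qone)))"
  have uM: "(u, qone) \<in> S2xS3" if "norm u = 1" for u using that by (simp add: S2xS3_iff)
  have gn: "norm (g s t u) = 1" if "s \<in> {0..1}" "norm u = 1" for s t u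
    using FM[OF that(1) uM[OF that(2)]] by (simp add: g_def S2xS3_iff)
  have g1: "g s 1 u = g s 0 u" if "s \<in> {0..1}" "norm u = 1" for s u
    using FM[OF that(1) uM[OF that(2)], of 0] by (simp add: g_def)
  have ga: "g 0 t u = qexp (2 * (pi * t)) u" and gb: "g 1 t u = qone" if "norm u = 1" for t u
    using F01[OF uM[OF that]] by (simp_all add: g_def fibre_rotation_def mult.assoc)
  have cF: "continuous_on ({0..1} \<times> UNIV \<times> S2xS3) (\<lambda>(t, \<theta>, m). F t \<theta> m)"
    by (rule smooth_on_imp_continuous_on[OF F])
  have cg: "continuous_on A (\<lambda>z. g (a z) (b z) (c z))"
    if "continuous_on A a" "continuous_on A b" "continuous_on A c" "\<And>z. z \<in> A \<Longrightarrow> a z \<in> {0..1} \<and> norm (c z) = 1"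
    for A :: "(real \<times> real \<times> (real^3)) set" and a b c
  proof -
    have "continuous_on A (\<lambda>z. (\<lambda>(t, \<theta>, m). F t \<theta> m) (a z, 2 * pi * b z, (c z, qone)))"
      by (rule continuous_on_compose2[OF cF]) (use that uM in \<open>auto intro!: continuous_intros\<close>)
    then show ?thesis unfolding g_def by (auto intro: continuous_on_snd)
  qed
  have "homotopic_with_canon (\<lambda>_. True) S3 S3 qsquare (\<lambda>_. qone)"
  proof (rule homotopic_clutching[where H="\<lambda>s t u. qmul (qconj (g s 0 u)) (g s t u)"])
    show "continuous_on ({0..1} \<times> {0..1} \<times> sphere 0 1) (\<lambda>(s, t, u). qmul (qconj (g s 0 u)) (g s t u))"
      unfolding case_prod_beta
      by (intro qmul.continuous_on bounded_linear.continuous_on[OF bounded_linear_qconj] cg continuous_intros) auto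
  qed (auto simp: norm_qmul gn g1 ga gb qmul_qconj qsquare_qexp, (simp_all add: vec4_eq_iff)?)
  then have "S3_degree qsquare = S3_degree (\<lambda>_. qone)" by (rule S3_degree_homotopic)
  then show False by (simp add: S3_degree_qsquare S3_degree_const)
qed

definition rotation_loop :: "nat \<Rightarrow> real \<Rightarrow> (real^3) \<times> (real^4) \<Rightarrow> (real^3) \<times> (real^4)" where
  "rotation_loop j s = restrict (fibre_rotation (2 * pi * 2 ^ j * s)) S2xS3"

abbreviation Diff_S2xS3 :: "nat \<Rightarrow> ((real^3) \<times> (real^4) \<Rightarrow> (real^3) \<times> (real^4)) topology" where
  "Diff_S2xS3 k \<equiv> Diff_topology TYPE(real^5) k S2xS3"

abbreviation id_S2xS3 :: "(real^3) \<times> (real^4) \<Rightarrow> (real^3) \<times> (real^4)" where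
  "id_S2xS3 \<equiv> restrict id S2xS3"

lemma rotation_loop_in_loops: "rotation_loop j \<in> loops (Diff_S2xS3 k) id_S2xS3"
proof -
  have sm: "smooth_on (UNIV \<times> S2xS3) (\<lambda>p. fibre_rotation (2 * pi * 2 ^ j * fst p) (snd p))"
  proof (rule smooth_imp_smooth_on)
    have "smooth_on_open UNIV (\<lambda>p :: real \<times> (real^3) \<times> (real^4). (2 * pi * 2 ^ j * fst p, snd p))"
      by (intro smooth_Pair smooth_mult smooth_fst smooth_snd smooth_id smooth_const open_UNIV)
    from smooth_compose[OF this smooth_fibre_rotation]
    show "smooth_on_open UNIV (\<lambda>p. fibre_rotation (2 * pi * 2 ^ j * fst p) (snd p))" by simp
  qed simp
  have "(\<lambda>p. fibre_rotation (2 * pi * 2 ^ j * fst p) (snd p)) ` (UNIV \<times> S2xS3) \<subseteq> S2xS3"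
    by (auto intro: fibre_rotation_in_S2xS3)
  from continuous_map_smooth_family[OF S2xS3_covered_by_charts sm this, of k]
  have "continuous_map euclideanreal (sobolev_maps_topology TYPE(real^5) k S2xS3) (rotation_loop j)"
    by (simp add: rotation_loop_def[abs_def])
  then have "continuous_map (top_of_set {0..1}) (sobolev_maps_topology TYPE(real^5) k S2xS3) (rotation_loop j)"
    by (rule continuous_map_from_subtopology)
  moreover have "rotation_loop j s \<in> Diff TYPE(real^5) k S2xS3" for s
    unfolding rotation_loop_def
  proof (rule smooth_imp_Diff[OF S2xS3_covered_by_charts])
    have sf: "smooth_on S2xS3 (fibre_rotation \<theta>)" for \<theta>
    proof (rule smooth_imp_smooth_on)
      have "smooth_on_open UNIV (\<lambda>m :: (real^3) \<times> (real^4). (\<theta>, m))"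
        by (intro smooth_Pair smooth_id smooth_const open_UNIV)
      from smooth_compose[OF this smooth_fibre_rotation] show "smooth_on_open UNIV (fibre_rotation \<theta>)" by simp
    qed simp
    show "smooth_on S2xS3 (fibre_rotation (2 * pi * 2 ^ j * s))" "smooth_on S2xS3 (fibre_rotation (- (2 * pi * 2 ^ j * s)))"
      by (rule sf)+
  qed (auto simp: fibre_rotation_in_S2xS3 fibre_rotation_add)
  ultimately have "pathin (Diff_S2xS3 k) (rotation_loop j)"
    by (auto simp: pathin_def Diff_topology_def continuous_map_in_subtopology)
  moreover have "rotation_loop j 0 = id_S2xS3" "rotation_loop j 1 = id_S2xS3"
    by (simp_all add: rotation_loop_def fibre_rotation_full_turns restrict_def fun_eq_iff)
  ultimately show ?thesis by (simp add: loops_def)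
qed

text \<open>Evaluated at \<open>(u, 1)\<close>, the loop \<open>rotation_loop j\<close> is \<open>exp (2\<pi> 2\<^sup>j t u)\<close>, which is
  \<open>exp (\<pi>tu)\<close> squared \<open>j + 1\<close> times. So a homotopy of loops forces the degrees \<open>2\<^bsup>i+1\<^esup>\<close> and
  \<open>2\<^bsup>j+1\<^esup>\<close> to agree.\<close>

lemma rotation_loops_not_homotopic:
  assumes "(rotation_loop i, rotation_loop j) \<in> loop_rel (Diff_S2xS3 k) id_S2xS3"
  shows "i = j"
proof -
  obtain h where h: "continuous_map (prod_topology (top_of_set {0..1::real}) (top_of_set {0..1::real})) (Diff_S2xS3 k) h"
    and h0: "\<And>t. h (0, t) = rotation_loop i t" and h1: "\<And>t. h (1, t) = rotation_loop j t"
    and e: "\<And>s. s \<in> {0..1} \<Longrightarrow> h (s, 0) = id_S2xS3 \<and> h (s, 1) = id_S2xS3"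
    using assms by (auto simp: loop_rel_def homotopic_with_def)
  have h': "continuous_map (top_of_set ({0..1::real} \<times> {0..1::real})) (sobolev_maps_topology TYPE(real^5) k S2xS3) h"
    using h by (simp add: Diff_topology_def continuous_map_in_subtopology subtopology_Times[symmetric] euclidean_product_topology[symmetric])
  have hM: "h z \<in> S2xS3 \<rightarrow> S2xS3" if "z \<in> {0..1} \<times> {0..1}" for z
  proof -
    have "h z \<in> sobolev_maps TYPE(real^5) k S2xS3"
      using continuous_map_image_subset_topspace[OF h'] topspace_sobolev_maps_topology_subset that by fastforce
    then show ?thesis by (auto simp: sobolev_maps_def)
  qed
  have "compact S2xS3" by (simp add: S2xS3_def compact_Times)
  then have ev: "continuous_on (({0..1} \<times> {0..1}) \<times> S2xS3) (\<lambda>(z, m). h z m)"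
    using h' by (rule evaluation_jointly_continuous)
  have uM: "(u, qone) \<in> S2xS3" if "norm u = 1" for u using that by (simp add: S2xS3_iff)
  have rl: "snd (rotation_loop n t (u, qone)) = (qsquare ^^ Suc n) (qexp (pi * t) u)" if "norm u = 1" for n t u
    using that uM by (simp add: rotation_loop_def fibre_rotation_def qsquare_pow_qexp mult_ac del: funpow.simps)
  have "homotopic_with_canon (\<lambda>_. True) S3 S3 (qsquare ^^ Suc i) (qsquare ^^ Suc j)"
  proof (rule homotopic_clutching[where H="\<lambda>s t u. snd (h (s, t) (u, qone))"])
    have "continuous_on ({0..1} \<times> {0..1} \<times> sphere 0 1) (\<lambda>p::real \<times> real \<times> (real^3). (\<lambda>(z, m). h z m) ((fst p, fst (snd p)), (snd (snd p), qone)))"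
      by (rule continuous_on_compose2[OF ev]) (use uM in \<open>auto intro!: continuous_intros\<close>)
    then show "continuous_on ({0..1} \<times> {0..1} \<times> sphere 0 1) (\<lambda>(s, t, u). snd (h (s, t) (u, qone)))"
      by (auto simp: case_prod_beta intro: continuous_on_snd)
    show "snd (h (s, t) (u, qone)) \<in> S3" if "s \<in> {0..1}" "t \<in> {0..1}" "norm u = 1" for s t u
    proof -
      have "h (s, t) (u, qone) \<in> S2xS3" using hM[of "(s, t)"] uM that by auto
      then show ?thesis by (simp add: S2xS3_iff)
    qed
  qed (simp_all add: e uM h0 h1 rl del: funpow.simps)
  then have "S3_degree (qsquare ^^ Suc i) = S3_degree (qsquare ^^ Suc j)" by (rule S3_degree_homotopic)
  then show ?thesis by (simp add: S3_degree_qsquare_pow del: funpow.simps)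
qed

lemma infinite_fundamental_group_Diff: "infinite (carrier (fundamental_group (Diff_S2xS3 k) id_S2xS3))"
proof -
  let ?R = "loop_rel (Diff_S2xS3 k) id_S2xS3"
  have refl: "(rotation_loop j, rotation_loop j) \<in> ?R" for j
  proof -
    have "rotation_loop j \<in> loops (Diff_S2xS3 k) id_S2xS3" by (rule rotation_loop_in_loops)
    then show ?thesis
      by (auto simp: loop_rel_def loops_def pathin_def)
  qed
  have "inj (\<lambda>j. ?R `` {rotation_loop j})"
  proof (rule injI)
    fix i j assume "?R `` {rotation_loop i} = ?R `` {rotation_loop j}"
    then have "(rotation_loop i, rotation_loop j) \<in> ?R" using refl[of j] by blast
    then show "i = j" by (rule rotation_loops_not_homotopic)
  qed
  then have "infinite (range (\<lambda>j. ?R `` {rotation_loop j}))" by (rule range_inj_infinite)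
  moreover have "range (\<lambda>j. ?R `` {rotation_loop j}) \<subseteq> carrier (fundamental_group (Diff_S2xS3 k) id_S2xS3)"
    by (auto simp: fundamental_group_def intro: quotientI rotation_loop_in_loops)
  ultimately show ?thesis by (rule infinite_super[rotated])
qed

theorem theorem6p5:
  shows "(\<exists>a. S1_action S2xS3 a \<and> \<not> smoothly_homotopic S2xS3 a trivial_action) \<and>
    (\<forall>k::nat. real k > 5 / 2 + 1 \<longrightarrow>
      infinite (carrier (fundamental_group (Diff_topology TYPE(real^5) k S2xS3)
        (restrict id S2xS3))))"
  using S1_action_fibre_rotation fibre_rotation_not_homotopic_to_trivial infinite_fundamental_group_Diff by blast

end
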